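(* For each $n\in\mathbb{N}$ let $\mathcal{A}_n$ be a unital $*$-algebra with a distinguished state $\phi_n$ and conditions $\psi_{n,1},\dots,\psi_{n,n}$, let $(\phi_{i,j}(n))_{1\le i,j\le n}$ be the array of states $\phi_{j,j}(n)=\phi_n$ and $\phi_{i,j}(n)=\psi_{n,j}$ for $i\neq j$, and let $(X_{i,j}(n))_{1\le i,j\le n}$ be an array of self-adjoint elements of $\mathcal{A}_n$. Assume that (1) for each $n$ the array $(X_{i,j}(n))$ is matricially free with respect to $(\phi_{i,j}(n))$; (2) $\phi_{i,j}(n)(X_{i,j}(n))=0$ and $\phi_{i,j}(n)(X_{i,j}^2(n))=v_{i,j}(n)$ for all $n$ and $i,j\in[n]$; (3) the moments of the $X_{i,j}(n)$ are uniformly bounded with respect to $(\phi_{i,j}(n))$; (4) for each $n$ the variance matrix $V(n)=(v_{i,j}(n))$ is of block form determined by a dimension matrix $D=\mathrm{diag}(d_1,\dots,d_r)$ and a matrix $U=(u_{i,j})\in M_r(\mathbb{R})$. Let $S(n)=\sum_{i,j=1}^n X_{i,j}(n)$. Then, as $n\to\infty$, the $\phi_n$-distributions of $S(n)$ converge weakly (in the sense of convergence of all moments) to the distribution $$\mu_0=\mu_{1,1}\uplus\mu_{2,2}\uplus\dots\uplus\mu_{r,r},$$ where, for each $j\in[r]$, $\mu_{j,j}$ is the probability measure with K-transform $K_{j,j}$ associated with the matrix $B=DU$.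
   Context: Notation: $[n]=\{1,\dots,n\}$; $(i_1,j_1)\ne\dots\ne(i_n,j_n)$ means that consecutive pairs differ. A state on a unital $*$-algebra is a normalized positive linear functional. The $\phi$-distribution of $S$ is given by the moments $\phi(S^m)$. Matricial freeness. Let $\Lambda=\bigcup_{n\ge1}\Lambda_n$, where $\Lambda_n=\{((i_1,i_2),(i_2,i_3),\dots,(i_n,i_n)):(i_1,i_2)\ne(i_2,i_3)\ne\dots\ne(i_n,i_n)\}$. Let $\mathcal{A}$ be a unital $*$-algebra, $(\mathcal{A}_{i,j})_{i,j\in I}$ an array of (not necessarily unital) $*$-subalgebras, each with an internal unit $1_{i,j}$ which is a projection, such that the subalgebra $\mathcal{I}$ generated by all $1_{i,j}$ is commutative. Let $\varphi$ be a distinguished state with $\varphi(1_{i,j})=\delta_{i,j}$ and let $\varphi_j$ ($j\in I$) be states, called conditions, with $\varphi_j(1_{i,k})=\delta_{j,k}$ for all $i,j,k$. Put $\varphi_{j,j}=\varphi$ and $\varphi_{i,j}=\varphi_j$ for $i\ne j$. The array $(\mathcal{A}_{i,j})$ is matricially free with respect to $(\varphi_{i,j})$ if: (a) $\varphi(a_1\cdots a_n)=0$ whenever $a_k\in\mathcal{A}_{i_k,j_k}\cap\ker\varphi_{i_k,j_k}$ for $k\in[n]$ and $(i_1,j_1)\ne\dots\ne(i_n,j_n)$; (b) $(1_{i,j})$ is a matricially free array of units: $\varphi(u_1au_2)=\varphi(u_1)\varphi(a)\varphi(u_2)$ for $a\in\mathcal{A}$, $u_1,u_2\in\mathcal{I}$,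 and, if $a\in\mathcal A$, $a_k\in\mathcal{A}_{i_k,j_k}\cap\ker\varphi_{i_k,j_k}$ for $r<k\le n$, $r<n$ and $(i_r,j_r)\ne\dots\ne(i_n,j_n)$, then $\varphi(a1_{i_r,j_r}a_{r+1}\cdots a_n)$ equals $\varphi(aa_{r+1}\cdots a_n)$ if $((i_r,j_r),\dots,(i_n,j_n))\in\Lambda$ and $0$ otherwise. An array of self-adjoint variables $(a_{i,j})$ in $\mathcal{A}$ is matricially free with respect to $(\varphi_{i,j})$ if there are projections $1_{i,j}\in\mathcal{A}$ such that the array of algebras $(\mathbb{C}[a_{i,j},1_{i,j}])$, with $1_{i,j}$ the internal unit, is matricially free with respect to $(\varphi_{i,j})$. Uniform boundedness: for every $m\in\mathbb{N}$ there is $M_m\ge0$ with $|\phi_{i,j}(n)(X_{i,j}^m(n))|\le M_m n^{-m/2}$ for all $n$ and $i,j\in[n]$. Block form. $d_1,\dots,d_r>0$ with $\sum_k d_k=1$; $U=(u_{i,j})$ has $u_{j,j}>0$ and $u_{i,j}\ge0$ for $i\neq j$. For each $n$ let $n_k=\lfloor (d_1+\dots+d_k)n\rfloor-\lfloor (d_1+\dots+d_{k-1})n\rfloor$ and split $[n]=N_1\cup\dots\cup N_r$ into consecutive intervals with $|N_k|=n_k$. Block form means $v_{p,q}(n)=u_{i,j}/n$ whenever $p\in N_i$, $q\in N_j$. Transforms. For a probability measure $\mu$ on $\mathbb{R}$ with Cauchy transform $G_\mu$, $F_\mu=1/G_\mu$ and $K_\mu(z)=z-F_\mu(z)$ is the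 K-transform ($z\in\mathbb{C}^+$). The boolean convolution $\mu\uplus\nu$ is the probability measure with $K_{\mu\uplus\nu}=K_\mu+K_\nu$. For $B=(b_{i,j})\in M_r(\mathbb{R})$ with nonnegative entries, put $K^{(0)}_{i,j}(z)=b_{i,j}/z$ and $K^{(m)}_{i,j}(z)=b_{i,j}/(z-\sum_{p=1}^r K^{(m-1)}_{p,i}(z))$ for $m\ge1$; $K_{i,j}=\lim_m K_{i,j}^{(m)}$ (locally uniformly on $\mathbb{C}^+$) is the continued fraction $K_{i,j}(z)=\cfrac{b_{i,j}}{z-\sum_k\cfrac{b_{k,i}}{z-\sum_p\cfrac{b_{p,k}}{z-\cdots}}}$ and it is the K-transform of a compactly supported probability measure $\mu_{i,j}$ on $\mathbb{R}$. *)

theory Defs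
  imports "HOL-Probability.Probability" "HOL-Algebra.Module"
begin

section \<open>Unital $*$-algebras and states\<close>

definition complex_ring :: "complex ring" where
  "complex_ring = \<lparr>carrier = UNIV, mult = (*), one = 1, zero = 0, add = (+)\<rparr>"

record 'a star_algebra = "(complex, 'a) module" +
  adj :: "'a \<Rightarrow> 'a"

text \<open>Carrier-based, so that the algebras of a sequence may be genuinely different (with different
  units and operations) although their elements live in one HOL type.\<close>

locale unital_star_algebra = module complex_ring A + ring A
  for A :: "('a, 'm) star_algebra_scheme" (structure) +
  assumes smult_mult_left:
      "\<lbrakk>x \<in> carrier A; y \<in> carrier A\<rbrakk> \<Longrightarrow> (c \<odot> x) \<otimes> y = c \<odot> (x \<otimes> y)"
    and smult_mult_right:
      "\<lbrakk>x \<in> carrier A; y \<in> carrier A\<rbrakk> \<Longrightarrow> x \<otimes> (c \<odot> y) = c \<odot> (x \<otimes> y)"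
    and adj_closed: "x \<in> carrier A \<Longrightarrow> adj A x \<in> carrier A"
    and adj_adj: "x \<in> carrier A \<Longrightarrow> adj A (adj A x) = x"
    and adj_add:
      "\<lbrakk>x \<in> carrier A; y \<in> carrier A\<rbrakk> \<Longrightarrow> adj A (x \<oplus> y) = adj A x \<oplus> adj A y"
    and adj_smult: "x \<in> carrier A \<Longrightarrow> adj A (c \<odot> x) = cnj c \<odot> adj A x"
    and adj_mult:
      "\<lbrakk>x \<in> carrier A; y \<in> carrier A\<rbrakk> \<Longrightarrow> adj A (x \<otimes> y) = adj A y \<otimes> adj A x"

definition state :: "('a, 'm) star_algebra_scheme \<Rightarrow> ('a \<Rightarrow> complex) \<Rightarrow> bool" where
  "state A \<phi> \<longleftrightarrow>
     (\<forall>x\<in>carrier A. \<forall>y\<in>carrier A. \<phi> (x \<oplus>\<^bsub>A\<^esub> y) = \<phi> x + \<phi> y) \<and>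
     (\<forall>c. \<forall>x\<in>carrier A. \<phi> (c \<odot>\<^bsub>A\<^esub> x) = c * \<phi> x) \<and>
     (\<forall>x\<in>carrier A. \<phi> (adj A x \<otimes>\<^bsub>A\<^esub> x) \<in> \<real>\<^sub>\<ge>\<^sub>0) \<and>
     \<phi> \<one>\<^bsub>A\<^esub> = 1"

definition self_adjoint :: "('a, 'm) star_algebra_scheme \<Rightarrow> 'a \<Rightarrow> bool" where
  "self_adjoint A x \<longleftrightarrow> x \<in> carrier A \<and> adj A x = x"

definition projection :: "('a, 'm) star_algebra_scheme \<Rightarrow> 'a \<Rightarrow> bool" where
  "projection A x \<longleftrightarrow> self_adjoint A x \<and> x \<otimes>\<^bsub>A\<^esub> x = x"

text \<open>Subalgebras need not contain the unit of the ambient algebra.\<close>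

definition is_subalgebra :: "('a, 'm) star_algebra_scheme \<Rightarrow> 'a set \<Rightarrow> bool" where
  "is_subalgebra A B \<longleftrightarrow>
     B \<subseteq> carrier A \<and> \<zero>\<^bsub>A\<^esub> \<in> B \<and>
     (\<forall>x\<in>B. \<forall>y\<in>B. x \<oplus>\<^bsub>A\<^esub> y \<in> B) \<and>
     (\<forall>c. \<forall>x\<in>B. c \<odot>\<^bsub>A\<^esub> x \<in> B) \<and>
     (\<forall>x\<in>B. \<forall>y\<in>B. x \<otimes>\<^bsub>A\<^esub> y \<in> B)"

definition is_star_subalgebra :: "('a, 'm) star_algebra_scheme \<Rightarrow> 'a set \<Rightarrow> bool" where
  "is_star_subalgebra A B \<longleftrightarrow> is_subalgebra A B \<and> (\<forall>x\<in>B. adj A x \<in> B)"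

definition gen_subalgebra :: "('a, 'm) star_algebra_scheme \<Rightarrow> 'a set \<Rightarrow> 'a set" where
  "gen_subalgebra A S = \<Inter>{B. is_subalgebra A B \<and> S \<subseteq> B}"

definition internal_unit :: "('a, 'm) star_algebra_scheme \<Rightarrow> 'a set \<Rightarrow> 'a \<Rightarrow> bool" where
  "internal_unit A B e \<longleftrightarrow> e \<in> B \<and> (\<forall>x\<in>B. e \<otimes>\<^bsub>A\<^esub> x = x \<and> x \<otimes>\<^bsub>A\<^esub> e = x)"


section \<open>Matricial freeness\<close>

definition Lambda_seqs :: "'i set \<Rightarrow> ('i \<times> 'i) list set" where
  "Lambda_seqs I = {ps. ps \<noteq> [] \<and> set ps \<subseteq> I \<times> I \<and> distinct_adj ps \<and>
     successively (\<lambda>p q. snd p = fst q) ps \<and> fst (last ps) = snd (last ps)}"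

definition state_array :: "('a \<Rightarrow> complex) \<Rightarrow> ('i \<Rightarrow> 'a \<Rightarrow> complex) \<Rightarrow> 'i \<Rightarrow> 'i \<Rightarrow> 'a \<Rightarrow> complex" where
  "state_array \<phi> \<psi> i j = (if i = j then \<phi> else \<psi> j)"

definition word_prod :: "('a, 'm) star_algebra_scheme \<Rightarrow> 'a list \<Rightarrow> 'a" where
  "word_prod A as = foldr (\<lambda>x y. x \<otimes>\<^bsub>A\<^esub> y) as \<one>\<^bsub>A\<^esub>"

text \<open>\<open>centered_word \<Phi> Alg ps as\<close>: the word \<open>as\<close> has as many letters as \<open>ps\<close> has indices, and each
  letter lies in the algebra with the corresponding index and in the kernel of the corresponding state.\<close>

definition centered_word ::
  "('i \<Rightarrow> 'i \<Rightarrow> 'a \<Rightarrow> complex) \<Rightarrow> ('i \<Rightarrow> 'i \<Rightarrow> 'a set) \<Rightarrow> ('i \<times> 'i) list \<Rightarrow> 'a list \<Rightarrow> bool" where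
  "centered_word \<Phi> Alg ps as \<longleftrightarrow>
     list_all2 (\<lambda>(i, j) a. a \<in> Alg i j \<and> \<Phi> i j a = 0) ps as"

definition unit_algebra ::
  "('a, 'm) star_algebra_scheme \<Rightarrow> 'i set \<Rightarrow> ('i \<Rightarrow> 'i \<Rightarrow> 'a) \<Rightarrow> 'a set" where
  "unit_algebra A I e = gen_subalgebra A {e i j | i j. i \<in> I \<and> j \<in> I}"

text \<open>The standing assumptions on an array of algebras \<open>Alg i j\<close> with internal units \<open>e i j\<close>, a
  distinguished state \<open>\<phi>\<close> and conditions \<open>\<psi> j\<close>.\<close>

definition matricial_setting ::
  "('a, 'm) star_algebra_scheme \<Rightarrow> 'i set \<Rightarrow> ('a \<Rightarrow> complex) \<Rightarrow> ('i \<Rightarrow> 'a \<Rightarrow> complex) \<Rightarrow>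
   ('i \<Rightarrow> 'i \<Rightarrow> 'a set) \<Rightarrow> ('i \<Rightarrow> 'i \<Rightarrow> 'a) \<Rightarrow> bool" where
  "matricial_setting A I \<phi> \<psi> Alg e \<longleftrightarrow>
     unital_star_algebra A \<and> state A \<phi> \<and> (\<forall>j\<in>I. state A (\<psi> j)) \<and>
     (\<forall>i\<in>I. \<forall>j\<in>I. is_star_subalgebra A (Alg i j) \<and> internal_unit A (Alg i j) (e i j) \<and>
        projection A (e i j)) \<and>
     (\<forall>x\<in>unit_algebra A I e. \<forall>y\<in>unit_algebra A I e. x \<otimes>\<^bsub>A\<^esub> y = y \<otimes>\<^bsub>A\<^esub> x) \<and>
     (\<forall>i\<in>I. \<forall>j\<in>I. \<phi> (e i j) = (if i = j then 1 else 0)) \<and>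
     (\<forall>i\<in>I. \<forall>j\<in>I. \<forall>k\<in>I. \<psi> j (e i k) = (if j = k then 1 else 0))"

text \<open>In the second condition the index list \<open>p # ps\<close> is $(i_r,j_r),\dots,(i_n,j_n)$ and \<open>as\<close> is
  $a_{r+1},\dots,a_n$; the restriction $r<n$ is \<open>ps \<noteq> []\<close>.\<close>

definition matricially_free_units ::
  "('a, 'm) star_algebra_scheme \<Rightarrow> 'i set \<Rightarrow> ('a \<Rightarrow> complex) \<Rightarrow> ('i \<Rightarrow> 'a \<Rightarrow> complex) \<Rightarrow>
   ('i \<Rightarrow> 'i \<Rightarrow> 'a set) \<Rightarrow> ('i \<Rightarrow> 'i \<Rightarrow> 'a) \<Rightarrow> bool" where
  "matricially_free_units A I \<phi> \<psi> Alg e \<longleftrightarrow>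
     (\<forall>a\<in>carrier A. \<forall>u1\<in>unit_algebra A I e. \<forall>u2\<in>unit_algebra A I e.
        \<phi> (u1 \<otimes>\<^bsub>A\<^esub> a \<otimes>\<^bsub>A\<^esub> u2) = \<phi> u1 * \<phi> a * \<phi> u2) \<and>
     (\<forall>a\<in>carrier A. \<forall>p ps as.
        ps \<noteq> [] \<and> set (p # ps) \<subseteq> I \<times> I \<and> distinct_adj (p # ps) \<and>
        centered_word (state_array \<phi> \<psi>) Alg ps as \<longrightarrow>
        \<phi> (a \<otimes>\<^bsub>A\<^esub> e (fst p) (snd p) \<otimes>\<^bsub>A\<^esub> word_prod A as) =
          (if p # ps \<in> Lambda_seqs I then \<phi> (a \<otimes>\<^bsub>A\<^esub> word_prod A as) else 0))"

definition matricially_free ::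
  "('a, 'm) star_algebra_scheme \<Rightarrow> 'i set \<Rightarrow> ('a \<Rightarrow> complex) \<Rightarrow> ('i \<Rightarrow> 'a \<Rightarrow> complex) \<Rightarrow>
   ('i \<Rightarrow> 'i \<Rightarrow> 'a set) \<Rightarrow> ('i \<Rightarrow> 'i \<Rightarrow> 'a) \<Rightarrow> bool" where
  "matricially_free A I \<phi> \<psi> Alg e \<longleftrightarrow>
     matricial_setting A I \<phi> \<psi> Alg e \<and>
     (\<forall>ps as. ps \<noteq> [] \<and> set ps \<subseteq> I \<times> I \<and> distinct_adj ps \<and>
        centered_word (state_array \<phi> \<psi>) Alg ps as \<longrightarrow> \<phi> (word_prod A as) = 0) \<and>
     matricially_free_units A I \<phi> \<psi> Alg e"

definition matricially_free_variables ::
  "('a, 'm) star_algebra_scheme \<Rightarrow> 'i set \<Rightarrow> ('a \<Rightarrow> complex) \<Rightarrow> ('i \<Rightarrow> 'a \<Rightarrow> complex) \<Rightarrow>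
   ('i \<Rightarrow> 'i \<Rightarrow> 'a) \<Rightarrow> bool" where
  "matricially_free_variables A I \<phi> \<psi> X \<longleftrightarrow>
     (\<exists>e. (\<forall>i\<in>I. \<forall>j\<in>I. projection A (e i j)) \<and>
        matricially_free A I \<phi> \<psi> (\<lambda>i j. gen_subalgebra A {X i j, e i j}) e)"


section \<open>Variance matrices of block form\<close>

definition block_size :: "(nat \<Rightarrow> real) \<Rightarrow> nat \<Rightarrow> nat \<Rightarrow> nat" where
  "block_size d n k =
     nat (\<lfloor>(\<Sum>l=1..k. d l) * real n\<rfloor> - \<lfloor>(\<Sum>l=1..<k. d l) * real n\<rfloor>)"

definition block :: "(nat \<Rightarrow> real) \<Rightarrow> nat \<Rightarrow> nat \<Rightarrow> nat set" where
  "block d n k = {(\<Sum>l=1..<k. block_size d n l)<..(\<Sum>l=1..k. block_size d n l)}"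

definition block_form ::
  "nat \<Rightarrow> (nat \<Rightarrow> real) \<Rightarrow> (nat \<Rightarrow> nat \<Rightarrow> real) \<Rightarrow> nat \<Rightarrow> (nat \<Rightarrow> nat \<Rightarrow> real) \<Rightarrow> bool" where
  "block_form r d u n v \<longleftrightarrow>
     (\<forall>i\<in>{1..r}. \<forall>j\<in>{1..r}. \<forall>p\<in>block d n i. \<forall>q\<in>block d n j. v p q = u i j / real n)"


section \<open>Transforms, boolean convolution and continued fractions\<close>

definition cauchy_transform :: "real measure \<Rightarrow> complex \<Rightarrow> complex" where
  "cauchy_transform \<mu> z = (\<integral>x. 1 / (z - complex_of_real x) \<partial>\<mu>)"

definition F_transform :: "real measure \<Rightarrow> complex \<Rightarrow> complex" where
  "F_transform \<mu> z = 1 / cauchy_transform \<mu> z"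

definition K_transform :: "real measure \<Rightarrow> complex \<Rightarrow> complex" where
  "K_transform \<mu> z = z - F_transform \<mu> z"

definition has_K_transform :: "real measure \<Rightarrow> (complex \<Rightarrow> complex) \<Rightarrow> bool" where
  "has_K_transform \<mu> K \<longleftrightarrow>
     real_distribution \<mu> \<and> (\<forall>z. Im z > 0 \<longrightarrow> K_transform \<mu> z = K z)"

text \<open>Meaningful only if such a measure exists; it is then unique, by Stieltjes inversion.\<close>

definition measure_of_K :: "(complex \<Rightarrow> complex) \<Rightarrow> real measure" where
  "measure_of_K K = (THE \<mu>. has_K_transform \<mu> K)"

definition boolean_conv :: "real measure \<Rightarrow> real measure \<Rightarrow> real measure" (infixl \<open>\<uplus>\<^sub>b\<close> 65) where
  "\<mu> \<uplus>\<^sub>b \<nu> = measure_of_K (\<lambda>z. K_transform \<mu> z + K_transform \<nu> z)"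

text \<open>$\mu_1\uplus\dots\uplus\mu_r$, for $r\ge1$\<close>

definition boolean_conv_upto :: "(nat \<Rightarrow> real measure) \<Rightarrow> nat \<Rightarrow> real measure" where
  "boolean_conv_upto \<mu> r = foldl (\<uplus>\<^sub>b) (\<mu> 1) (map \<mu> [2..<Suc r])"

fun K_approx :: "nat \<Rightarrow> (nat \<Rightarrow> nat \<Rightarrow> real) \<Rightarrow> nat \<Rightarrow> nat \<Rightarrow> nat \<Rightarrow> complex \<Rightarrow> complex" where
  "K_approx r b 0 i j z = of_real (b i j) / z"
| "K_approx r b (Suc m) i j z = of_real (b i j) / (z - (\<Sum>p=1..r. K_approx r b m p i z))"

text \<open>Only used on the upper half-plane, where the convergence is locally uniform, so that the pointwise
  limit is the right function.\<close>

definition K_fraction :: "nat \<Rightarrow> (nat \<Rightarrow> nat \<Rightarrow> real) \<Rightarrow> nat \<Rightarrow> nat \<Rightarrow> complex \<Rightarrow> complex" where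
  "K_fraction r b i j z = lim (\<lambda>m. K_approx r b m i j z)"

definition K_measure :: "nat \<Rightarrow> (nat \<Rightarrow> nat \<Rightarrow> real) \<Rightarrow> nat \<Rightarrow> nat \<Rightarrow> real measure" where
  "K_measure r b i j = measure_of_K (K_fraction r b i j)"

text \<open>Integrability is required explicitly, since the Bochner integral of a non-integrable function
  is zero.\<close>

definition converges_in_moments :: "(nat \<Rightarrow> nat \<Rightarrow> complex) \<Rightarrow> real measure \<Rightarrow> bool" where
  "converges_in_moments mom \<mu> \<longleftrightarrow>
     real_distribution \<mu> \<and>
     (\<forall>m. integrable \<mu> (\<lambda>x. x ^ m) \<and>
        (\<lambda>n. mom n m) \<longlonglongrightarrow> complex_of_real (\<integral>x. x ^ m \<partial>\<mu>))"

end

theory Submission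
  imports Defs "HOL-Computational_Algebra.Fundamental_Theorem_Algebra" "HOL-Real_Asymp.Real_Asymp"
begin

text \<open>Expand $S(n)^m$ from the right. Matricial freeness turns the application of one variable
  $X_{i,j}$ to a word of centred powers into a sum of at most three such words, so the numbers
  $\phi_n(S(n)^m w)$ satisfy a recursion in $m$. Every centred power $X^k - \phi(X^k)1$ in $w$ needs at
  least one more factor $X$ to contribute and therefore costs $n^{-(k+1)/2}$, while the creation of a
  letter offers only $n$ choices; in the limit only words of exponents $1$ survive, and only the blocks
  of their indices matter. The limiting recursion is solved by a product of power series which satisfy
  the functional equations of the continued fraction.

  The measures are obtained from the approximants of the continued fraction. Partial fractions show
  that $1/(z - \sum_k a_k G_k(z))$ is the Cauchy transform of a finitely supported probability measure
  whenever the $G_k$ are. The supports stay in a fixed interval and the moments converge, so Helly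
  selection and the Weierstrass theorem give limit measures with the right transforms, and Stieltjes
  inversion makes them the ones meant by \<open>measure_of_K\<close>.\<close>

section \<open>Stieltjes inversion\<close>

text \<open>Condition (b) of freeness tolerates any factor to the left of a unit but asks for a
  centred word to its right. Products are therefore resolved from the right, with an arbitrary left
  factor that later becomes a power of \<open>S\<close>.

  On the analytic side \<open>measure_of_K\<close> is a definite description, so
  \<open>boolean_conv\<close> says nothing until existence and uniqueness of a measure with the
  given K-transform are known. Two remarks reduce all existence claims to one.
  \<open>K_fraction r b i j\<close> is \<open>b i j\<close> times the Cauchy transform of a measure
  \<open>\<nu> i\<close> that does not depend on \<open>j\<close>. Hence each factor, each partial
  boolean convolution and the limit law have K-transforms that are combinations of the transforms of
  the \<open>\<nu> l\<close> with weights \<open>a l \<ge> 0\<close>, and all of them arise from the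
  \<open>\<nu> l\<close> by one more step of the fraction with other weights. That step carries a
  moment recursion as well, so transforms and moments pass to the limit together.\<close>

lemma norm_inverse_diff_le:
  fixes z :: complex assumes "Im z > 0"
  shows "norm (1 / (z - of_real x)) \<le> 1 / Im z"
proof -
  have "Im z \<le> norm (z - of_real x)"
    using abs_Im_le_cmod[of "z - of_real x"] assms by simp
  then show ?thesis using assms by (simp add: norm_divide frac_le)
qed

lemma (in real_distribution) integrable_inverse_diff:
  assumes "Im z > 0"
  shows "integrable M (\<lambda>x. 1 / (z - complex_of_real x))"
  by (rule integrable_const_bound[where B = "1 / Im z"])
     (use norm_inverse_diff_le[OF assms] in auto)

text \<open>The imaginary part of \<open>1 / (z - t)\<close> is minus the Poisson kernel, up to
  normalisation. The kernel is nonnegative, so \<open>nn_integral\<close> can be used and the later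
  exchange of integrals has no integrability condition.\<close>

lemma (in real_distribution) nn_integral_Poisson:
  assumes "y > 0"
  shows "(\<integral>\<^sup>+t. ennreal (y / ((x - t)\<^sup>2 + y\<^sup>2)) \<partial>M) = ennreal (- Im (cauchy_transform M (Complex x y)))"
proof -
  have int: "integrable M (\<lambda>t. 1 / (Complex x y - complex_of_real t))"
    using integrable_inverse_diff[of "Complex x y"] assms by simp
  have Im_eq: "Im (1 / (Complex x y - complex_of_real t)) = - (y / ((x - t)\<^sup>2 + y\<^sup>2))" for t
    by (simp add: Im_divide power2_eq_square)
  have "integrable M (\<lambda>t. Im (1 / (Complex x y - complex_of_real t)))"
    using int by simp
  then have i: "integrable M (\<lambda>t. y / ((x - t)\<^sup>2 + y\<^sup>2))"
    unfolding Im_eq by simp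
  have "Im (cauchy_transform M (Complex x y)) = (\<integral>t. Im (1 / (Complex x y - complex_of_real t)) \<partial>M)"
    unfolding cauchy_transform_def by (rule integral_Im[OF int, symmetric])
  then have "- Im (cauchy_transform M (Complex x y)) = (\<integral>t. y / ((x - t)\<^sup>2 + y\<^sup>2) \<partial>M)"
    unfolding Im_eq by simp
  then show ?thesis using nn_integral_eq_integral[OF i] assms by simp
qed

text \<open>Fubini: integrating the Poisson kernel over \<open>x\<close> first gives a difference of
  arctangents, integrating over \<open>t\<close> first leaves only the Cauchy transform. So these
  arctangent integrals are determined by the transform.\<close>

lemma (in real_distribution) nn_integral_arctan:
  assumes "y > 0" "a \<le> b"
  shows "(\<integral>\<^sup>+t. ennreal (arctan ((b - t) / y) - arctan ((a - t) / y)) \<partial>M) =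
    (\<integral>\<^sup>+x. ennreal (- Im (cauchy_transform M (Complex x y))) * indicator {a..b} x \<partial>lborel)"
proof -
  interpret pair_sigma_finite lborel M ..
  have "(\<integral>\<^sup>+t. ennreal (arctan ((b - t) / y) - arctan ((a - t) / y)) \<partial>M) =
    (\<integral>\<^sup>+t. (\<integral>\<^sup>+x. ennreal (y / ((x - t)\<^sup>2 + y\<^sup>2)) * indicator {a..b} x \<partial>lborel) \<partial>M)"
  proof (intro nn_integral_cong sym[OF nn_integral_FTC_Icc])
    fix t x :: real
    have "(x - t)\<^sup>2 + y\<^sup>2 > 0" using assms by (simp add: add_nonneg_pos)
    then show "((\<lambda>x. arctan ((x - t) / y)) has_real_derivative y / ((x - t)\<^sup>2 + y\<^sup>2)) (at x)"
      using assms by (auto intro!: derivative_eq_intros simp: field_simps power2_eq_square)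
  qed (use assms in auto)
  also have "\<dots> = (\<integral>\<^sup>+x. (\<integral>\<^sup>+t. ennreal (y / ((x - t)\<^sup>2 + y\<^sup>2)) * indicator {a..b} x \<partial>M) \<partial>lborel)"
    by (rule Fubini') measurable
  also have "\<dots> = (\<integral>\<^sup>+x. ennreal (- Im (cauchy_transform M (Complex x y))) * indicator {a..b} x \<partial>lborel)"
    by (intro nn_integral_cong) (simp add: nn_integral_multc nn_integral_Poisson[OF assms(1)])
  finally show ?thesis .
qed

text \<open>Moving the right end point to \<open>b\<close> from above more slowly than the Poisson kernel narrows avoids the
  half weights which Stieltjes inversion puts on atoms.\<close>

lemma (in real_distribution) cdf_arctan_limit:
  fixes b :: real
  shows "(\<lambda>n. enn2real (\<integral>\<^sup>+t. ennreal (arctan ((b + 1 / real (Suc n) - t) / (1 / (real (Suc n))\<^sup>2)) - arctan ((b - real (Suc n) - t) / (1 / (real (Suc n))\<^sup>2))) \<partial>M))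
    \<longlonglongrightarrow> pi * cdf M b"
proof -
  define f where "f n t = arctan ((b + 1 / real (Suc n) - t) / (1 / (real (Suc n))\<^sup>2)) - arctan ((b - real (Suc n) - t) / (1 / (real (Suc n))\<^sup>2))" for n t
  have f0: "0 \<le> f n t" for n t
    unfolding f_def diff_ge_0_iff_ge arctan_le_iff
    by (intro divide_right_mono) (auto simp: field_simps)
  have f1: "f n t \<le> pi" for n t
    unfolding f_def using arctan_bounded[of "(b + 1 / real (Suc n) - t) / (1 / (real (Suc n))\<^sup>2)"]
      arctan_bounded[of "(b - real (Suc n) - t) / (1 / (real (Suc n))\<^sup>2)"] by linarith
  have lim: "(\<lambda>n. f n t) \<longlonglongrightarrow> pi * indicator {..b} t" for t
  proof -
    have 2: "filterlim (\<lambda>n. (b - real (Suc n) - t) / (1 / (real (Suc n))\<^sup>2)) at_bot sequentially"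
      by real_asymp
    have l2: "(\<lambda>n. arctan ((b - real (Suc n) - t) / (1 / (real (Suc n))\<^sup>2))) \<longlonglongrightarrow> - (pi / 2)"
      by (rule filterlim_compose[OF tendsto_arctan_at_bot 2])
    define c where "c = b - t"
    show ?thesis
    proof (cases "t \<le> b")
      case True
      then have c: "c \<ge> 0" by (simp add: c_def)
      \<comment> \<open>\<open>c = 0\<close> is the case of an atom at \<open>b\<close>. There the
        quotient equals \<open>real (Suc n)\<close>, hence the comparison with this sequence and not
        with its square.\<close>
      have 0: "filterlim (\<lambda>n. real (Suc n)) at_top sequentially" by real_asymp
      have 1: "filterlim (\<lambda>n. (c + 1 / real (Suc n)) / (1 / (real (Suc n))\<^sup>2)) at_top sequentially"
      proof (rule filterlim_at_top_mono[OF 0], rule always_eventually, rule allI)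
        fix n
        have "(c + 1 / real (Suc n)) / (1 / (real (Suc n))\<^sup>2) = c * (real (Suc n))\<^sup>2 + real (Suc n)"
          by (simp add: field_simps power2_eq_square)
        then show "real (Suc n) \<le> (c + 1 / real (Suc n)) / (1 / (real (Suc n))\<^sup>2)" using c by simp
      qed
      have "(\<lambda>n. arctan ((c + 1 / real (Suc n)) / (1 / (real (Suc n))\<^sup>2))) \<longlonglongrightarrow> pi / 2"
        by (rule filterlim_compose[OF tendsto_arctan_at_top 1])
      then have "(\<lambda>n. arctan ((b + 1 / real (Suc n) - t) / (1 / (real (Suc n))\<^sup>2))) \<longlonglongrightarrow> pi / 2"
        by (simp add: c_def algebra_simps)
      from tendsto_diff[OF this l2] show ?thesis using True by (simp add: f_def)
    next
      case False
      then have c: "c < 0" by (simp add: c_def)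
      have 1: "filterlim (\<lambda>n. (c + 1 / real (Suc n)) / (1 / (real (Suc n))\<^sup>2)) at_bot sequentially"
        using c by real_asymp
      have "(\<lambda>n. arctan ((c + 1 / real (Suc n)) / (1 / (real (Suc n))\<^sup>2))) \<longlonglongrightarrow> - (pi / 2)"
        by (rule filterlim_compose[OF tendsto_arctan_at_bot 1])
      then have "(\<lambda>n. arctan ((b + 1 / real (Suc n) - t) / (1 / (real (Suc n))\<^sup>2))) \<longlonglongrightarrow> - (pi / 2)"
        by (simp add: c_def algebra_simps)
      from tendsto_diff[OF this l2] show ?thesis using False by (simp add: f_def)
    qed
  qed
  have [measurable]: "f n \<in> borel_measurable M" for n unfolding f_def by measurable
  have int: "integrable M (f n)" for n
    by (rule integrable_const_bound[where B = pi]) (use f0 f1 in auto)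
  have "(\<lambda>n. \<integral>t. f n t \<partial>M) \<longlonglongrightarrow> (\<integral>t. pi * indicator {..b} t \<partial>M)"
    by (rule integral_dominated_convergence[where w = "\<lambda>_. pi"]) (use f0 f1 lim in auto)
  moreover have "(\<integral>t. pi * indicator {..b} t \<partial>M) = pi * cdf M b"
    by (simp add: cdf_def)
  moreover have "(\<integral>t. f n t \<partial>M) = enn2real (\<integral>\<^sup>+t. ennreal (f n t) \<partial>M)" for n
    by (rule integral_eq_nn_integral) (use f0 in auto)
  ultimately show ?thesis by (simp add: f_def)
qed

text \<open>Equal transforms give equal arctangent integrals by \<open>nn_integral_arctan\<close>;
  their limits are \<open>pi\<close> times the distribution functions.\<close>

theorem cauchy_transform_inject:
  assumes "real_distribution \<mu>" "real_distribution \<nu>"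
    and eq: "\<And>z. Im z > 0 \<Longrightarrow> cauchy_transform \<mu> z = cauchy_transform \<nu> z"
  shows "\<mu> = \<nu>"
proof (rule cdf_unique[OF assms(1,2)], rule ext)
  fix b :: real
  interpret M: real_distribution \<mu> by fact
  interpret N: real_distribution \<nu> by fact
  have eqn: "(\<integral>\<^sup>+t. ennreal (arctan ((b + 1 / real (Suc n) - t) / (1 / (real (Suc n))\<^sup>2)) - arctan ((b - real (Suc n) - t) / (1 / (real (Suc n))\<^sup>2))) \<partial>\<mu>)
    = (\<integral>\<^sup>+t. ennreal (arctan ((b + 1 / real (Suc n) - t) / (1 / (real (Suc n))\<^sup>2)) - arctan ((b - real (Suc n) - t) / (1 / (real (Suc n))\<^sup>2))) \<partial>\<nu>)" for n
  proof -
    have 1: "0 < 1 / (real (Suc n))\<^sup>2" by simp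
    have 2: "b - real (Suc n) \<le> b + 1 / real (Suc n)"
      using zero_less_divide_1_iff[of "real (Suc n)"] by linarith
    show ?thesis
      unfolding M.nn_integral_arctan[OF 1 2] N.nn_integral_arctan[OF 1 2]
      by (subst eq) (simp_all del: of_nat_Suc)
  qed
  have "pi * cdf \<mu> b = pi * cdf \<nu> b"
    by (rule LIMSEQ_unique[OF M.cdf_arctan_limit[of b, unfolded eqn] N.cdf_arctan_limit[of b]])
  then show "cdf \<mu> b = cdf \<nu> b" by simp
qed

lemma has_K_transform_unique:
  assumes "has_K_transform \<mu> K" "has_K_transform \<nu> K"
  shows "\<mu> = \<nu>"
proof (rule cauchy_transform_inject)
  fix z :: complex assume z: "Im z > 0"
  then have "K_transform \<mu> z = K_transform \<nu> z"
    using assms by (simp add: has_K_transform_def)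
  \<comment> \<open>With \<open>1 / 0 = 0\<close> inversion is injective on all complex numbers, so
    zeros of the Cauchy transform need no separate treatment.\<close>
  then show "cauchy_transform \<mu> z = cauchy_transform \<nu> z"
    by (simp add: K_transform_def F_transform_def)
qed (use assms in \<open>auto simp: has_K_transform_def\<close>)

lemma measure_of_K_eq: "has_K_transform \<mu> K \<Longrightarrow> measure_of_K K = \<mu>"
  unfolding measure_of_K_def using has_K_transform_unique by blast

lemma has_K_transform_cong:
  "(\<And>z. Im z > 0 \<Longrightarrow> K z = K' z) \<Longrightarrow> has_K_transform \<mu> K \<longleftrightarrow> has_K_transform \<mu> K'"
  by (auto simp: has_K_transform_def)

section \<open>Partial fractions\<close>

text \<open>Besides the expansion of \<open>1 / f\<close>, the vanishing of \<open>f\<close> at the new nodes and of \<open>1 / f\<close> at the old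
  ones is recorded: these two facts give the recursion for the moments by finite sums alone.\<close>

lemma partial_fractions:
  fixes xs :: "real set" and \<alpha> :: "real \<Rightarrow> real"
  assumes fin: "finite xs" and pos: "\<And>x. x \<in> xs \<Longrightarrow> \<alpha> x > 0"
  obtains Y \<beta> where "finite Y" "\<And>y. y \<in> Y \<Longrightarrow> \<beta> y > 0" "sum \<beta> Y = 1"
    "\<And>y. y \<in> Y \<Longrightarrow> y \<notin> xs" "\<And>x. x \<in> xs \<Longrightarrow> (\<Sum>y\<in>Y. \<beta> y / (x - y)) = 0"
    "\<And>y. y \<in> Y \<Longrightarrow> (\<Sum>x\<in>xs. \<alpha> x / (y - x)) = y"
    "\<And>z. z \<notin> complex_of_real ` xs \<Longrightarrow> z - (\<Sum>x\<in>xs. of_real (\<alpha> x) / (z - of_real x)) \<noteq> 0 \<Longrightarrow>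
       (\<Sum>y\<in>Y. of_real (\<beta> y) / (z - of_real y)) = 1 / (z - (\<Sum>x\<in>xs. of_real (\<alpha> x) / (z - of_real x)))"
proof -
  define f where "f z = z - (\<Sum>x\<in>xs. complex_of_real (\<alpha> x) / (z - of_real x))" for z
  define Qx where "Qx x = (\<Prod>x'\<in>xs - {x}. [:- complex_of_real x', 1:])" for x
  define Q where "Q = (\<Prod>x\<in>xs. [:- complex_of_real x, 1:])"
  \<comment> \<open>\<open>P\<close> is the numerator of \<open>f\<close> over the common
    denominator \<open>Q\<close>. Its degree exceeds that of \<open>Q\<close> by one, and its roots
    become the new nodes.\<close>
  define P where "P = pCons 0 Q - (\<Sum>x\<in>xs. Polynomial.smult (of_real (\<alpha> x)) (Qx x))"
  define Y where "Y = {y. poly P (complex_of_real y) = 0}"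
  \<comment> \<open>The residue of \<open>1 / f\<close> at a zero \<open>y\<close> is the reciprocal
    of the derivative of \<open>f\<close>, and on the real line that derivative is at least
    1.\<close>
  define \<beta> where "\<beta> y = 1 / (1 + (\<Sum>x\<in>xs. \<alpha> x / (y - x)\<^sup>2))" for y
  define Py where "Py y = (\<Prod>y'\<in>Y - {y}. [:- complex_of_real y', 1:])" for y
  have Qz: "poly Q z = (\<Prod>x\<in>xs. z - of_real x)" for z by (simp add: Q_def poly_prod)
  have Qxz: "poly (Qx x) z = (\<Prod>x'\<in>xs - {x}. z - of_real x')" for x z by (simp add: Qx_def poly_prod)
  have Q_nz: "poly Q z \<noteq> 0" if "z \<notin> of_real ` xs" for z
    using that fin unfolding Qz by auto
  have Q_split: "poly Q z = (z - of_real x) * poly (Qx x) z" if "x \<in> xs" for x z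
    unfolding Qz Qxz using fin that by (simp add: prod.remove)
  have P_eq: "poly P z = f z * poly Q z" if z: "z \<notin> of_real ` xs" for z
  proof -
    have "of_real (\<alpha> x) * poly (Qx x) z = of_real (\<alpha> x) / (z - of_real x) * poly Q z" if "x \<in> xs" for x
    proof -
      have "z - of_real x \<noteq> 0" using z that by auto
      then show ?thesis using Q_split[OF that, of z] by simp
    qed
    then show ?thesis
      by (simp add: P_def f_def poly_sum algebra_simps sum_distrib_left)
  qed
  have P_xs: "poly P (of_real x) \<noteq> 0" if x: "x \<in> xs" for x
  proof -
    have "poly Q (of_real x) = 0" using Q_split[OF x] by simp
    moreover have "poly (Qx x') (of_real x) = 0" if "x' \<noteq> x" for x'
      unfolding Qxz using that x fin by auto
    then have "(\<Sum>x'\<in>xs. of_real (\<alpha> x') * poly (Qx x') (of_real x)) = of_real (\<alpha> x) * poly (Qx x) (of_real x)"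
      using fin x by (subst sum.remove[of _ x]) (auto intro: sum.neutral)
    moreover have "poly (Qx x) (of_real x) \<noteq> 0"
      unfolding Qxz using fin by auto
    ultimately show ?thesis using pos[OF x] by (simp add: P_def poly_sum)
  qed
  have deg_Q: "degree Q = card xs" and lead_Q: "lead_coeff Q = 1"
    unfolding Q_def by (simp add: degree_prod_sum_eq, simp only: lead_coeff_prod) simp
  then have Q0: "Q \<noteq> 0" by auto
  have deg_sum: "degree (- (\<Sum>x\<in>xs. Polynomial.smult (of_real (\<alpha> x)) (Qx x))) \<le> card xs"
    unfolding degree_minus
  proof (rule degree_sum_le[OF fin])
    fix x assume "x \<in> xs"
    have "degree (Polynomial.smult (of_real (\<alpha> x)) (Qx x)) \<le> degree (Qx x)" by (rule degree_smult_le)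
    also have "degree (Qx x) = card (xs - {x})" unfolding Qx_def by (simp add: degree_prod_sum_eq)
    also have "\<dots> \<le> card xs" using fin by (intro card_mono) auto
    finally show "degree (Polynomial.smult (of_real (\<alpha> x)) (Qx x)) \<le> card xs" .
  qed
  have P_alt: "P = - (\<Sum>x\<in>xs. Polynomial.smult (of_real (\<alpha> x)) (Qx x)) + pCons 0 Q" by (simp add: P_def)
  have deg_less: "degree (- (\<Sum>x\<in>xs. Polynomial.smult (of_real (\<alpha> x)) (Qx x))) < degree (pCons 0 Q)"
    using deg_sum deg_Q Q0 by simp
  have deg_P: "degree P = Suc (card xs)"
    unfolding P_alt degree_add_eq_right[OF deg_less] using deg_Q Q0 by simp
  have lead_P: "lead_coeff P = 1"
    unfolding P_alt lead_coeff_add_le[OF deg_less] using lead_Q Q0 by simp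
  have root: "w \<notin> of_real ` xs \<and> f w = 0" if "poly P w = 0" for w
    using P_xs P_eq[of w] Q_nz[of w] that by auto
  \<comment> \<open>\<open>Im (f w)\<close> is \<open>Im w\<close> times a factor that is at least
    1, so zeros off the real axis are impossible.\<close>
  have root_real: "Im w = 0" if w: "poly P w = 0" for w
  proof -
    have "Im (of_real (\<alpha> x) / (w - of_real x)) = - Im w * (\<alpha> x / (cmod (w - of_real x))\<^sup>2)" for x
      by (simp add: Im_divide cmod_power2)
    then have "Im (f w) = Im w * (1 + (\<Sum>x\<in>xs. \<alpha> x / (cmod (w - of_real x))\<^sup>2))"
      by (simp add: f_def algebra_simps sum_distrib_left sum_negf)
    moreover have "(\<Sum>x\<in>xs. \<alpha> x / (cmod (w - of_real x))\<^sup>2) \<ge> 0"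
      using pos by (intro sum_nonneg) (auto simp: less_imp_le)
    ultimately show ?thesis using root[OF w] by (auto simp: add_nonneg_eq_0_iff)
  qed
  have roots: "{w. poly P w = 0} = of_real ` Y"
  proof (intro equalityI subsetI)
    fix w assume "w \<in> {w. poly P w = 0}"
    then have "w = of_real (Re w)" "poly P w = 0" using root_real by (auto simp: complex_eq_iff)
    then show "w \<in> of_real ` Y" unfolding Y_def by (metis (mono_tags, lifting) image_eqI mem_Collect_eq)
  qed (auto simp: Y_def)
  have slope: "1 + (\<Sum>x\<in>xs. \<alpha> x / (y - x)\<^sup>2) > 0" for y
    using pos by (intro add_pos_nonneg sum_nonneg) (auto simp: less_imp_le)
  then have beta_pos: "\<beta> y > 0" for y by (simp add: \<beta>_def)
  \<comment> \<open>Near a zero of \<open>f\<close> one has \<open>P = f * Q\<close>; in the product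
    rule the term containing \<open>f\<close> itself drops out.\<close>
  have deriv: "poly (pderiv P) (of_real y) = of_real (1 / \<beta> y) * poly Q (of_real y)" if y: "y \<in> Y" for y
  proof -
    let ?w = "complex_of_real y"
    have w: "?w \<notin> of_real ` xs" "f ?w = 0" using root[of ?w] y by (auto simp: Y_def)
    have ne: "?w - of_real x \<noteq> 0" if "x \<in> xs" for x using w that by auto
    have "(f has_field_derivative (1 - (\<Sum>x\<in>xs. - (of_real (\<alpha> x) / (?w - of_real x)\<^sup>2)))) (at ?w)"
      unfolding f_def
      by (intro derivative_intros DERIV_sum)
         (auto intro!: derivative_eq_intros simp: ne power2_eq_square divide_simps, use ne in auto)
    moreover have "1 - (\<Sum>x\<in>xs. - (of_real (\<alpha> x) / (?w - of_real x)\<^sup>2)) = of_real (1 / \<beta> y)"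
      by (simp add: \<beta>_def sum_negf)
    ultimately have "(f has_field_derivative of_real (1 / \<beta> y)) (at ?w)" by metis
    from DERIV_mult[OF this poly_DERIV[of Q ?w]]
    have "((\<lambda>z. f z * poly Q z) has_field_derivative of_real (1 / \<beta> y) * poly Q ?w) (at ?w)"
      using w by (simp add: algebra_simps)
    moreover have "open (- complex_of_real ` xs)" using fin by (simp add: finite_imp_closed open_Compl)
    ultimately have "(poly P has_field_derivative of_real (1 / \<beta> y) * poly Q ?w) (at ?w)"
      using has_field_derivative_transform_within_open[of "\<lambda>z. f z * poly Q z" _ ?w "- of_real ` xs" "poly P"]
        P_eq w by auto
    then show ?thesis using DERIV_unique poly_DERIV by blast
  qed
  \<comment> \<open>By \<open>deriv\<close> no root is multiple. With the fundamental theorem of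
    algebra \<open>P\<close> is then the product of distinct real linear factors, which gives the
    cardinality of \<open>Y\<close>.\<close>
  have rsq: "rsquarefree P"
    unfolding rsquarefree_roots
  proof (intro allI notI, elim conjE)
    fix a assume a: "poly P a = 0" "poly (pderiv P) a = 0"
    then obtain y where y: "y \<in> Y" "a = of_real y" using roots by blast
    have "poly Q a \<noteq> 0" using root[OF a(1)] Q_nz by blast
    then show False using deriv[OF y(1)] a y beta_pos[of y] by auto
  qed
  have P0: "P \<noteq> 0" using lead_P by auto
  have "finite (complex_of_real ` Y)" using poly_roots_finite[OF P0] roots by simp
  then have finY: "finite Y" by (rule finite_imageD) (simp add: inj_on_def)
  have P_prod: "P = (\<Prod>y\<in>Y. [:- complex_of_real y, 1:])"
    using complex_poly_decompose_rsquarefree[OF rsq] lead_P unfolding roots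
    by (simp add: prod.reindex inj_on_def)
  have "degree P = card Y" unfolding P_prod by (simp add: degree_prod_sum_eq)
  then have cardY: "card Y = Suc (card xs)" using deg_P by simp
  have P_split: "P = [:- complex_of_real y, 1:] * Py y" if "y \<in> Y" for y
    unfolding P_prod Py_def using finY that by (simp add: prod.remove)
  have Py_z: "poly (Py y) z = (\<Prod>y'\<in>Y - {y}. z - of_real y')" for y z by (simp add: Py_def poly_prod)
  have deg_Py: "degree (Py y) = card xs" and lead_Py: "lead_coeff (Py y) = 1" if "y \<in> Y" for y
    using that finY cardY unfolding Py_def by (simp add: degree_prod_sum_eq, simp only: lead_coeff_prod) simp
  define T where "T = (\<Sum>y\<in>Y. Polynomial.smult (of_real (\<beta> y)) (Py y))"
  \<comment> \<open>Lagrange interpolation: both polynomials have degree below \<open>card Y\<close>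
    and agree at every root of \<open>P\<close>, because there the derivative of \<open>P\<close>
    equals the value of \<open>Py y\<close>.\<close>
  have "T = Q"
  proof (rule poly_eqI_degree[where A = "complex_of_real ` Y"])
    fix w assume "w \<in> complex_of_real ` Y"
    then obtain y where y: "y \<in> Y" "w = of_real y" by blast
    have "poly (Py y') w = 0" if "y' \<noteq> y" for y'
      unfolding Py_z using that y finY by auto
    then have "poly T w = of_real (\<beta> y) * poly (Py y) w"
      unfolding T_def poly_sum using finY y by (subst sum.remove[of _ y]) (auto intro: sum.neutral)
    moreover have "poly (pderiv P) w = poly (Py y) w"
      by (subst P_split[OF y(1)], subst pderiv_mult) (simp add: y pderiv_pCons)
    ultimately show "poly T w = poly Q w" using deriv[OF y(1)] beta_pos[of y] y by (simp add: field_simps)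
  next
    have card: "card (complex_of_real ` Y) = Suc (card xs)"
      using cardY by (subst card_image) (simp_all add: inj_on_def)
    have "degree T \<le> card xs" unfolding T_def
    proof (rule degree_sum_le[OF finY])
      fix y assume "y \<in> Y"
      then show "degree (Polynomial.smult (of_real (\<beta> y)) (Py y)) \<le> card xs"
        using degree_smult_le[of "of_real (\<beta> y)" "Py y"] deg_Py by simp
    qed
    then show "degree T < card (complex_of_real ` Y)" using card by simp
    show "degree Q < card (complex_of_real ` Y)" using card deg_Q by simp
  qed
  \<comment> \<open>Each \<open>Py y\<close> is monic of degree \<open>card xs\<close>, so the total
    mass is the leading coefficient of \<open>T\<close>, and \<open>Q\<close> is monic.\<close>
  have "(\<Sum>y\<in>Y. of_real (\<beta> y)) = poly.coeff T (card xs)"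
    unfolding T_def coeff_sum using deg_Py lead_Py by (intro sum.cong) auto
  also have "\<dots> = 1" using lead_Q deg_Q \<open>T = Q\<close> by simp
  finally have "complex_of_real (sum \<beta> Y) = of_real 1" by simp
  then have sum1: "sum \<beta> Y = 1" using of_real_eq_iff by blast
  have G: "(\<Sum>y\<in>Y. of_real (\<beta> y) / (z - of_real y)) = poly Q z / poly P z" if z: "poly P z \<noteq> 0" for z
  proof -
    have "of_real (\<beta> y) / (z - of_real y) = of_real (\<beta> y) * poly (Py y) z / poly P z" if "y \<in> Y" for y
    proof -
      have "poly P z = (z - of_real y) * poly (Py y) z"
        using arg_cong[OF P_split[OF that], of "\<lambda>p. poly p z"] by (simp add: algebra_simps)
      then show ?thesis using z by auto
    qed
    then have "(\<Sum>y\<in>Y. of_real (\<beta> y) / (z - of_real y)) = poly T z / poly P z"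
      by (simp add: T_def poly_sum sum_divide_distrib)
    then show ?thesis using \<open>T = Q\<close> by simp
  qed
  show ?thesis
  proof (rule that[of Y \<beta>])
    show "y \<notin> xs" if "y \<in> Y" for y using root[of "of_real y"] that by (auto simp: Y_def)
    show "(\<Sum>y\<in>Y. \<beta> y / (x - y)) = 0" if x: "x \<in> xs" for x
    proof -
      have "complex_of_real (\<Sum>y\<in>Y. \<beta> y / (x - y)) = 0"
        using G[OF P_xs[OF x]] Q_split[OF x, of "of_real x"] by simp
      then show ?thesis unfolding of_real_eq_0_iff .
    qed
    show "(\<Sum>x\<in>xs. \<alpha> x / (y - x)) = y" if "y \<in> Y" for y
    proof -
      have "complex_of_real (y - (\<Sum>x\<in>xs. \<alpha> x / (y - x))) = f (of_real y)" by (simp add: f_def)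
      also have "\<dots> = 0" using root[of "of_real y"] that by (simp add: Y_def)
      finally show ?thesis using of_real_eq_0_iff by (simp del: of_real_diff)
    qed
    fix z assume z: "z \<notin> complex_of_real ` xs" "z - (\<Sum>x\<in>xs. of_real (\<alpha> x) / (z - of_real x)) \<noteq> 0"
    then have "f z \<noteq> 0" by (simp add: f_def)
    then show "(\<Sum>y\<in>Y. of_real (\<beta> y) / (z - of_real y)) = 1 / (z - (\<Sum>x\<in>xs. of_real (\<alpha> x) / (z - of_real x)))"
      using G[of z] P_eq[OF z(1)] Q_nz[OF z(1)] by (simp add: f_def)
  qed (use finY beta_pos sum1 in auto)
qed

section \<open>Limits of measures with bounded support\<close>

lemma (in real_distribution) integrable_continuous_bounded_support:
  fixes f :: "real \<Rightarrow> 'b::{banach, second_countable_topology}"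
  assumes supp: "AE x in M. \<bar>x\<bar> \<le> R" and cont: "continuous_on UNIV f"
  shows "integrable M f"
proof -
  have "compact (f ` {-R..R})"
    using cont by (intro compact_continuous_image) (auto intro: continuous_on_subset)
  then obtain B where B: "\<And>x. x \<in> {-R..R} \<Longrightarrow> norm (f x) \<le> B"
    by (meson bounded_iff compact_imp_bounded imageI)
  show ?thesis
  proof (rule integrable_const_bound[where B = B])
    show "AE x in M. norm (f x) \<le> B" using supp by eventually_elim (rule B, simp add: abs_le_iff minus_le_iff)
    show "f \<in> borel_measurable M" using cont by (simp add: borel_measurable_continuous_onI)
  qed
qed

text \<open>Helly selection only provides a subsequence. Its limit has the limits of the moments as
  its own moments, and on the common interval continuous functions are uniform limits of
  polynomials; this brings back the whole sequence. Unbounded test functions are admissible because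
  only their values on \<open>[-R, R]\<close> count.\<close>

lemma moment_convergence:
  assumes distr: "\<And>n. real_distribution (\<mu> n)" and supp: "\<And>n. AE x in \<mu> n. \<bar>x\<bar> \<le> R"
    and mom: "\<And>k. convergent (\<lambda>n. \<integral>x. x ^ k \<partial>\<mu> n)"
  obtains \<nu> where "real_distribution \<nu>" "AE x in \<nu>. \<bar>x\<bar> \<le> R"
    "\<And>f :: real \<Rightarrow> real. continuous_on UNIV f \<Longrightarrow> (\<lambda>n. \<integral>x. f x \<partial>\<mu> n) \<longlonglongrightarrow> (\<integral>x. f x \<partial>\<nu>)"
proof -
  interpret \<mu>: real_distribution "\<mu> n" for n by (rule distr)
  have R: "R \<ge> 0"
  proof (rule ccontr)
    assume "\<not> R \<ge> 0"
    then have "AE x in \<mu> 0. \<bar>x\<bar> \<le> R \<longrightarrow> False" by (intro AE_I2) auto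
    with supp[of 0] have "AE x in \<mu> 0. False" by (rule AE_mp)
    then show False by simp
  qed
  have "tight \<mu>"
    unfolding tight_def
  proof (intro conjI allI impI)
    fix \<epsilon> :: real assume e: "\<epsilon> > 0"
    have "measure (\<mu> n) {-R - 1<..R} = 1" for n
    proof (rule \<mu>.prob_eq_1[THEN iffD2])
      show "AE x in \<mu> n. x \<in> {-R - 1<..R}" using supp[of n] by eventually_elim auto
    qed simp
    then show "\<exists>a b. a < b \<and> (\<forall>n. measure (\<mu> n) {a<..b} > 1 - \<epsilon>)"
      using e R by (intro exI[of _ "-R - 1"] exI[of _ R]) auto
  qed (rule distr)
  from tight_imp_convergent_subsubsequence[OF this, of id]
  obtain r \<nu> where r: "strict_mono r" and \<nu>: "real_distribution \<nu>" and w: "weak_conv_m (\<mu> \<circ> r) \<nu>"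
    by (auto simp: strict_mono_def)
  interpret \<nu>: real_distribution \<nu> by fact
  have conv: "(\<lambda>n. \<integral>x. g x \<partial>\<mu> (r n)) \<longlonglongrightarrow> (\<integral>x. g x \<partial>\<nu>)"
    if "continuous_on UNIV g" "\<And>x. norm (g x) \<le> B" for g :: "real \<Rightarrow> real" and B
    using weak_conv_imp_integral_bdd_continuous_conv[OF _ \<nu> w, of g B] that distr
    by (simp add: continuous_on_eq_continuous_at o_def)
  have supp_\<nu>: "AE x in \<nu>. \<bar>x\<bar> \<le> R"
  proof -
    \<comment> \<open>\<open>h\<close> is bounded, continuous and zero exactly on
      \<open>[-R, R]\<close>, so weak convergence transfers the support condition to the
      limit.\<close>
    define h where "h x = min 1 (max 0 (\<bar>x\<bar> - R))" for x
    have cont: "continuous_on UNIV h" unfolding h_def by (intro continuous_intros)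
    have h: "0 \<le> h x" "norm (h x) \<le> 1" for x by (auto simp: h_def)
    have "(\<integral>x. h x \<partial>\<mu> n) = (\<integral>x. 0 \<partial>\<mu> n)" for n
    proof (rule integral_cong_AE)
      show "AE x in \<mu> n. h x = 0" using supp[of n] by eventually_elim (auto simp: h_def)
    qed (use cont in \<open>auto simp: borel_measurable_continuous_onI\<close>)
    then have "(\<integral>x. h x \<partial>\<nu>) = 0" using conv[OF cont h(2)] LIMSEQ_unique[OF _ tendsto_const] by simp
    moreover have "integrable \<nu> h"
      by (rule \<nu>.integrable_const_bound[where B = 1])
         (use h(2) cont in \<open>auto simp: borel_measurable_continuous_onI\<close>)
    ultimately have "AE x in \<nu>. h x = 0"
      using integral_nonneg_eq_0_iff_AE[of \<nu> h] h(1) by auto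
    then show ?thesis by eventually_elim (auto simp: h_def min_def max_def split: if_splits)
  qed
  have sub: "(\<lambda>n. \<integral>x. f x \<partial>\<mu> (r n)) \<longlonglongrightarrow> (\<integral>x. f x \<partial>\<nu>)"
    if f: "continuous_on UNIV f" for f :: "real \<Rightarrow> real"
  proof -
    \<comment> \<open>Clamping the argument leaves \<open>f\<close> unchanged on the supports and
      makes it bounded, as weak convergence demands.\<close>
    define g where "g x = f (max (-R) (min R x))" for x
    have cont: "continuous_on UNIV g"
      unfolding g_def by (rule continuous_on_compose2[OF f]) (auto intro!: continuous_intros)
    have "compact (f ` {-R..R})"
      using f by (intro compact_continuous_image) (auto intro: continuous_on_subset)
    then obtain B where "\<And>x. x \<in> {-R..R} \<Longrightarrow> norm (f x) \<le> B"
      by (meson bounded_iff compact_imp_bounded imageI)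
    then have g: "norm (g x) \<le> B" for x using R unfolding g_def by auto
    have eq: "g x = f x" if "\<bar>x\<bar> \<le> R" for x
      using that by (auto simp: g_def min_def max_def)
    have "(\<integral>x. g x \<partial>M) = (\<integral>x. f x \<partial>M)" if "real_distribution M" "AE x in M. \<bar>x\<bar> \<le> R" for M
    proof (rule integral_cong_AE)
      interpret M: real_distribution M by fact
      show "AE x in M. g x = f x" using that(2) by eventually_elim (rule eq)
      show "g \<in> borel_measurable M" "f \<in> borel_measurable M"
        using cont f by (auto simp: borel_measurable_continuous_onI)
    qed
    then show ?thesis using conv[OF cont g] distr supp \<nu> supp_\<nu> by simp
  qed
  have mom': "(\<lambda>n. \<integral>x. x ^ k \<partial>\<mu> n) \<longlonglongrightarrow> (\<integral>x. x ^ k \<partial>\<nu>)" for k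
  proof -
    obtain l where l: "(\<lambda>n. \<integral>x. x ^ k \<partial>\<mu> n) \<longlonglongrightarrow> l" using mom by (auto simp: convergent_def)
    have "(\<lambda>n. \<integral>x. x ^ k \<partial>\<mu> (r n)) \<longlonglongrightarrow> l" using LIMSEQ_subseq_LIMSEQ[OF l r] by (simp add: o_def)
    moreover have "(\<lambda>n. \<integral>x. x ^ k \<partial>\<mu> (r n)) \<longlonglongrightarrow> (\<integral>x. x ^ k \<partial>\<nu>)"
      by (rule sub) (intro continuous_intros)
    ultimately show ?thesis using l LIMSEQ_unique by blast
  qed
  show ?thesis
  proof (rule that[OF \<nu> supp_\<nu>])
    fix f :: "real \<Rightarrow> real" assume f: "continuous_on UNIV f"
    have approx: "\<bar>(\<integral>x. f x \<partial>M) - (\<integral>x. p x \<partial>M)\<bar> \<le> e"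
      if M: "real_distribution M" and S: "AE x in M. \<bar>x\<bar> \<le> R" and p: "continuous_on UNIV p"
        and e: "\<And>x. x \<in> {-R..R} \<Longrightarrow> \<bar>f x - p x\<bar> < e" for M p e
    proof -
      interpret M: real_distribution M by fact
      note int = M.integrable_continuous_bounded_support[OF S]
      have "\<bar>\<integral>x. f x - p x \<partial>M\<bar> \<le> (\<integral>x. \<bar>f x - p x\<bar> \<partial>M)" by (rule integral_abs_bound)
      also have "\<dots> \<le> (\<integral>x. e \<partial>M)"
      proof (rule integral_mono_AE)
        show "integrable M (\<lambda>x. \<bar>f x - p x\<bar>)" using f p by (intro int continuous_intros)
        show "AE x in M. \<bar>f x - p x\<bar> \<le> e"
          using S by eventually_elim (rule less_imp_le, rule e, simp add: abs_le_iff minus_le_iff)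
      qed simp
      also have "\<dots> = e" using M.prob_space by simp
      finally show ?thesis using int[OF f] int[OF p] by simp
    qed
    show "(\<lambda>n. \<integral>x. f x \<partial>\<mu> n) \<longlonglongrightarrow> (\<integral>x. f x \<partial>\<nu>)"
    proof (rule LIMSEQ_I)
      fix \<epsilon> :: real assume \<epsilon>: "\<epsilon> > 0"
      have "continuous_on {-R..R} f" using f by (auto intro: continuous_on_subset)
      from Stone_Weierstrass_real_polynomial_function[OF compact_Icc this, of "\<epsilon> / 3"] \<epsilon>
      obtain p where p: "real_polynomial_function p" "\<And>x. x \<in> {-R..R} \<Longrightarrow> \<bar>f x - p x\<bar> < \<epsilon> / 3"
        by auto
      then obtain a N where pa: "p = (\<lambda>x. \<Sum>i\<le>N. a i * x ^ i)"
        unfolding real_polynomial_function_iff_sum by blast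
      have pc: "continuous_on UNIV p" unfolding pa by (intro continuous_intros)
      have int: "(\<integral>x. p x \<partial>M) = (\<Sum>i\<le>N. a i * (\<integral>x. x ^ i \<partial>M))"
        if "real_distribution M" "AE x in M. \<bar>x\<bar> \<le> R" for M
      proof -
        interpret M: real_distribution M by fact
        have "integrable M (\<lambda>x. x ^ i)" for i
          by (rule M.integrable_continuous_bounded_support[OF that(2)]) (intro continuous_intros)
        then show ?thesis unfolding pa by simp
      qed
      have "(\<lambda>n. \<integral>x. p x \<partial>\<mu> n) \<longlonglongrightarrow> (\<integral>x. p x \<partial>\<nu>)"
        unfolding int[OF distr supp] int[OF \<nu> supp_\<nu>] by (intro tendsto_intros mom')
      from LIMSEQ_D[OF this, of "\<epsilon> / 3"] \<epsilon>
      obtain n0 where n0: "\<And>n. n \<ge> n0 \<Longrightarrow> \<bar>(\<integral>x. p x \<partial>\<mu> n) - (\<integral>x. p x \<partial>\<nu>)\<bar> < \<epsilon> / 3" by auto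
      have "norm ((\<integral>x. f x \<partial>\<mu> n) - (\<integral>x. f x \<partial>\<nu>)) < \<epsilon>" if "n \<ge> n0" for n
        using n0[OF that] approx[OF distr supp pc p(2), of n] approx[OF \<nu> supp_\<nu> pc p(2)]
        unfolding real_norm_def abs_if by (auto split: if_splits)
      then show "\<exists>n0. \<forall>n\<ge>n0. norm ((\<integral>x. f x \<partial>\<mu> n) - (\<integral>x. f x \<partial>\<nu>)) < \<epsilon>" by blast
    qed
  qed
qed

section \<open>The measures of the continued fraction\<close>

definition pmf_cauchy :: "real pmf \<Rightarrow> complex \<Rightarrow> complex" where
  "pmf_cauchy p z = (\<Sum>x\<in>set_pmf p. of_real (pmf p x) / (z - of_real x))"

definition pmf_moment :: "real pmf \<Rightarrow> nat \<Rightarrow> real" where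
  "pmf_moment p k = (\<Sum>x\<in>set_pmf p. pmf p x * x ^ k)"

text \<open>Every set is measurable for \<open>measure_pmf\<close>; the push-forward along the
  identity replaces this by the Borel sets that \<open>real_distribution\<close> requires.\<close>

definition pmf_law :: "real pmf \<Rightarrow> real measure" where
  "pmf_law p = distr (measure_pmf p) borel (\<lambda>x. x)"

lemma real_distribution_pmf_law: "real_distribution (pmf_law p)"
  unfolding pmf_law_def by (intro prob_space.real_distribution_distr measure_pmf.prob_space_axioms) simp

lemma integral_pmf_law:
  fixes f :: "real \<Rightarrow> 'b::{banach, second_countable_topology}"
  assumes "finite (set_pmf p)" "f \<in> borel_measurable borel"
  shows "(\<integral>x. f x \<partial>pmf_law p) = (\<Sum>x\<in>set_pmf p. pmf p x *\<^sub>R f x)"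
  unfolding pmf_law_def
  by (subst integral_distr) (use assms in \<open>auto intro!: integral_measure_pmf\<close>)

lemma cauchy_transform_pmf_law:
  assumes "finite (set_pmf p)"
  shows "cauchy_transform (pmf_law p) z = pmf_cauchy p z"
  unfolding cauchy_transform_def pmf_cauchy_def
  by (subst integral_pmf_law[OF assms]) (auto simp: scaleR_conv_of_real)

lemma moment_pmf_law:
  assumes "finite (set_pmf p)"
  shows "(\<integral>x. x ^ k \<partial>pmf_law p) = pmf_moment p k"
  unfolding pmf_moment_def by (subst integral_pmf_law[OF assms]) auto

lemma AE_pmf_law:
  assumes "\<And>x. x \<in> set_pmf p \<Longrightarrow> P x" "{x. P x} \<in> sets borel"
  shows "AE x in pmf_law p. P x"
  unfolding pmf_law_def using assms by (subst AE_distr_iff) (auto simp: AE_measure_pmf_iff)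

lemma Im_pmf_cauchy_nonpos: "Im z > 0 \<Longrightarrow> Im (pmf_cauchy p z) \<le> 0"
  unfolding pmf_cauchy_def Im_sum by (intro sum_nonpos) (auto simp: Im_divide intro!: divide_nonpos_nonneg)

text \<open>\<open>partial_fractions\<close> for the mixture of the \<open>q k\<close> with weights
  \<open>a k\<close>. Some weights may be zero, so only the points of positive mass are kept as
  nodes. The moment recursion is the coefficient form of the equation for the Cauchy
  transform.\<close>

lemma boolean_step_exists:
  assumes K: "finite K" and q: "\<And>k. k \<in> K \<Longrightarrow> finite (set_pmf (q k))" and a: "\<And>k. k \<in> K \<Longrightarrow> a k \<ge> 0"
  obtains p where "finite (set_pmf p)"
    "\<And>k. pmf_moment p (Suc k) = (\<Sum>i<k. pmf_moment p i * (\<Sum>l\<in>K. a l * pmf_moment (q l) (k - Suc i)))"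
    "\<And>y. y \<in> set_pmf p \<Longrightarrow> of_real y = (\<Sum>k\<in>K. of_real (a k) * pmf_cauchy (q k) (of_real y))"
    "\<And>z. (\<And>k x. k \<in> K \<Longrightarrow> x \<in> set_pmf (q k) \<Longrightarrow> z \<noteq> of_real x) \<Longrightarrow>
       z - (\<Sum>k\<in>K. of_real (a k) * pmf_cauchy (q k) z) \<noteq> 0 \<Longrightarrow>
       pmf_cauchy p z = 1 / (z - (\<Sum>k\<in>K. of_real (a k) * pmf_cauchy (q k) z))"
proof -
  define U where "U = (\<Union>k\<in>K. set_pmf (q k))"
  define \<alpha> where "\<alpha> x = (\<Sum>k\<in>K. a k * pmf (q k) x)" for x
  define xs where "xs = {x \<in> U. \<alpha> x > 0}"
  have finU: "finite U" unfolding U_def using K q by blast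
  then have fin: "finite xs" by (simp add: xs_def)
  have \<alpha>0: "\<alpha> x \<ge> 0" for x unfolding \<alpha>_def using a by (intro sum_nonneg) auto
  \<comment> \<open>Stated over an arbitrary real normed field because it is applied both to complex
    resolvents and to real powers.\<close>
  have mix: "(\<Sum>k\<in>K. of_real (a k) * (\<Sum>x\<in>set_pmf (q k). of_real (pmf (q k) x) * g x)) = (\<Sum>x\<in>xs. of_real (\<alpha> x) * g x)"
    for g :: "real \<Rightarrow> 'b::real_normed_field"
  proof -
    have "(\<Sum>x\<in>set_pmf (q k). of_real (pmf (q k) x) * g x) = (\<Sum>x\<in>U. of_real (pmf (q k) x) * g x)" if "k \<in> K" for k
      using that finU by (intro sum.mono_neutral_left) (auto simp: U_def set_pmf_iff)
    then have "(\<Sum>k\<in>K. of_real (a k) * (\<Sum>x\<in>set_pmf (q k). of_real (pmf (q k) x) * g x)) =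
      (\<Sum>k\<in>K. \<Sum>x\<in>U. of_real (a k * pmf (q k) x) * g x)"
      by (simp add: sum_distrib_left mult.assoc)
    also have "\<dots> = (\<Sum>x\<in>U. of_real (\<alpha> x) * g x)"
      unfolding \<alpha>_def by (subst sum.swap) (simp add: sum_distrib_right)
    also have "\<dots> = (\<Sum>x\<in>xs. of_real (\<alpha> x) * g x)"
      using finU \<alpha>0 by (intro sum.mono_neutral_right) (auto simp: xs_def order_less_le)
    finally show ?thesis .
  qed
  from mix[of "\<lambda>x. 1 / (z - of_real x)" for z :: complex]
  have mixG: "(\<Sum>k\<in>K. of_real (a k) * pmf_cauchy (q k) z) = (\<Sum>x\<in>xs. of_real (\<alpha> x) / (z - of_real x))" for z
    by (simp add: pmf_cauchy_def)
  from mix[of "\<lambda>x::real. x ^ j" for j]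
  have mixM: "(\<Sum>l\<in>K. a l * pmf_moment (q l) j) = (\<Sum>x\<in>xs. \<alpha> x * x ^ j)" for j
    by (simp add: pmf_moment_def)
  have "\<alpha> x > 0" if "x \<in> xs" for x using that by (simp add: xs_def)
  from partial_fractions[of xs \<alpha>, OF fin this] obtain Y \<beta>
    where Y: "finite Y" "\<And>y. y \<in> Y \<Longrightarrow> \<beta> y > 0" "sum \<beta> Y = 1"
    "\<And>y. y \<in> Y \<Longrightarrow> y \<notin> xs" "\<And>x. x \<in> xs \<Longrightarrow> (\<Sum>y\<in>Y. \<beta> y / (x - y)) = 0"
    "\<And>y. y \<in> Y \<Longrightarrow> (\<Sum>x\<in>xs. \<alpha> x / (y - x)) = y"
    "\<And>z. z \<notin> complex_of_real ` xs \<Longrightarrow> z - (\<Sum>x\<in>xs. of_real (\<alpha> x) / (z - of_real x)) \<noteq> 0 \<Longrightarrow>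
       (\<Sum>y\<in>Y. of_real (\<beta> y) / (z - of_real y)) = 1 / (z - (\<Sum>x\<in>xs. of_real (\<alpha> x) / (z - of_real x)))"
    by blast
  define \<beta>' where "\<beta>' y = (if y \<in> Y then \<beta> y else 0)" for y
  define p where "p = embed_pmf \<beta>'"
  have \<beta>'0: "\<beta>' y \<ge> 0" for y using Y(2) by (auto simp: \<beta>'_def less_imp_le)
  have "(\<integral>\<^sup>+y. ennreal (\<beta>' y) \<partial>count_space UNIV) = (\<Sum>y\<in>Y. ennreal (\<beta>' y))"
    using Y(1) by (intro nn_integral_count_space') (auto simp: \<beta>'_def)
  also have "\<dots> = ennreal (\<Sum>y\<in>Y. \<beta>' y)" using \<beta>'0 by (intro sum_ennreal) auto
  also have "\<dots> = 1" using Y(3) by (simp add: \<beta>'_def)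
  finally have nn: "(\<integral>\<^sup>+y. ennreal (\<beta>' y) \<partial>count_space UNIV) = 1" .
  have pmf_p: "pmf p y = \<beta>' y" for y unfolding p_def by (rule pmf_embed_pmf[OF \<beta>'0 nn])
  have set_p: "set_pmf p = Y"
    unfolding p_def set_embed_pmf[OF \<beta>'0 nn] using Y(2) by (auto simp: \<beta>'_def less_le)
  have cauchy_p: "pmf_cauchy p z = (\<Sum>y\<in>Y. of_real (\<beta> y) / (z - of_real y))" for z
    unfolding pmf_cauchy_def set_p pmf_p by (intro sum.cong) (auto simp: \<beta>'_def)
  have moment_p: "pmf_moment p k = (\<Sum>y\<in>Y. \<beta> y * y ^ k)" for k
    unfolding pmf_moment_def set_p pmf_p by (intro sum.cong) (auto simp: \<beta>'_def)
  show ?thesis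
  proof (rule that[of p])
    show "finite (set_pmf p)" by (simp add: set_p Y)
    show "of_real y = (\<Sum>k\<in>K. of_real (a k) * pmf_cauchy (q k) (of_real y))" if "y \<in> set_pmf p" for y
    proof -
      have "complex_of_real (\<Sum>x\<in>xs. \<alpha> x / (y - x)) = of_real y" using Y(6) that set_p by simp
      then show ?thesis unfolding mixG by simp
    qed
    show "pmf_cauchy p z = 1 / (z - (\<Sum>k\<in>K. of_real (a k) * pmf_cauchy (q k) z))"
      if "\<And>k x. k \<in> K \<Longrightarrow> x \<in> set_pmf (q k) \<Longrightarrow> z \<noteq> of_real x"
        "z - (\<Sum>k\<in>K. of_real (a k) * pmf_cauchy (q k) z) \<noteq> 0" for z
    proof -
      have "z \<notin> of_real ` xs" using that(1) by (auto simp: xs_def U_def)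
      then show ?thesis using Y(7)[of z] that(2) unfolding mixG cauchy_p by blast
    qed
    fix k
    \<comment> \<open>At the new nodes \<open>f\<close> vanishes, so one factor \<open>y\<close> can
      be traded for the sum of the \<open>\<alpha> x / (y - x)\<close>.\<close>
    have "pmf_moment p (Suc k) = (\<Sum>y\<in>Y. \<beta> y * y ^ k * (\<Sum>x\<in>xs. \<alpha> x / (y - x)))"
      unfolding moment_p by (intro sum.cong) (auto simp: Y(6))
    \<comment> \<open>Here \<open>y ^ k\<close> is split into \<open>x ^ k\<close> and a multiple of
      \<open>y - x\<close>. The first part is later summed over \<open>y\<close> and killed by the
      vanishing of \<open>1 / f\<close> at the old nodes; in the second part the denominator
      cancels.\<close>
    also have "\<dots> = (\<Sum>y\<in>Y. \<Sum>x\<in>xs. \<alpha> x * x ^ k * (- (\<beta> y / (x - y))) + \<beta> y * \<alpha> x * (\<Sum>i<k. y ^ i * x ^ (k - Suc i)))"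
      unfolding sum_distrib_left
    proof (intro sum.cong refl)
      fix x y assume xy: "y \<in> Y" "x \<in> xs"
      then have ne: "y - x \<noteq> 0" using Y(4) by auto
      define t where "t = (\<Sum>i<k. y ^ i * x ^ (k - Suc i))"
      have yk: "y ^ k = x ^ k + (y - x) * t"
        using power_diff_sumr2[of y k x] by (simp add: mult.commute t_def)
      have "\<beta> y / (y - x) = - (\<beta> y / (x - y))"
        by (metis minus_diff_eq minus_divide_right)
      moreover have "\<beta> y * y ^ k * (\<alpha> x / (y - x)) = \<alpha> x * x ^ k * (\<beta> y / (y - x)) + \<beta> y * \<alpha> x * t"
        unfolding yk using ne by (simp add: field_simps)
      ultimately show "\<beta> y * y ^ k * (\<alpha> x / (y - x)) =
        \<alpha> x * x ^ k * (- (\<beta> y / (x - y))) + (\<Sum>i<k. \<beta> y * \<alpha> x * (y ^ i * x ^ (k - Suc i)))"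
        by (simp only: t_def sum_distrib_left)
    qed
    also have "\<dots> = (\<Sum>x\<in>xs. \<alpha> x * x ^ k * (- (\<Sum>y\<in>Y. \<beta> y / (x - y)))) +
      (\<Sum>y\<in>Y. \<Sum>x\<in>xs. \<beta> y * \<alpha> x * (\<Sum>i<k. y ^ i * x ^ (k - Suc i)))"
      unfolding sum.distrib by (subst (1) sum.swap) (simp add: sum_distrib_left sum_negf)
    also have "(\<Sum>x\<in>xs. \<alpha> x * x ^ k * (- (\<Sum>y\<in>Y. \<beta> y / (x - y)))) = 0"
      by (intro sum.neutral) (simp add: Y(5))
    also have "0 + (\<Sum>y\<in>Y. \<Sum>x\<in>xs. \<beta> y * \<alpha> x * (\<Sum>i<k. y ^ i * x ^ (k - Suc i))) =
      (\<Sum>i<k. \<Sum>y\<in>Y. \<Sum>x\<in>xs. (\<beta> y * y ^ i) * (\<alpha> x * x ^ (k - Suc i)))"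
    proof -
      have "(\<Sum>y\<in>Y. \<Sum>x\<in>xs. \<beta> y * \<alpha> x * (\<Sum>i<k. y ^ i * x ^ (k - Suc i))) =
        (\<Sum>y\<in>Y. \<Sum>i<k. \<Sum>x\<in>xs. (\<beta> y * y ^ i) * (\<alpha> x * x ^ (k - Suc i)))"
        unfolding sum_distrib_left by (intro sum.cong refl, subst sum.swap, simp add: mult_ac)
      also have "\<dots> = (\<Sum>i<k. \<Sum>y\<in>Y. \<Sum>x\<in>xs. (\<beta> y * y ^ i) * (\<alpha> x * x ^ (k - Suc i)))"
        by (rule sum.swap)
      finally show ?thesis by simp
    qed
    also have "\<dots> = (\<Sum>i<k. pmf_moment p i * (\<Sum>l\<in>K. a l * pmf_moment (q l) (k - Suc i)))"
      unfolding mixM moment_p by (simp add: sum_product)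
    finally show "pmf_moment p (Suc k) = (\<Sum>i<k. pmf_moment p i * (\<Sum>l\<in>K. a l * pmf_moment (q l) (k - Suc i)))" .
  qed
qed

text \<open>The equation for the atoms of \<open>p\<close> is kept because it confines them to a
  bounded interval. The transform formula covers real \<open>z\<close> outside the supports as well,
  since the growth bound in \<open>tame_pmf\<close> is later evaluated at real points.\<close>

definition boolean_step :: "nat \<Rightarrow> (nat \<Rightarrow> real) \<Rightarrow> (nat \<Rightarrow> real pmf) \<Rightarrow> real pmf \<Rightarrow> bool" where
  "boolean_step r a q p \<longleftrightarrow> finite (set_pmf p) \<and>
    (\<forall>k. pmf_moment p (Suc k) = (\<Sum>i<k. pmf_moment p i * (\<Sum>l=1..r. a l * pmf_moment (q l) (k - Suc i)))) \<and>
    (\<forall>y\<in>set_pmf p. of_real y = (\<Sum>l=1..r. of_real (a l) * pmf_cauchy (q l) (of_real y))) \<and>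
    (\<forall>z. (\<forall>l\<in>{1..r}. z \<notin> of_real ` set_pmf (q l)) \<longrightarrow>
       z - (\<Sum>l=1..r. of_real (a l) * pmf_cauchy (q l) z) \<noteq> 0 \<longrightarrow>
       pmf_cauchy p z = 1 / (z - (\<Sum>l=1..r. of_real (a l) * pmf_cauchy (q l) z)))"

text \<open>Choice turns the existence statement into a function that can be iterated; everything
  known about the result comes through \<open>boolean_step\<close>.\<close>

definition step_pmf :: "nat \<Rightarrow> (nat \<Rightarrow> real) \<Rightarrow> (nat \<Rightarrow> real pmf) \<Rightarrow> real pmf" where
  "step_pmf r a q = (SOME p. boolean_step r a q p)"

lemma boolean_step_pmf:
  assumes "\<And>l. l \<in> {1..r} \<Longrightarrow> finite (set_pmf (q l))" "\<And>l. l \<in> {1..r} \<Longrightarrow> a l \<ge> 0"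
  shows "boolean_step r a q (step_pmf r a q)"
proof -
  obtain p where "finite (set_pmf p)"
    "\<And>k. pmf_moment p (Suc k) = (\<Sum>i<k. pmf_moment p i * (\<Sum>l\<in>{1..r}. a l * pmf_moment (q l) (k - Suc i)))"
    "\<And>y. y \<in> set_pmf p \<Longrightarrow> of_real y = (\<Sum>k\<in>{1..r}. of_real (a k) * pmf_cauchy (q k) (of_real y))"
    "\<And>z. (\<And>k x. k \<in> {1..r} \<Longrightarrow> x \<in> set_pmf (q k) \<Longrightarrow> z \<noteq> of_real x) \<Longrightarrow>
       z - (\<Sum>k\<in>{1..r}. of_real (a k) * pmf_cauchy (q k) z) \<noteq> 0 \<Longrightarrow>
       pmf_cauchy p z = 1 / (z - (\<Sum>k\<in>{1..r}. of_real (a k) * pmf_cauchy (q k) z))"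
    using boolean_step_exists[of "{1..r}" q a] assms by blast
  then have "boolean_step r a q p" unfolding boolean_step_def by blast
  then show ?thesis unfolding step_pmf_def by (rule someI)
qed

text \<open>The bound on the Cauchy transform outside \<open>[-(s+1), s+1]\<close> is what keeps the supports from
  growing along the iteration.\<close>

definition tame_pmf :: "real \<Rightarrow> real pmf \<Rightarrow> bool" where
  "tame_pmf s p \<longleftrightarrow> finite (set_pmf p) \<and> (\<forall>x\<in>set_pmf p. \<bar>x\<bar> \<le> s + 1) \<and>
     (\<forall>z. norm z > s + 1 \<longrightarrow> norm (pmf_cauchy p z) \<le> 1)"

text \<open>For \<open>norm z > s + 1\<close> the weighted sum \<open>S\<close> of the transforms
  has modulus at most \<open>s\<close>, hence \<open>norm (z - S) > 1\<close>. This rules out atoms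
  there, since an atom solves \<open>z = S\<close>, and bounds \<open>1 / (z - S)\<close> by 1. So
  the same \<open>s\<close> works again.\<close>

lemma tame_pmf_step:
  assumes q: "\<And>l. l \<in> {1..r} \<Longrightarrow> tame_pmf s (q l)" and a: "\<And>l. l \<in> {1..r} \<Longrightarrow> a l \<ge> 0"
    and s: "(\<Sum>l=1..r. a l) \<le> s"
  shows "tame_pmf s (step_pmf r a q)"
proof -
  have step: "boolean_step r a q (step_pmf r a q)"
    using q a by (intro boolean_step_pmf) (auto simp: tame_pmf_def)
  have bound: "norm (\<Sum>l=1..r. of_real (a l) * pmf_cauchy (q l) z) \<le> s" if "norm z > s + 1" for z
  proof -
    have "norm (\<Sum>l=1..r. of_real (a l) * pmf_cauchy (q l) z) \<le> (\<Sum>l=1..r. a l * 1)"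
    proof (rule sum_norm_le)
      fix l assume l: "l \<in> {1..r}"
      have "norm (pmf_cauchy (q l) z) \<le> 1" using q[OF l] that by (simp add: tame_pmf_def)
      then show "norm (of_real (a l) * pmf_cauchy (q l) z) \<le> a l * 1"
        using a[OF l] mult_left_mono[of "norm (pmf_cauchy (q l) z)" 1 "a l"] by (simp add: norm_mult)
    qed
    then show ?thesis using s by simp
  qed
  have s0: "s \<ge> 0" using sum_nonneg[of "{1..r}" a] a s by simp
  show ?thesis
    unfolding tame_pmf_def
  proof (intro conjI ballI allI impI)
    show "finite (set_pmf (step_pmf r a q))" using step by (simp add: boolean_step_def)
  next
    fix y assume y: "y \<in> set_pmf (step_pmf r a q)"
    show "\<bar>y\<bar> \<le> s + 1"
    proof (rule ccontr)
      assume "\<not> \<bar>y\<bar> \<le> s + 1"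
      then have y1: "norm (complex_of_real y) > s + 1" by simp
      have "complex_of_real y = (\<Sum>l=1..r. of_real (a l) * pmf_cauchy (q l) (of_real y))"
        using step y unfolding boolean_step_def by blast
      then have "norm (complex_of_real y) \<le> s" using bound[OF y1] by simp
      then show False using y1 by simp
    qed
  next
    fix z :: complex assume z: "norm z > s + 1"
    define S where "S = (\<Sum>l=1..r. of_real (a l) * pmf_cauchy (q l) z)"
    have "norm (z - S) \<ge> norm z - norm S" by (rule norm_triangle_ineq2)
    then have 1: "norm (z - S) > 1" using bound[OF z] z by (simp add: S_def)
    have "\<forall>l\<in>{1..r}. z \<notin> of_real ` set_pmf (q l)"
      using q z by (force simp: tame_pmf_def)
    moreover have "z - S \<noteq> 0" using 1 by auto
    ultimately have "pmf_cauchy (step_pmf r a q) z = 1 / (z - S)"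
      using step unfolding boolean_step_def S_def by blast
    then show "norm (pmf_cauchy (step_pmf r a q) z) \<le> 1" using 1 by (simp add: norm_divide, subst divide_le_eq_1_pos) auto
  qed
qed

text \<open>In the upper half-plane the side conditions hold automatically: the atoms are real, and
  subtracting the sum cannot lower the imaginary part of \<open>z\<close>.\<close>

lemma pmf_cauchy_step:
  assumes q: "\<And>l. l \<in> {1..r} \<Longrightarrow> finite (set_pmf (q l))" and a: "\<And>l. l \<in> {1..r} \<Longrightarrow> a l \<ge> 0"
    and z: "Im z > 0"
  shows "pmf_cauchy (step_pmf r a q) z = 1 / (z - (\<Sum>l=1..r. of_real (a l) * pmf_cauchy (q l) z))"
proof -
  have "Im (\<Sum>l=1..r. of_real (a l) * pmf_cauchy (q l) z) \<le> 0"
    unfolding Im_sum using a Im_pmf_cauchy_nonpos[OF z] by (intro sum_nonpos) (auto intro: mult_nonneg_nonpos)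
  then have "z - (\<Sum>l=1..r. of_real (a l) * pmf_cauchy (q l) z) \<noteq> 0" using z by (auto simp: complex_eq_iff)
  moreover have "\<forall>l\<in>{1..r}. z \<notin> of_real ` set_pmf (q l)" using z by auto
  moreover have "boolean_step r a q (step_pmf r a q)" using q a by (rule boolean_step_pmf)
  ultimately show ?thesis unfolding boolean_step_def by blast
qed

lemma pmf_moment_0: "finite (set_pmf p) \<Longrightarrow> pmf_moment p 0 = 1"
  by (simp add: pmf_moment_def sum_pmf_eq_1)

lemma pmf_moment_step:
  assumes "\<And>l. l \<in> {1..r} \<Longrightarrow> finite (set_pmf (q l))" "\<And>l. l \<in> {1..r} \<Longrightarrow> a l \<ge> 0"
  shows "pmf_moment (step_pmf r a q) (Suc k) =
    (\<Sum>i<k. pmf_moment (step_pmf r a q) i * (\<Sum>l=1..r. a l * pmf_moment (q l) (k - Suc i)))"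
  using boolean_step_pmf[of r q a] assms unfolding boolean_step_def by blast

text \<open>The index \<open>j\<close> of the approximant is absent because it enters only through
  the factor \<open>b i j\<close>. The point mass at 0 has transform \<open>1 / z\<close>, which
  matches the start of \<open>K_approx\<close>; the weights of a step form column \<open>i\<close>
  of \<open>b\<close>.\<close>

primrec K_pmf :: "nat \<Rightarrow> (nat \<Rightarrow> nat \<Rightarrow> real) \<Rightarrow> nat \<Rightarrow> nat \<Rightarrow> real pmf" where
  "K_pmf r b 0 i = return_pmf 0"
| "K_pmf r b (Suc m) i = step_pmf r (\<lambda>l. b l i) (K_pmf r b m)"

text \<open>The recursion is triangular: a moment of the new law involves only lower moments of
  itself and of the input laws.\<close>

lemma convergent_pmf_moment_step:
  assumes fin: "\<And>m l. l \<in> {1..r} \<Longrightarrow> finite (set_pmf (q m l))" and a: "\<And>l. l \<in> {1..r} \<Longrightarrow> a l \<ge> 0"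
    and conv: "\<And>j l. j < k \<Longrightarrow> l \<in> {1..r} \<Longrightarrow> convergent (\<lambda>m. pmf_moment (q m l) j)"
  shows "convergent (\<lambda>m. pmf_moment (step_pmf r a (q m)) k)"
  using conv
proof (induction k rule: less_induct)
  case (less k)
  show ?case
  proof (cases k)
    case 0
    have "finite (set_pmf (step_pmf r a (q m)))" for m
      using boolean_step_pmf[of r "q m" a] fin a by (simp add: boolean_step_def)
    then show ?thesis using 0 by (simp add: pmf_moment_0 convergent_const)
  next
    case (Suc j)
    have "convergent (\<lambda>m. pmf_moment (step_pmf r a (q m)) i * (\<Sum>l=1..r. a l * pmf_moment (q m l) (j - Suc i)))"
      if "i < j" for i
      using that Suc by (intro convergent_mult convergent_sum convergent_const less) auto
    then have "convergent (\<lambda>m. \<Sum>i<j. pmf_moment (step_pmf r a (q m)) i * (\<Sum>l=1..r. a l * pmf_moment (q m l) (j - Suc i)))"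
      by (intro convergent_sum) auto
    moreover have "pmf_moment (step_pmf r a (q m)) k =
      (\<Sum>i<j. pmf_moment (step_pmf r a (q m)) i * (\<Sum>l=1..r. a l * pmf_moment (q m l) (j - Suc i)))" for m
      unfolding Suc by (rule pmf_moment_step) (use fin a in auto)
    ultimately show ?thesis by presburger
  qed
qed

section \<open>Limits of the approximating laws\<close>

definition tame_measure :: "real measure \<Rightarrow> bool" where
  "tame_measure \<mu> \<longleftrightarrow> real_distribution \<mu> \<and> (\<exists>R. AE x in \<mu>. \<bar>x\<bar> \<le> R)"

lemma pmf_limit:
  assumes tame: "\<And>m. tame_pmf s (p m)" and conv: "\<And>k. convergent (\<lambda>m. pmf_moment (p m) k)"
  obtains \<mu> where "tame_measure \<mu>"
    "\<And>k. (\<lambda>m. pmf_moment (p m) k) \<longlonglongrightarrow> (\<integral>x. x ^ k \<partial>\<mu>)"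
    "\<And>z. Im z > 0 \<Longrightarrow> (\<lambda>m. pmf_cauchy (p m) z) \<longlonglongrightarrow> cauchy_transform \<mu> z"
proof -
  have fin: "finite (set_pmf (p m))" for m using tame by (simp add: tame_pmf_def)
  have supp: "AE x in pmf_law (p m). \<bar>x\<bar> \<le> s + 1" for m
    using tame[of m] by (intro AE_pmf_law) (auto simp: tame_pmf_def)
  have "convergent (\<lambda>m. \<integral>x. x ^ k \<partial>pmf_law (p m))" for k
    unfolding moment_pmf_law[OF fin] by (rule conv)
  from moment_convergence[of "\<lambda>m. pmf_law (p m)", OF real_distribution_pmf_law supp this]
  obtain \<mu> where \<mu>: "real_distribution \<mu>" "AE x in \<mu>. \<bar>x\<bar> \<le> s + 1"
    and lim: "\<And>f :: real \<Rightarrow> real. continuous_on UNIV f \<Longrightarrow>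
      (\<lambda>n. \<integral>x. f x \<partial>pmf_law (p n)) \<longlonglongrightarrow> (\<integral>x. f x \<partial>\<mu>)" by blast
  show ?thesis
  proof (rule that[of \<mu>])
    show "tame_measure \<mu>" using \<mu> by (auto simp: tame_measure_def)
    show "(\<lambda>m. pmf_moment (p m) k) \<longlonglongrightarrow> (\<integral>x. x ^ k \<partial>\<mu>)" for k
      using lim[of "\<lambda>x. x ^ k"] moment_pmf_law[OF fin] by (simp add: continuous_intros)
    fix z :: complex assume z: "Im z > 0"
    have ne: "z - complex_of_real x \<noteq> 0" for x using z by (auto simp: complex_eq_iff)
    have cont: "continuous_on UNIV (\<lambda>x. 1 / (z - complex_of_real x))"
      using ne by (intro continuous_intros) auto
    \<comment> \<open>Convergence is available for real test functions only, so the kernel is split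
      into its real and imaginary parts.\<close>
    have Re_Im: "cauchy_transform M z = of_real (\<integral>x. Re (1 / (z - of_real x)) \<partial>M) + \<i> * of_real (\<integral>x. Im (1 / (z - of_real x)) \<partial>M)"
      if "real_distribution M" for M
    proof -
      have "integrable M (\<lambda>x. 1 / (z - complex_of_real x))"
        by (rule real_distribution.integrable_inverse_diff[OF that z])
      then show ?thesis
        unfolding cauchy_transform_def by (simp only: integral_Re integral_Im complex_eq[symmetric])
    qed
    have "(\<lambda>m. cauchy_transform (pmf_law (p m)) z) \<longlonglongrightarrow> cauchy_transform \<mu> z"
      unfolding Re_Im[OF real_distribution_pmf_law] Re_Im[OF \<mu>(1)]
      by (intro tendsto_intros lim continuous_on_Re continuous_on_Im cont)
    then show "(\<lambda>m. pmf_cauchy (p m) z) \<longlonglongrightarrow> cauchy_transform \<mu> z"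
      by (simp only: cauchy_transform_pmf_law[OF fin])
  qed
qed

context
  fixes r :: nat and b :: "nat \<Rightarrow> nat \<Rightarrow> real"
  assumes b: "\<And>i j. i \<in> {1..r} \<Longrightarrow> j \<in> {1..r} \<Longrightarrow> b i j \<ge> 0"
begin

lemma tame_K_pmf:
  assumes s: "s \<ge> 0" "\<And>i. i \<in> {1..r} \<Longrightarrow> (\<Sum>l=1..r. b l i) \<le> s" and i: "i \<in> {1..r}"
  shows "tame_pmf s (K_pmf r b m i)"
  using i
proof (induction m arbitrary: i)
  case 0
  have "norm (1 / z) \<le> 1" if "norm z > s + 1" for z :: complex
    using that s(1) by (simp add: norm_divide divide_le_eq_1)
  moreover have "pmf_cauchy (return_pmf 0) z = 1 / z" for z by (simp add: pmf_cauchy_def)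
  ultimately show ?case unfolding tame_pmf_def K_pmf.simps using s(1) by simp
next
  case (Suc m)
  show ?case
    unfolding K_pmf.simps by (rule tame_pmf_step) (use Suc b s(2) in blast)+
qed

lemma finite_K_pmf: "i \<in> {1..r} \<Longrightarrow> finite (set_pmf (K_pmf r b m i))"
proof (induction m arbitrary: i)
  case (Suc m)
  have "boolean_step r (\<lambda>l. b l i) (K_pmf r b m) (step_pmf r (\<lambda>l. b l i) (K_pmf r b m))"
    by (rule boolean_step_pmf) (use Suc b in blast)+
  then show ?case by (simp add: boolean_step_def)
qed simp

lemma K_approx_eq:
  assumes "Im z > 0" "i \<in> {1..r}"
  shows "K_approx r b m i j z = of_real (b i j) * pmf_cauchy (K_pmf r b m i) z"
  using assms(2)
proof (induction m arbitrary: i j)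
  case 0
  show ?case by (simp add: pmf_cauchy_def)
next
  case (Suc m)
  have "(\<Sum>p=1..r. K_approx r b m p i z) = (\<Sum>p=1..r. of_real (b p i) * pmf_cauchy (K_pmf r b m p) z)"
    by (intro sum.cong refl Suc.IH)
  moreover have "pmf_cauchy (step_pmf r (\<lambda>l. b l i) (K_pmf r b m)) z =
    1 / (z - (\<Sum>p=1..r. of_real (b p i) * pmf_cauchy (K_pmf r b m p) z))"
    by (rule pmf_cauchy_step) (use finite_K_pmf b Suc.prems assms(1) in blast)+
  ultimately show ?case by simp
qed

text \<open>The induction runs over the order \<open>k\<close> of the moment and not over the depth
  \<open>m\<close>. The step relates depth \<open>Suc m\<close> to depth \<open>m\<close>, and this
  shift does not affect convergence.\<close>

lemma convergent_moment_K_pmf: "i \<in> {1..r} \<Longrightarrow> convergent (\<lambda>m. pmf_moment (K_pmf r b m i) k)"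
proof (induction k arbitrary: i rule: less_induct)
  case (less k)
  have "convergent (\<lambda>m. pmf_moment (K_pmf r b (Suc m) i) k)"
    unfolding K_pmf.simps
  proof (rule convergent_pmf_moment_step)
    show "finite (set_pmf (K_pmf r b m l))" if "l \<in> {1..r}" for m l using that by (rule finite_K_pmf)
    show "b l i \<ge> 0" if "l \<in> {1..r}" for l using that less.prems by (rule b)
    show "convergent (\<lambda>m. pmf_moment (K_pmf r b m l) j)" if "j < k" "l \<in> {1..r}" for j l
      using that by (rule less.IH)
  qed
  then show ?case by (rule convergent_Suc_iff[of "\<lambda>m. pmf_moment (K_pmf r b m i) k", THEN iffD1])
qed

lemma K_limit_measures:
  obtains \<nu> where
    "\<And>i. i \<in> {1..r} \<Longrightarrow> tame_measure (\<nu> i)"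
    "\<And>i z. i \<in> {1..r} \<Longrightarrow> Im z > 0 \<Longrightarrow> (\<lambda>m. pmf_cauchy (K_pmf r b m i) z) \<longlonglongrightarrow> cauchy_transform (\<nu> i) z"
    "\<And>i k. i \<in> {1..r} \<Longrightarrow> (\<lambda>m. pmf_moment (K_pmf r b m i) k) \<longlonglongrightarrow> (\<integral>x. x ^ k \<partial>\<nu> i)"
proof -
  \<comment> \<open>One bound for all column sums at once: a step for \<open>i\<close> uses the laws
    of every other index, so they must share the same \<open>s\<close>.\<close>
  define s where "s = (\<Sum>i=1..r. \<Sum>l=1..r. b l i)"
  have s0: "s \<ge> 0" unfolding s_def using b by (intro sum_nonneg) auto
  have s: "(\<Sum>l=1..r. b l i) \<le> s" if "i \<in> {1..r}" for i
    unfolding s_def using b that by (intro member_le_sum[of _ _ "\<lambda>i. \<Sum>l=1..r. b l i"] sum_nonneg) auto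
  have "\<exists>\<mu>. tame_measure \<mu> \<and> (\<forall>k. (\<lambda>m. pmf_moment (K_pmf r b m i) k) \<longlonglongrightarrow> (\<integral>x. x ^ k \<partial>\<mu>)) \<and>
    (\<forall>z. Im z > 0 \<longrightarrow> (\<lambda>m. pmf_cauchy (K_pmf r b m i) z) \<longlonglongrightarrow> cauchy_transform \<mu> z)" if "i \<in> {1..r}" for i
    by (rule pmf_limit[of s "\<lambda>m. K_pmf r b m i", OF tame_K_pmf[OF s0 s that] convergent_moment_K_pmf[OF that]])
      blast+
  then show ?thesis using that by metis
qed

end

lemma pmf_moment_step_limit:
  assumes q: "\<And>m l. l \<in> {1..r} \<Longrightarrow> finite (set_pmf (q m l))" and a: "\<And>l. l \<in> {1..r} \<Longrightarrow> a l \<ge> 0"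
    and M: "\<And>k. (\<lambda>m. pmf_moment (step_pmf r a (q m)) k) \<longlonglongrightarrow> M k"
    and N: "\<And>l k. l \<in> {1..r} \<Longrightarrow> (\<lambda>m. pmf_moment (q m l) k) \<longlonglongrightarrow> N l k"
  shows "M (Suc k) = (\<Sum>i<k. M i * (\<Sum>l=1..r. a l * N l (k - Suc i)))"
proof (rule LIMSEQ_unique[OF M])
  have "pmf_moment (step_pmf r a (q m)) (Suc k) =
    (\<Sum>i<k. pmf_moment (step_pmf r a (q m)) i * (\<Sum>l=1..r. a l * pmf_moment (q m l) (k - Suc i)))" for m
    by (rule pmf_moment_step) (use q a in blast)+
  moreover have "(\<lambda>m. \<Sum>i<k. pmf_moment (step_pmf r a (q m)) i * (\<Sum>l=1..r. a l * pmf_moment (q m l) (k - Suc i)))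
    \<longlonglongrightarrow> (\<Sum>i<k. M i * (\<Sum>l=1..r. a l * N l (k - Suc i)))"
    by (intro tendsto_intros M N)
  ultimately show "(\<lambda>m. pmf_moment (step_pmf r a (q m)) (Suc k)) \<longlonglongrightarrow> (\<Sum>i<k. M i * (\<Sum>l=1..r. a l * N l (k - Suc i)))"
    by presburger
qed

section \<open>Moment generating functions\<close>

definition moment_fps :: "real measure \<Rightarrow> real fps" where
  "moment_fps \<mu> = Abs_fps (\<lambda>k. \<integral>x. x ^ k \<partial>\<mu>)"

text \<open>With \<open>M(x) = G(1/x) / x\<close> this is the equation
  \<open>G = 1 / (z - K)\<close> in power series form. One factor \<open>fps_X\<close> stems from
  \<open>Suc k\<close> on the left, the other from \<open>k - Suc i\<close>; coefficient 1 is the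
  empty sum.\<close>

lemma moment_fps_eqI:
  assumes "real_distribution \<mu>"
    and "\<And>k. (\<integral>x. x ^ Suc k \<partial>\<mu>) = (\<Sum>i<k. (\<integral>x. x ^ i \<partial>\<mu>) * (\<Sum>l=1..r. a l * (\<integral>x. x ^ (k - Suc i) \<partial>\<nu> l)))"
  shows "moment_fps \<mu> = 1 + fps_X\<^sup>2 * (\<Sum>l=1..r. fps_const (a l) * moment_fps (\<nu> l)) * moment_fps \<mu>"
proof (rule fps_ext)
  fix n
  interpret real_distribution \<mu> by fact
  let ?Q = "\<Sum>l=1..r. fps_const (a l) * moment_fps (\<nu> l)"
  have alt: "fps_X\<^sup>2 * ?Q * moment_fps \<mu> = fps_X * (fps_X * (moment_fps \<mu> * ?Q))"
    by (simp add: power2_eq_square mult_ac)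
  consider "n = 0" | "n = Suc 0" | k where "n = Suc (Suc k)" by (metis not0_implies_Suc)
  then show "fps_nth (moment_fps \<mu>) n = fps_nth (1 + fps_X\<^sup>2 * ?Q * moment_fps \<mu>) n"
  proof cases
    case 1
    then show ?thesis unfolding alt using prob_space by (simp add: moment_fps_def)
  next
    case 2
    then show ?thesis unfolding alt using assms(2)[of 0] by (simp add: moment_fps_def)
  next
    case 3
    have "fps_nth (moment_fps \<mu>) n = (\<integral>x. x ^ Suc (Suc k) \<partial>\<mu>)" by (simp only: 3 moment_fps_def fps_nth_Abs_fps)
    also have "\<dots> = (\<Sum>i<Suc k. (\<integral>x. x ^ i \<partial>\<mu>) * (\<Sum>l=1..r. a l * (\<integral>x. x ^ (Suc k - Suc i) \<partial>\<nu> l)))"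
      by (rule assms(2))
    also have "\<dots> = fps_nth (moment_fps \<mu> * ?Q) k"
      unfolding fps_mult_nth by (intro sum.cong) (auto simp: fps_sum_nth moment_fps_def)
    finally show ?thesis unfolding alt 3 by simp
  qed
qed

text \<open>The weights \<open>a\<close> in the last conclusion are left free so that the individual
  factors, the partial boolean convolutions and the full one are all instances of it.\<close>

theorem K_fraction_measures:
  fixes r :: nat and b :: "nat \<Rightarrow> nat \<Rightarrow> real"
  assumes b: "\<And>i j. i \<in> {1..r} \<Longrightarrow> j \<in> {1..r} \<Longrightarrow> b i j \<ge> 0"
  obtains \<nu> where
    "\<And>i j z. i \<in> {1..r} \<Longrightarrow> Im z > 0 \<Longrightarrow> K_fraction r b i j z = of_real (b i j) * cauchy_transform (\<nu> i) z"
    "\<And>i. i \<in> {1..r} \<Longrightarrow>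
       moment_fps (\<nu> i) = 1 + fps_X\<^sup>2 * (\<Sum>l=1..r. fps_const (b l i) * moment_fps (\<nu> l)) * moment_fps (\<nu> i)"
    "\<And>a. (\<And>l. l \<in> {1..r} \<Longrightarrow> a l \<ge> 0) \<Longrightarrow> \<exists>\<mu>. tame_measure \<mu> \<and>
       has_K_transform \<mu> (\<lambda>z. \<Sum>l=1..r. of_real (a l) * cauchy_transform (\<nu> l) z) \<and>
       moment_fps \<mu> = 1 + fps_X\<^sup>2 * (\<Sum>l=1..r. fps_const (a l) * moment_fps (\<nu> l)) * moment_fps \<mu>"
proof -
  obtain \<nu> where
    tame: "\<And>i. i \<in> {1..r} \<Longrightarrow> tame_measure (\<nu> i)" and
    G: "\<And>i z. i \<in> {1..r} \<Longrightarrow> Im z > 0 \<Longrightarrow> (\<lambda>m. pmf_cauchy (K_pmf r b m i) z) \<longlonglongrightarrow> cauchy_transform (\<nu> i) z" and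
    M: "\<And>i k. i \<in> {1..r} \<Longrightarrow> (\<lambda>m. pmf_moment (K_pmf r b m i) k) \<longlonglongrightarrow> (\<integral>x. x ^ k \<partial>\<nu> i)"
    using K_limit_measures[of r b, OF b] by blast
  have fin: "finite (set_pmf (K_pmf r b m l))" if "l \<in> {1..r}" for m l
    using b that by (rule finite_K_pmf)
  show ?thesis
  proof (rule that[of \<nu>])
    fix i j :: nat and z :: complex assume i: "i \<in> {1..r}" and z: "Im z > 0"
    have "K_approx r b m i j z = of_real (b i j) * pmf_cauchy (K_pmf r b m i) z" for m
      using b z i by (rule K_approx_eq)
    moreover have "(\<lambda>m. of_real (b i j) * pmf_cauchy (K_pmf r b m i) z) \<longlonglongrightarrow> of_real (b i j) * cauchy_transform (\<nu> i) z"
      using G[OF i z] by (intro tendsto_intros)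
    ultimately show "K_fraction r b i j z = of_real (b i j) * cauchy_transform (\<nu> i) z"
      unfolding K_fraction_def by (intro limI) presburger
  next
    fix i assume i: "i \<in> {1..r}"
    show "moment_fps (\<nu> i) = 1 + fps_X\<^sup>2 * (\<Sum>l=1..r. fps_const (b l i) * moment_fps (\<nu> l)) * moment_fps (\<nu> i)"
    proof (rule moment_fps_eqI)
      show "real_distribution (\<nu> i)" using tame[OF i] by (simp add: tame_measure_def)
      have lim: "(\<lambda>m. pmf_moment (step_pmf r (\<lambda>l. b l i) (K_pmf r b m)) k) \<longlonglongrightarrow> (\<integral>x. x ^ k \<partial>\<nu> i)" for k
        using M[OF i, of k, THEN LIMSEQ_Suc] by simp
      fix k
      show "(\<integral>x. x ^ Suc k \<partial>\<nu> i) = (\<Sum>j<k. (\<integral>x. x ^ j \<partial>\<nu> i) * (\<Sum>l=1..r. b l i * (\<integral>x. x ^ (k - Suc j) \<partial>\<nu> l)))"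
        by (rule pmf_moment_step_limit[where q = "K_pmf r b" and M = "\<lambda>k. \<integral>x. x ^ k \<partial>\<nu> i" and N = "\<lambda>l k. \<integral>x. x ^ k \<partial>\<nu> l" and a = "\<lambda>l. b l i"])
          (use fin b i lim M in blast)+
    qed
  next
    fix a :: "nat \<Rightarrow> real" assume a: "\<And>l. l \<in> {1..r} \<Longrightarrow> a l \<ge> 0"
    \<comment> \<open>Both summands are nonnegative, so \<open>s\<close> dominates the column sums
      of \<open>b\<close> and also the total weight of the additional step.\<close>
    define s where "s = (\<Sum>i=1..r. \<Sum>l=1..r. b l i) + (\<Sum>l=1..r. a l)"
    have b0: "(\<Sum>l=1..r. b l i) \<ge> 0" if "i \<in> {1..r}" for i using b[OF _ that] by (intro sum_nonneg) blast
    have a0: "(\<Sum>l=1..r. a l) \<ge> 0" using a by (intro sum_nonneg) blast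
    have sb: "(\<Sum>i=1..r. \<Sum>l=1..r. b l i) \<ge> 0" using b0 by (rule sum_nonneg)
    have s: "(\<Sum>l=1..r. b l i) \<le> s" if "i \<in> {1..r}" for i
    proof -
      have "(\<Sum>l=1..r. b l i) \<le> (\<Sum>i=1..r. \<Sum>l=1..r. b l i)"
        by (rule member_le_sum[of i "{1..r}" "\<lambda>i. \<Sum>l=1..r. b l i"]) (use that b0 in blast, use b0 in blast, simp)
      then show ?thesis using a0 by (simp add: s_def)
    qed
    have "tame_pmf s (K_pmf r b m l)" if "l \<in> {1..r}" for m l
      by (rule tame_K_pmf[OF b _ s that]) (use sb a0 in \<open>simp_all add: s_def\<close>)
    then have tame_p: "tame_pmf s (step_pmf r a (K_pmf r b m))" for m
      by (rule tame_pmf_step[OF _ a]) (use sb in \<open>simp_all add: s_def\<close>)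
    have "convergent (\<lambda>m. pmf_moment (step_pmf r a (K_pmf r b m)) k)" for k
      by (rule convergent_pmf_moment_step[OF fin a convergent_moment_K_pmf[OF b]])
    from pmf_limit[of s "\<lambda>m. step_pmf r a (K_pmf r b m)", OF tame_p this]
    obtain \<mu> where \<mu>: "tame_measure \<mu>"
      and M\<mu>: "\<And>k. (\<lambda>m. pmf_moment (step_pmf r a (K_pmf r b m)) k) \<longlonglongrightarrow> (\<integral>x. x ^ k \<partial>\<mu>)"
      and G\<mu>: "\<And>z. Im z > 0 \<Longrightarrow> (\<lambda>m. pmf_cauchy (step_pmf r a (K_pmf r b m)) z) \<longlonglongrightarrow> cauchy_transform \<mu> z"
      by blast
    have distr: "real_distribution \<mu>" using \<mu> by (simp add: tame_measure_def)
    have "moment_fps \<mu> = 1 + fps_X\<^sup>2 * (\<Sum>l=1..r. fps_const (a l) * moment_fps (\<nu> l)) * moment_fps \<mu>"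
    proof (rule moment_fps_eqI[OF distr])
      fix k
      show "(\<integral>x. x ^ Suc k \<partial>\<mu>) = (\<Sum>j<k. (\<integral>x. x ^ j \<partial>\<mu>) * (\<Sum>l=1..r. a l * (\<integral>x. x ^ (k - Suc j) \<partial>\<nu> l)))"
        by (rule pmf_moment_step_limit[where q = "K_pmf r b" and M = "\<lambda>k. \<integral>x. x ^ k \<partial>\<mu>" and N = "\<lambda>l k. \<integral>x. x ^ k \<partial>\<nu> l" and a = a])
          (use fin a M\<mu> M in blast)+
    qed
    moreover have "has_K_transform \<mu> (\<lambda>z. \<Sum>l=1..r. of_real (a l) * cauchy_transform (\<nu> l) z)"
      unfolding has_K_transform_def
    proof (intro conjI allI impI distr)
      fix z :: complex assume z: "Im z > 0"
      let ?T = "\<Sum>l=1..r. of_real (a l) * cauchy_transform (\<nu> l) z"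
      have T: "(\<lambda>m. \<Sum>l=1..r. of_real (a l) * pmf_cauchy (K_pmf r b m l) z) \<longlonglongrightarrow> ?T"
        using G[OF _ z] by (intro tendsto_intros) blast
      have "Im (of_real (a l) * pmf_cauchy (K_pmf r b m l) z) \<le> 0" if "l \<in> {1..r}" for m l
        using a[OF that] Im_pmf_cauchy_nonpos[OF z] by (simp add: mult_nonneg_nonpos)
      then have "Im (\<Sum>l=1..r. of_real (a l) * pmf_cauchy (K_pmf r b m l) z) \<le> 0" for m
        unfolding Im_sum by (intro sum_nonpos) blast
      \<comment> \<open>The sign of the imaginary part survives the limit and keeps the limiting
        denominator away from zero.\<close>
      then have "Im ?T \<le> 0"
        using LIMSEQ_le_const2[OF tendsto_Im[OF T], of 0] by blast
      then have ne: "z - ?T \<noteq> 0" using z by (auto simp: complex_eq_iff)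
      have "pmf_cauchy (step_pmf r a (K_pmf r b m)) z =
        1 / (z - (\<Sum>l=1..r. of_real (a l) * pmf_cauchy (K_pmf r b m l) z))" for m
        by (rule pmf_cauchy_step[OF fin a z])
      moreover have "(\<lambda>m. 1 / (z - (\<Sum>l=1..r. of_real (a l) * pmf_cauchy (K_pmf r b m l) z))) \<longlonglongrightarrow> 1 / (z - ?T)"
        by (intro tendsto_intros T ne)
      ultimately have "(\<lambda>m. pmf_cauchy (step_pmf r a (K_pmf r b m)) z) \<longlonglongrightarrow> 1 / (z - ?T)"
        by presburger
      then have "cauchy_transform \<mu> z = 1 / (z - ?T)" using G\<mu>[OF z] LIMSEQ_unique by blast
      then show "K_transform \<mu> z = ?T" by (simp add: K_transform_def F_transform_def)
    qed
    ultimately show "\<exists>\<mu>. tame_measure \<mu> \<and>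
       has_K_transform \<mu> (\<lambda>z. \<Sum>l=1..r. of_real (a l) * cauchy_transform (\<nu> l) z) \<and>
       moment_fps \<mu> = 1 + fps_X\<^sup>2 * (\<Sum>l=1..r. fps_const (a l) * moment_fps (\<nu> l)) * moment_fps \<mu>"
      using \<mu> by blast
  qed
qed

section \<open>Words in matricially free variables\<close>

lemma complex_ring_simps [simp]:
  "carrier complex_ring = UNIV" "mult complex_ring = (*)" "one complex_ring = 1"
  "zero complex_ring = 0" "add complex_ring = (+)"
  by (simp_all add: complex_ring_def)

lemma gen_subalgebra_incl: "x \<in> S \<Longrightarrow> x \<in> gen_subalgebra A S"
  by (auto simp: gen_subalgebra_def)

lemma gen_subalgebra_mult:
  "x \<in> gen_subalgebra A S \<Longrightarrow> y \<in> gen_subalgebra A S \<Longrightarrow> x \<otimes>\<^bsub>A\<^esub> y \<in> gen_subalgebra A S"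
  by (auto simp: gen_subalgebra_def is_subalgebra_def)

text \<open>A letter \<open>((i, j), k)\<close> encodes the centred power of exponent
  \<open>k\<close> of the variable with index \<open>(i, j)\<close>.\<close>

type_synonym 'i word = "(('i \<times> 'i) \<times> nat) list"

text \<open>Creation in front of a valid word gives zero or another valid word, so these words
  suffice. The empty word is added by hand because \<open>Lambda_seqs\<close> contains nonempty
  lists only.\<close>

definition valid_word :: "'i set \<Rightarrow> 'i word \<Rightarrow> bool" where
  "valid_word I w \<longleftrightarrow> (w = [] \<or> map fst w \<in> Lambda_seqs I) \<and> (\<forall>x\<in>set w. snd x \<ge> 1)"

lemma valid_word_Nil [simp]: "valid_word I []"
  by (simp add: valid_word_def)

lemma valid_word_singleton: "valid_word I [((i, j), k)] \<longleftrightarrow> i \<in> I \<and> i = j \<and> k \<ge> 1"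
  by (auto simp: valid_word_def Lambda_seqs_def)

lemma valid_word_Cons_Cons:
  "valid_word I (((i, j), k) # ((i', j'), k') # w) \<longleftrightarrow>
     i \<in> I \<and> j = i' \<and> (i, j) \<noteq> (i', j') \<and> k \<ge> 1 \<and> valid_word I (((i', j'), k') # w)"
  by (auto simp: valid_word_def Lambda_seqs_def)

lemma valid_word_tl: "valid_word I (x # w) \<Longrightarrow> valid_word I w"
proof (cases w)
  case (Cons y w')
  obtain i j k i' j' k' where "x = ((i, j), k)" "y = ((i', j'), k')" by (metis surj_pair)
  then show "valid_word I (x # w) \<Longrightarrow> valid_word I w" using Cons by (simp add: valid_word_Cons_Cons)
qed simp

lemma valid_word_exponent: "valid_word I ((p, k) # w) \<Longrightarrow> k' \<ge> 1 \<Longrightarrow> valid_word I ((p, k') # w)"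
  by (auto simp: valid_word_def)

section \<open>Action of one variable on centred words\<close>

locale matricially_free_array =
  fixes A :: "('a, 'm) star_algebra_scheme" (structure)
    and I :: "'i set" and \<phi> :: "'a \<Rightarrow> complex" and \<psi> :: "'i \<Rightarrow> 'a \<Rightarrow> complex"
    and X e :: "'i \<Rightarrow> 'i \<Rightarrow> 'a"
  assumes free: "matricially_free A I \<phi> \<psi> (\<lambda>i j. gen_subalgebra A {X i j, e i j}) e"
    and finite_I: "finite I"
    and X_closed: "\<And>i j. i \<in> I \<Longrightarrow> j \<in> I \<Longrightarrow> X i j \<in> carrier A"
    and centered: "\<And>i j. i \<in> I \<Longrightarrow> j \<in> I \<Longrightarrow> state_array \<phi> \<psi> i j (X i j) = 0"

sublocale matricially_free_array \<subseteq> unital_star_algebra A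
  using free by (auto simp: matricially_free_def matricial_setting_def)

context matricially_free_array
begin

abbreviation Alg :: "'i \<Rightarrow> 'i \<Rightarrow> 'a set" where
  "Alg i j \<equiv> gen_subalgebra A {X i j, e i j}"

lemma setting: "matricial_setting A I \<phi> \<psi> Alg e"
  using free by (simp add: matricially_free_def)

lemma subalgebra: "i \<in> I \<Longrightarrow> j \<in> I \<Longrightarrow> is_subalgebra A (Alg i j)"
  using setting by (auto simp: matricial_setting_def is_star_subalgebra_def)

lemma Alg_closed: "i \<in> I \<Longrightarrow> j \<in> I \<Longrightarrow> x \<in> Alg i j \<Longrightarrow> x \<in> carrier A"
  using subalgebra[of i j] by (auto simp: is_subalgebra_def)

lemma e_closed: "i \<in> I \<Longrightarrow> j \<in> I \<Longrightarrow> e i j \<in> carrier A"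
  by (rule Alg_closed[of i j]) (auto intro: gen_subalgebra_incl)

lemma unit_Alg:
  assumes "i \<in> I" "j \<in> I" "x \<in> Alg i j"
  shows "e i j \<otimes> x = x" "x \<otimes> e i j = x"
proof -
  have "internal_unit A (Alg i j) (e i j)"
    using setting assms(1,2) by (auto simp: matricial_setting_def)
  then show "e i j \<otimes> x = x" "x \<otimes> e i j = x" using assms(3) by (auto simp: internal_unit_def)
qed

lemma state_\<phi>: "state A \<phi>"
  using setting by (simp add: matricial_setting_def)

lemma state_\<Phi>: "i \<in> I \<Longrightarrow> j \<in> I \<Longrightarrow> state A (state_array \<phi> \<psi> i j)"
  using setting by (auto simp: matricial_setting_def state_array_def)

lemma \<Phi>_e: "i \<in> I \<Longrightarrow> j \<in> I \<Longrightarrow> state_array \<phi> \<psi> i j (e i j) = 1"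
  using setting by (auto simp: matricial_setting_def state_array_def)

lemma \<phi>_e: "i \<in> I \<Longrightarrow> j \<in> I \<Longrightarrow> \<phi> (e i j) = (if i = j then 1 else 0)"
  using setting by (auto simp: matricial_setting_def)

lemma \<phi>_add: "x \<in> carrier A \<Longrightarrow> y \<in> carrier A \<Longrightarrow> \<phi> (x \<oplus> y) = \<phi> x + \<phi> y"
  using state_\<phi> by (simp add: state_def)

lemma \<phi>_smult: "x \<in> carrier A \<Longrightarrow> \<phi> (c \<odot> x) = c * \<phi> x"
  using state_\<phi> by (simp add: state_def)

lemma \<phi>_one: "\<phi> \<one> = 1"
  using state_\<phi> by (simp add: state_def)

text \<open>Exponent 0 is excluded: it would be the ambient unit, which need not lie in the
  subalgebra.\<close>

lemma X_pow_Alg: "i \<in> I \<Longrightarrow> j \<in> I \<Longrightarrow> k \<ge> 1 \<Longrightarrow> X i j [^] (k::nat) \<in> Alg i j"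
proof (induction k)
  case (Suc k)
  have X: "X i j \<in> Alg i j" by (auto intro: gen_subalgebra_incl)
  show ?case
  proof (cases "k = 0")
    case True
    then show ?thesis using X X_closed Suc.prems by simp
  next
    case False
    then show ?thesis using Suc X by (auto intro: gen_subalgebra_mult)
  qed
qed simp

definition moment :: "'i \<times> 'i \<Rightarrow> nat \<Rightarrow> complex" where
  "moment p k = state_array \<phi> \<psi> (fst p) (snd p) (X (fst p) (snd p) [^] k)"

text \<open>The internal unit, not the ambient one, is subtracted, so that the centred power stays
  in its subalgebra. For exponent 1 the correction vanishes and the letter is the variable.\<close>

definition letter :: "('i \<times> 'i) \<times> nat \<Rightarrow> 'a" where
  "letter x = X (fst (fst x)) (snd (fst x)) [^] snd x \<oplus> (- moment (fst x) (snd x)) \<odot> e (fst (fst x)) (snd (fst x))"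

definition word_elem :: "'i word \<Rightarrow> 'a" where
  "word_elem w = word_prod A (map letter w)"

lemma moment_1: "i \<in> I \<Longrightarrow> j \<in> I \<Longrightarrow> moment (i, j) (Suc 0) = 0"
  using centered X_closed by (simp add: moment_def)

lemma letter_closed: "i \<in> I \<Longrightarrow> j \<in> I \<Longrightarrow> letter ((i, j), k) \<in> carrier A"
  using X_closed e_closed by (simp add: letter_def)

lemma letter_1: "i \<in> I \<Longrightarrow> j \<in> I \<Longrightarrow> letter ((i, j), Suc 0) = X i j"
  using X_closed e_closed smult_l_null[of "e i j"] by (simp add: letter_def moment_1)

lemma letter_centered:
  assumes "i \<in> I" "j \<in> I" "k \<ge> 1"
  shows "letter ((i, j), k) \<in> Alg i j" "state_array \<phi> \<psi> i j (letter ((i, j), k)) = 0"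
proof -
  have e: "e i j \<in> Alg i j" by (auto intro: gen_subalgebra_incl)
  show "letter ((i, j), k) \<in> Alg i j"
    using subalgebra[OF assms(1,2)] e X_pow_Alg[OF assms] by (simp add: letter_def is_subalgebra_def)
  show "state_array \<phi> \<psi> i j (letter ((i, j), k)) = 0"
    using state_\<Phi>[OF assms(1,2)] \<Phi>_e[OF assms(1,2)] X_closed e_closed assms
    by (simp add: letter_def state_def moment_def)
qed

lemma word_elem_Nil: "word_elem [] = \<one>"
  by (simp add: word_elem_def word_prod_def)

lemma word_elem_Cons: "word_elem (x # w) = letter x \<otimes> word_elem w"
  by (simp add: word_elem_def word_prod_def)

lemma word_elem_closed: "set (map fst w) \<subseteq> I \<times> I \<Longrightarrow> word_elem w \<in> carrier A"
  by (induction w) (auto simp: word_elem_Nil word_elem_Cons intro!: letter_closed)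

lemma valid_word_subset: "valid_word I w \<Longrightarrow> set (map fst w) \<subseteq> I \<times> I"
  by (auto simp: valid_word_def Lambda_seqs_def)

lemma valid_word_closed: "valid_word I w \<Longrightarrow> word_elem w \<in> carrier A"
  by (intro word_elem_closed valid_word_subset)

lemma valid_word_centered:
  assumes "valid_word I w"
  shows "centered_word (state_array \<phi> \<psi>) Alg (map fst w) (map letter w)"
  unfolding centered_word_def list_all2_map1 list_all2_map2
proof (rule list_all2_same[THEN iffD2], rule ballI)
  fix x assume x: "x \<in> set w"
  obtain i j k where [simp]: "x = ((i, j), k)" by (metis surj_pair)
  have "i \<in> I" "j \<in> I" using valid_word_subset[OF assms] x by force+
  moreover have "k \<ge> 1" using assms x by (force simp: valid_word_def)
  ultimately show "(\<lambda>(i, j) a. a \<in> Alg i j \<and> state_array \<phi> \<psi> i j a = 0) (fst x) (letter x)"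
    using letter_centered by simp
qed

lemma free_units:
  assumes "a \<in> carrier A" "ps \<noteq> []" "set (p # ps) \<subseteq> I \<times> I" "distinct_adj (p # ps)"
    "centered_word (state_array \<phi> \<psi>) Alg ps as"
  shows "\<phi> (a \<otimes> e (fst p) (snd p) \<otimes> word_prod A as) =
    (if p # ps \<in> Lambda_seqs I then \<phi> (a \<otimes> word_prod A as) else 0)"
  using free assms unfolding matricially_free_def matricially_free_units_def by blast

lemma sandwich:
  assumes "a \<in> carrier A" "u1 \<in> unit_algebra A I e" "u2 \<in> unit_algebra A I e"
  shows "\<phi> (u1 \<otimes> a \<otimes> u2) = \<phi> u1 * \<phi> a * \<phi> u2"
  using free assms unfolding matricially_free_def matricially_free_units_def by blast

text \<open>The unit condition for words needs a nonempty word to the right, so a unit at the right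
  end is handled by the sandwich property. The unit algebra need not contain the ambient unit;
  \<open>e j j\<close>, where \<phi> is 1, serves as the neutral outer factor.\<close>

lemma \<phi>_mult_e:
  assumes a: "a \<in> carrier A" and ij: "i \<in> I" "j \<in> I"
  shows "\<phi> (a \<otimes> e i j) = (if i = j then \<phi> a else 0)"
proof -
  have U: "e k l \<in> unit_algebra A I e" if "k \<in> I" "l \<in> I" for k l
    unfolding unit_algebra_def using that by (intro gen_subalgebra_incl) blast
  have prod: "e i j \<otimes> e j j \<in> unit_algebra A I e"
    using U[OF ij] U[OF ij(2) ij(2)] unfolding unit_algebra_def by (rule gen_subalgebra_mult)
  note closed = a e_closed[OF ij] e_closed[OF ij(2) ij(2)]
  have "\<phi> (a \<otimes> e i j) = \<phi> (e j j \<otimes> (a \<otimes> e i j) \<otimes> e j j)"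
    using sandwich[of "a \<otimes> e i j" "e j j" "e j j"] U ij closed \<phi>_e by simp
  also have "e j j \<otimes> (a \<otimes> e i j) \<otimes> e j j = e j j \<otimes> a \<otimes> (e i j \<otimes> e j j)"
    using closed by (simp add: m_assoc)
  also have "\<phi> \<dots> = \<phi> a * \<phi> (e i j \<otimes> \<one> \<otimes> e j j)"
    using sandwich[OF a U[OF ij(2) ij(2)] prod] closed \<phi>_e ij by simp
  also have "\<phi> (e i j \<otimes> \<one> \<otimes> e j j) = \<phi> (e i j)"
    using sandwich[of \<one> "e i j" "e j j"] U ij \<phi>_e \<phi>_one by simp
  finally show ?thesis using ij by (simp add: \<phi>_e)
qed

lemma X_e:
  assumes "i \<in> I" "j \<in> I"
  shows "X i j \<otimes> e i j = X i j"
  using unit_Alg(2)[OF assms, of "X i j"] by (simp add: gen_subalgebra_incl)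

text \<open>In vector language: since \<open>X i j\<close> absorbs \<open>e i j\<close> on its
  right, an off-diagonal variable annihilates the vacuum.\<close>

lemma \<phi>_mult_X:
  assumes a: "a \<in> carrier A" and ij: "i \<in> I" "j \<in> I" "i \<noteq> j"
  shows "\<phi> (a \<otimes> X i j) = 0"
proof -
  have "a \<otimes> X i j = (a \<otimes> X i j) \<otimes> e i j"
    using a X_closed[OF ij(1,2)] e_closed[OF ij(1,2)] X_e[OF ij(1,2)] by (simp add: m_assoc)
  then show ?thesis using \<phi>_mult_e[of "a \<otimes> X i j" i j] a X_closed ij by simp
qed

text \<open>A unit \<open>e i j\<close> is inserted after \<open>X i j\<close> and meets a centred
  word, so the unit condition applies. As the index list of the word is already admissible, only the
  matching \<open>j = i'\<close> decides.\<close>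

lemma \<phi>_creation:
  assumes a: "a \<in> carrier A" and w: "valid_word I (((i', j'), k) # w)" and ij: "i \<in> I" "j \<in> I" "(i, j) \<noteq> (i', j')"
  shows "\<phi> (a \<otimes> (X i j \<otimes> word_elem (((i', j'), k) # w))) =
    (if j = i' then \<phi> (a \<otimes> word_elem (((i, j), 1) # ((i', j'), k) # w)) else 0)"
proof -
  let ?w = "((i', j'), k) # w"
  note closed = a X_closed[OF ij(1,2)] e_closed[OF ij(1,2)] valid_word_closed[OF w]
  have L: "map fst ?w \<in> Lambda_seqs I" using w by (auto simp: valid_word_def)
  have Lp: "(i, j) # map fst ?w \<in> Lambda_seqs I \<longleftrightarrow> j = i'"
    using L ij by (auto simp: Lambda_seqs_def)
  have "\<phi> (a \<otimes> (X i j \<otimes> word_elem ?w)) = \<phi> (a \<otimes> X i j \<otimes> e i j \<otimes> word_elem ?w)"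
    using closed X_e[OF ij(1,2)] by (simp add: m_assoc)
  also have "\<dots> = (if (i, j) # map fst ?w \<in> Lambda_seqs I then \<phi> (a \<otimes> X i j \<otimes> word_elem ?w) else 0)"
  proof -
    have "\<phi> (a \<otimes> X i j \<otimes> e (fst (i, j)) (snd (i, j)) \<otimes> word_prod A (map letter ?w)) =
      (if (i, j) # map fst ?w \<in> Lambda_seqs I then \<phi> (a \<otimes> X i j \<otimes> word_prod A (map letter ?w)) else 0)"
    proof (rule free_units)
      show "centered_word (state_array \<phi> \<psi>) Alg (map fst ?w) (map letter ?w)"
        using w by (rule valid_word_centered)
      show "distinct_adj ((i, j) # map fst ?w)" using L ij by (simp add: Lambda_seqs_def)
      show "set ((i, j) # map fst ?w) \<subseteq> I \<times> I" using valid_word_subset[OF w] ij by simp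
    qed (use closed in auto)
    then show ?thesis by (simp add: word_elem_def)
  qed
  also have "a \<otimes> X i j \<otimes> word_elem ?w = a \<otimes> word_elem (((i, j), 1) # ?w)"
    using closed ij by (simp add: m_assoc word_elem_Cons[of "((i, j), Suc 0)"] letter_1)
  finally show ?thesis using Lp by simp
qed

text \<open>The unit of the leading letter acts as the identity on the remaining word. If nothing
  remains, the letter is diagonal and \<open>\<phi>_mult_e\<close> takes over.\<close>

lemma \<phi>_unit_word:
  assumes a: "a \<in> carrier A" and w: "valid_word I (((i, j), k) # w)"
  shows "\<phi> (a \<otimes> (e i j \<otimes> word_elem w)) = \<phi> (a \<otimes> word_elem w)"
proof (cases w)
  case Nil
  then have "i \<in> I" "j = i" using w by (auto simp: valid_word_singleton)
  then show ?thesis using Nil \<phi>_mult_e[OF a, of i i] e_closed a by (simp add: word_elem_Nil)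
next
  case (Cons x w')
  have ij: "i \<in> I" "j \<in> I" using valid_word_subset[OF w] by auto
  have w': "valid_word I w" using w by (rule valid_word_tl)
  have L: "(i, j) # map fst w \<in> Lambda_seqs I" using w by (simp add: valid_word_def)
  have "\<phi> (a \<otimes> e (fst (i, j)) (snd (i, j)) \<otimes> word_prod A (map letter w)) =
      (if (i, j) # map fst w \<in> Lambda_seqs I then \<phi> (a \<otimes> word_prod A (map letter w)) else 0)"
    by (rule free_units[OF a _ _ _ valid_word_centered[OF w']])
       (use L Cons in \<open>auto simp: Lambda_seqs_def\<close>)
  then show ?thesis
    using L a e_closed[OF ij] valid_word_closed[OF w'] by (simp add: m_assoc word_elem_def)
qed

lemma \<phi>_letter:
  assumes a: "a \<in> carrier A" and w: "valid_word I (((i, j), k) # w)"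
  shows "\<phi> (a \<otimes> word_elem (((i, j), k) # w)) =
    \<phi> (a \<otimes> (X i j [^] k \<otimes> word_elem w)) - moment (i, j) k * \<phi> (a \<otimes> word_elem w)"
proof -
  have ij: "i \<in> I" "j \<in> I" using valid_word_subset[OF w] by auto
  note closed = a X_closed[OF ij] e_closed[OF ij] valid_word_closed[OF valid_word_tl[OF w]]
  have "a \<otimes> word_elem (((i, j), k) # w) =
    a \<otimes> (X i j [^] k \<otimes> word_elem w) \<oplus> (- moment (i, j) k) \<odot> (a \<otimes> (e i j \<otimes> word_elem w))"
    using closed by (simp add: word_elem_Cons letter_def l_distr r_distr smult_mult_left smult_mult_right)
  then show ?thesis
    using closed \<phi>_unit_word[OF a w] by (simp add: \<phi>_add \<phi>_smult)
qed

text \<open>\<open>X i j\<close> times the letter is the next power minus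
  \<open>moment (i, j) k\<close> times \<open>X i j\<close>. Recentring the power by
  \<open>\<phi>_letter\<close> produces the term in which the letter disappears.\<close>

lemma \<phi>_top:
  assumes a: "a \<in> carrier A" and w: "valid_word I (((i, j), k) # w)"
  shows "\<phi> (a \<otimes> (X i j \<otimes> word_elem (((i, j), k) # w))) =
    \<phi> (a \<otimes> word_elem (((i, j), Suc k) # w)) + moment (i, j) (Suc k) * \<phi> (a \<otimes> word_elem w)
      - moment (i, j) k * \<phi> (a \<otimes> word_elem (((i, j), 1) # w))"
proof -
  have ij: "i \<in> I" "j \<in> I" using valid_word_subset[OF w] by auto
  note closed = a X_closed[OF ij] e_closed[OF ij] valid_word_closed[OF valid_word_tl[OF w]]
  have "X i j \<otimes> (X i j [^] k) = X i j [^] Suc k"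
    using closed by (simp only: nat_pow_Suc2)
  then have "X i j \<otimes> letter ((i, j), k) = X i j [^] Suc k \<oplus> (- moment (i, j) k) \<odot> X i j"
    using closed X_e[OF ij] by (simp add: letter_def r_distr smult_mult_right)
  then have "a \<otimes> (X i j \<otimes> word_elem (((i, j), k) # w)) =
    a \<otimes> (X i j [^] Suc k \<otimes> word_elem w) \<oplus> (- moment (i, j) k) \<odot> (a \<otimes> (X i j \<otimes> word_elem w))"
    using closed letter_closed[OF ij, of k]
    by (simp add: word_elem_Cons m_assoc[symmetric] l_distr r_distr smult_mult_left smult_mult_right del: nat_pow_Suc)
  moreover have "word_elem (((i, j), 1) # w) = X i j \<otimes> word_elem w"
    using letter_1[OF ij] by (simp add: word_elem_Cons)
  ultimately show ?thesis
    using \<phi>_letter[OF a valid_word_exponent[OF w, of "Suc k"]] closed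
    by (simp add: \<phi>_add \<phi>_smult del: nat_pow_Suc)
qed

section \<open>Recursion for the moments of the sum\<close>

definition S :: 'a where "S = (\<Oplus>i\<in>I. \<Oplus>j\<in>I. X i j)"

lemma S_closed: "S \<in> carrier A"
  unfolding S_def using X_closed by (intro finsum_closed) auto

lemma additive_finsum:
  assumes add: "\<And>x y. x \<in> carrier A \<Longrightarrow> y \<in> carrier A \<Longrightarrow> L (x \<oplus> y) = L x + (L y :: complex)"
    and fin: "finite J" and f: "f \<in> J \<rightarrow> carrier A"
  shows "L (\<Oplus>i\<in>J. f i) = (\<Sum>i\<in>J. L (f i))"
  using fin f
proof (induction J rule: finite_induct)
  case empty
  have "L \<zero> = L \<zero> + L \<zero>" using add[of \<zero> \<zero>] by simp
  then show ?case by simp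
next
  case (insert x J)
  then show ?case by (simp add: add finsum_closed Pi_def)
qed

lemma \<phi>_S_word:
  assumes a: "a \<in> carrier A" and b: "b \<in> carrier A"
  shows "\<phi> (a \<otimes> (S \<otimes> b)) = (\<Sum>i\<in>I. \<Sum>j\<in>I. \<phi> (a \<otimes> (X i j \<otimes> b)))"
proof -
  define L where "L x = \<phi> (a \<otimes> (x \<otimes> b))" for x
  have add: "L (x \<oplus> y) = L x + L y" if "x \<in> carrier A" "y \<in> carrier A" for x y
    using that a b by (simp add: L_def l_distr r_distr \<phi>_add)
  have "L S = (\<Sum>i\<in>I. L (\<Oplus>j\<in>I. X i j))"
    unfolding S_def using X_closed by (intro additive_finsum add finite_I) (auto intro!: finsum_closed)
  also have "\<dots> = (\<Sum>i\<in>I. \<Sum>j\<in>I. L (X i j))"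
    using X_closed by (intro sum.cong refl additive_finsum add finite_I) auto
  finally show ?thesis by (simp add: L_def)
qed

definition S_moment :: "nat \<Rightarrow> 'i word \<Rightarrow> complex" where
  "S_moment m w = \<phi> (S [^] m \<otimes> word_elem w)"

lemma S_moment_Suc:
  assumes "valid_word I w"
  shows "S_moment (Suc m) w = (\<Sum>i\<in>I. \<Sum>j\<in>I. \<phi> (S [^] m \<otimes> (X i j \<otimes> word_elem w)))"
proof -
  have "S [^] Suc m \<otimes> word_elem w = S [^] m \<otimes> (S \<otimes> word_elem w)"
    using S_closed valid_word_closed[OF assms] by (simp add: m_assoc)
  then show ?thesis
    using \<phi>_S_word[of "S [^] m" "word_elem w"] S_closed valid_word_closed[OF assms] by (simp add: S_moment_def)
qed

lemma S_moment_0: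
  assumes "valid_word I w"
  shows "S_moment 0 w = (if w = [] then 1 else 0)"
proof (cases "w = []")
  case False
  then have L: "map fst w \<in> Lambda_seqs I" using assms by (simp add: valid_word_def)
  have "\<phi> (word_prod A (map letter w)) = 0"
    using free valid_word_centered[OF assms] L unfolding matricially_free_def Lambda_seqs_def by blast
  then show ?thesis using False valid_word_closed[OF assms] by (simp add: S_moment_def word_elem_def)
qed (simp add: S_moment_def word_elem_Nil \<phi>_one)

lemma S_moment_Nil: "S_moment (Suc m) [] = (\<Sum>i\<in>I. S_moment m [((i, i), 1)])"
proof -
  have "\<phi> (S [^] m \<otimes> (X i j \<otimes> \<one>)) = (if i = j then S_moment m [((i, i), 1)] else 0)" if "i \<in> I" "j \<in> I" for i j
    using that \<phi>_mult_X[of "S [^] m" i j] S_closed X_closed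
    by (simp add: S_moment_def word_elem_Cons word_elem_Nil letter_1)
  then have "S_moment (Suc m) [] = (\<Sum>i\<in>I. \<Sum>j\<in>I. if i = j then S_moment m [((i, i), 1)] else 0)"
    by (simp add: S_moment_Suc word_elem_Nil)
  then show ?thesis using finite_I by simp
qed

text \<open>Only the variables \<open>X l i\<close> can create a letter, and only
  \<open>X i j\<close> can act on the leading one. The two roles coincide for
  \<open>l = i = j\<close>, that is on a diagonal letter; this case is assigned to
  \<open>\<phi>_top\<close> and left out of the creation sum.\<close>

lemma S_moment_Cons:
  assumes w: "valid_word I (((i, j), k) # w)"
  shows "S_moment (Suc m) (((i, j), k) # w) =
    (\<Sum>l\<in>I. if (l, i) = (i, j) then 0 else S_moment m (((l, i), 1) # ((i, j), k) # w)) +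
    S_moment m (((i, j), Suc k) # w) + moment (i, j) (Suc k) * S_moment m w
      - moment (i, j) k * S_moment m (((i, j), 1) # w)"
proof -
  let ?w = "((i, j), k) # w"
  have ij: "i \<in> I" "j \<in> I" using valid_word_subset[OF w] by auto
  define T where "T = S_moment m (((i, j), Suc k) # w) + moment (i, j) (Suc k) * S_moment m w
      - moment (i, j) k * S_moment m (((i, j), 1) # w)"
  define f where "f l = (if (l, i) = (i, j) then 0 else S_moment m (((l, i), 1) # ?w))" for l
  have "\<phi> (S [^] m \<otimes> (X l l' \<otimes> word_elem ?w)) =
    (if l' = i then f l else 0) + (if l' = j then if l = i then T else 0 else 0)" if "l \<in> I" "l' \<in> I" for l l'
    using \<phi>_top[OF _ w, of "S [^] m"] \<phi>_creation[OF _ w that, of "S [^] m"] S_closed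
    by (auto simp: f_def T_def S_moment_def)
  then have "S_moment (Suc m) ?w =
    (\<Sum>l\<in>I. \<Sum>l'\<in>I. (if l' = i then f l else 0) + (if l' = j then if l = i then T else 0 else 0))"
    unfolding S_moment_Suc[OF w] by (intro sum.cong refl) blast
  also have "\<dots> = (\<Sum>l\<in>I. f l) + T"
    using finite_I ij by (simp add: sum.distrib)
  finally show ?thesis by (simp add: f_def T_def)
qed

end

text \<open>This detaches the numbers from the algebra: all that is left are the moments
  \<open>c\<close> of the variables and the moments \<open>s\<close> of the sum, which are attached
  to the empty word.\<close>

definition word_recursion ::
  "'i set \<Rightarrow> ('i \<times> 'i \<Rightarrow> nat \<Rightarrow> complex) \<Rightarrow> (nat \<Rightarrow> complex) \<Rightarrow> (nat \<Rightarrow> 'i word \<Rightarrow> complex) \<Rightarrow> bool" where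
  "word_recursion I c s g \<longleftrightarrow> (\<forall>m. g m [] = s m) \<and>
    (\<forall>w. valid_word I w \<longrightarrow> g 0 w = (if w = [] then 1 else 0)) \<and>
    (\<forall>m. g (Suc m) [] = (\<Sum>i\<in>I. g m [((i, i), 1)])) \<and>
    (\<forall>m i j k w. valid_word I (((i, j), k) # w) \<longrightarrow> g (Suc m) (((i, j), k) # w) =
       (\<Sum>l\<in>I. if (l, i) = (i, j) then 0 else g m (((l, i), 1) # ((i, j), k) # w)) +
       g m (((i, j), Suc k) # w) + c (i, j) (Suc k) * g m w - c (i, j) k * g m (((i, j), 1) # w)) \<and>
    (\<forall>i\<in>I. \<forall>j\<in>I. c (i, j) (Suc 0) = 0)"

lemma matricially_free_recursion:
  assumes free: "matricially_free_variables A I \<phi> \<psi> X" and I: "finite I"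
    and closed: "\<And>i j. i \<in> I \<Longrightarrow> j \<in> I \<Longrightarrow> X i j \<in> carrier A"
    and centered: "\<And>i j. i \<in> I \<Longrightarrow> j \<in> I \<Longrightarrow> state_array \<phi> \<psi> i j (X i j) = 0"
  shows "\<exists>g. word_recursion I (\<lambda>(i, j) k. state_array \<phi> \<psi> i j (X i j [^]\<^bsub>A\<^esub> k))
    (\<lambda>m. \<phi> ((\<Oplus>\<^bsub>A\<^esub>i\<in>I. \<Oplus>\<^bsub>A\<^esub>j\<in>I. X i j) [^]\<^bsub>A\<^esub> m)) g"
proof -
  obtain e where e: "matricially_free A I \<phi> \<psi> (\<lambda>i j. gen_subalgebra A {X i j, e i j}) e"
    using free unfolding matricially_free_variables_def by blast
  interpret matricially_free_array A I \<phi> \<psi> X e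
    by unfold_locales (use e I closed centered in blast)+
  have c: "(\<lambda>(i, j) k. state_array \<phi> \<psi> i j (X i j [^]\<^bsub>A\<^esub> (k :: nat))) = moment"
    by (auto simp: moment_def fun_eq_iff)
  have "S_moment m [] = \<phi> (S [^]\<^bsub>A\<^esub> m)" for m
    by (simp add: S_moment_def word_elem_Nil S_closed)
  then have "word_recursion I moment (\<lambda>m. \<phi> (S [^]\<^bsub>A\<^esub> m)) S_moment"
    unfolding word_recursion_def using S_moment_0 S_moment_Nil S_moment_Cons moment_1 by blast
  then show ?thesis unfolding c S_def by blast
qed

section \<open>Asymptotics of the recursion\<close>

lemma abs_le_sum_sum:
  fixes u :: "'i \<Rightarrow> 'j \<Rightarrow> real"
  assumes "finite I" "finite J" "i \<in> I" "j \<in> J"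
  shows "\<bar>u i j\<bar> \<le> (\<Sum>i\<in>I. \<Sum>j\<in>J. \<bar>u i j\<bar>)"
proof -
  have "\<bar>u i j\<bar> \<le> (\<Sum>j\<in>J. \<bar>u i j\<bar>)" using assms by (intro member_le_sum) auto
  also have "\<dots> \<le> (\<Sum>i\<in>I. \<Sum>j\<in>J. \<bar>u i j\<bar>)"
    using assms by (intro member_le_sum[of i I "\<lambda>i. \<Sum>j\<in>J. \<bar>u i j\<bar>"] sum_nonneg) auto
  finally show ?thesis .
qed

text \<open>The list carries the blocks of the first indices of the letters, leftmost letter first. The second
  index of a letter is the first index of the next one, and the rightmost letter is diagonal.\<close>

fun limit_moment :: "nat \<Rightarrow> (nat \<Rightarrow> real) \<Rightarrow> (nat \<Rightarrow> nat \<Rightarrow> real) \<Rightarrow> nat \<Rightarrow> nat list \<Rightarrow> real" where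
  "limit_moment r d u 0 cs = (if cs = [] then 1 else 0)"
| "limit_moment r d u (Suc m) [] = (\<Sum>k=1..r. d k * limit_moment r d u m [k])"
| "limit_moment r d u (Suc m) (x # cs) = (\<Sum>k=1..r. d k * limit_moment r d u m (k # x # cs)) +
     u x (if cs = [] then x else hd cs) * limit_moment r d u m cs"

text \<open>The bound is independent of the length of \<open>cs\<close>, as it must be: each step of
  the recursion can lengthen the list.\<close>

lemma limit_moment_bounded:
  "\<exists>B\<ge>0. \<forall>cs. set cs \<subseteq> {1..r} \<longrightarrow> \<bar>limit_moment r d u m cs\<bar> \<le> B"
proof (induction m)
  case 0
  show ?case by (intro exI[of _ 1]) simp
next
  case (Suc m)
  then obtain B where B: "B \<ge> 0" "\<And>cs. set cs \<subseteq> {1..r} \<Longrightarrow> \<bar>limit_moment r d u m cs\<bar> \<le> B" by blast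
  define U where "U = (\<Sum>i=1..r. \<Sum>j=1..r. \<bar>u i j\<bar>)"
  have U: "\<bar>u i j\<bar> \<le> U" if "i \<in> {1..r}" "j \<in> {1..r}" for i j
    unfolding U_def using that by (intro abs_le_sum_sum) auto
  have U0: "U \<ge> 0" unfolding U_def by (intro sum_nonneg) auto
  have D: "\<bar>\<Sum>k=1..r. d k * limit_moment r d u m (k # cs)\<bar> \<le> (\<Sum>k=1..r. \<bar>d k\<bar>) * B" if "set cs \<subseteq> {1..r}" for cs
  proof -
    have "\<bar>\<Sum>k=1..r. d k * limit_moment r d u m (k # cs)\<bar> \<le> (\<Sum>k=1..r. \<bar>d k\<bar> * B)"
    proof (rule order_trans[OF sum_abs sum_mono])
      fix k assume "k \<in> {1..r}"
      then show "\<bar>d k * limit_moment r d u m (k # cs)\<bar> \<le> \<bar>d k\<bar> * B"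
        using B(2)[of "k # cs"] that by (simp add: abs_mult mult_left_mono)
    qed
    then show ?thesis by (simp add: sum_distrib_right)
  qed
  have D0: "(\<Sum>k=1..r. \<bar>d k\<bar>) * B \<ge> 0" using B by (intro mult_nonneg_nonneg sum_nonneg) auto
  show ?case
  proof (intro exI[of _ "(\<Sum>k=1..r. \<bar>d k\<bar>) * B + U * B"] conjI allI impI)
    show "0 \<le> (\<Sum>k=1..r. \<bar>d k\<bar>) * B + U * B" using D0 U0 B by simp
    fix cs assume cs: "set cs \<subseteq> {1..r}"
    show "\<bar>limit_moment r d u (Suc m) cs\<bar> \<le> (\<Sum>k=1..r. \<bar>d k\<bar>) * B + U * B"
    proof (cases cs)
      case Nil
      have "U * B \<ge> 0" using U0 B by simp
      then show ?thesis using D[of "[]"] Nil by simp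
    next
      case (Cons x cs')
      let ?y = "if cs' = [] then x else hd cs'"
      have "x \<in> {1..r}" "?y \<in> {1..r}" using cs Cons by (cases cs'; simp)+
      then have "\<bar>u x ?y * limit_moment r d u m cs'\<bar> \<le> U * B"
        unfolding abs_mult using U B(2)[of cs'] U0 cs Cons by (intro mult_mono) auto
      then show ?thesis using D[OF cs] Cons by simp
    qed
  qed
qed

text \<open>The blocks appear as colours of the indices. Only their range, their asymptotic
  densities and the dependence of the variances on them are recorded.\<close>

locale moment_recursion =
  fixes g :: "nat \<Rightarrow> nat \<Rightarrow> nat word \<Rightarrow> complex"
    and c :: "nat \<Rightarrow> nat \<times> nat \<Rightarrow> nat \<Rightarrow> complex"
    and r :: nat and d :: "nat \<Rightarrow> real" and u :: "nat \<Rightarrow> nat \<Rightarrow> real" and colour :: "nat \<Rightarrow> nat \<Rightarrow> nat"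
  assumes g_0: "\<And>n w. n \<ge> 1 \<Longrightarrow> valid_word {1..n} w \<Longrightarrow> g n 0 w = (if w = [] then 1 else 0)"
    and g_Nil: "\<And>n m. n \<ge> 1 \<Longrightarrow> g n (Suc m) [] = (\<Sum>i=1..n. g n m [((i, i), 1)])"
    and g_Cons: "\<And>n m i j k w. n \<ge> 1 \<Longrightarrow> valid_word {1..n} (((i, j), k) # w) \<Longrightarrow>
      g n (Suc m) (((i, j), k) # w) =
        (\<Sum>l=1..n. if (l, i) = (i, j) then 0 else g n m (((l, i), 1) # ((i, j), k) # w)) +
        g n m (((i, j), Suc k) # w) + c n (i, j) (Suc k) * g n m w - c n (i, j) k * g n m (((i, j), 1) # w)"
    and c_1: "\<And>n i j. n \<ge> 1 \<Longrightarrow> i \<in> {1..n} \<Longrightarrow> j \<in> {1..n} \<Longrightarrow> c n (i, j) (Suc 0) = 0"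
    and c_2: "\<And>n i j. n \<ge> 1 \<Longrightarrow> i \<in> {1..n} \<Longrightarrow> j \<in> {1..n} \<Longrightarrow>
      c n (i, j) 2 = of_real (u (colour n i) (colour n j) / real n)"
    and c_bound: "\<And>k. \<exists>M\<ge>0. \<forall>n\<ge>1. \<forall>i\<in>{1..n}. \<forall>j\<in>{1..n}. norm (c n (i, j) k) \<le> M * (1 / sqrt (real n)) ^ k"
    and colour: "\<And>n i. n \<ge> 1 \<Longrightarrow> i \<in> {1..n} \<Longrightarrow> colour n i \<in> {1..r}"
    and density: "\<And>k. k \<in> {1..r} \<Longrightarrow> (\<lambda>n. real (card {i \<in> {1..n}. colour n i = k}) / real n) \<longlonglongrightarrow> d k"
begin

text \<open>A centred power of exponent \<open>k\<close> needs at least one further factor, hence \<open>k + 1\<close>.\<close>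

definition weight :: "nat word \<Rightarrow> nat" where
  "weight w = (\<Sum>x\<leftarrow>w. Suc (snd x))"

lemma weight_simps [simp]: "weight [] = 0" "weight ((p, k) # w) = Suc k + weight w"
  by (simp_all add: weight_def)

text \<open>With \<open>t = 1 / sqrt n\<close> every term of the recursion is balanced. Creation has
  \<open>n\<close> choices and adds weight 2. Raising the exponent gains a factor \<open>t\<close>.
  Removing the leading letter brings a moment of size \<open>t ^ Suc k\<close>, exactly the weight
  lost. The last term gains a factor \<open>t\<close>. The leading exponent may grow by one, so the
  induction hypothesis is taken at \<open>Suc K\<close>.\<close>

lemma g_bound:
  "\<exists>C\<ge>0. \<forall>n\<ge>1. \<forall>w. valid_word {1..n} w \<and> (\<forall>x\<in>set w. snd x \<le> K) \<longrightarrow>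
     norm (g n m w) \<le> C * (1 / sqrt (real n)) ^ weight w"
proof (induction m arbitrary: K)
  case 0
  show ?case
  proof (intro exI[of _ 1] conjI allI impI)
    fix n :: nat and w assume "n \<ge> 1" "valid_word {1..n} w \<and> (\<forall>x\<in>set w. snd x \<le> K)"
    then show "norm (g n 0 w) \<le> 1 * (1 / sqrt (real n)) ^ weight w" using g_0[of n w] by simp
  qed simp
next
  case (Suc m)
  obtain C where C: "C \<ge> 0" "\<And>n w. n \<ge> 1 \<Longrightarrow> valid_word {1..n} w \<Longrightarrow> (\<And>x. x \<in> set w \<Longrightarrow> snd x \<le> Suc K) \<Longrightarrow>
     norm (g n m w) \<le> C * (1 / sqrt (real n)) ^ weight w" using Suc[of "Suc K"] by blast
  obtain M where M: "\<And>k. M k \<ge> 0"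
    "\<And>k n i j. n \<ge> 1 \<Longrightarrow> i \<in> {1..n} \<Longrightarrow> j \<in> {1..n} \<Longrightarrow> norm (c n (i, j) k) \<le> M k * (1 / sqrt (real n)) ^ k"
    using c_bound by metis
  define N where "N = (\<Sum>k\<le>Suc K. M k)"
  have MN: "M k \<le> N" if "k \<le> Suc K" for k
    unfolding N_def using that M(1) by (intro member_le_sum) auto
  have N0: "N \<ge> 0" unfolding N_def using M(1) by (intro sum_nonneg) auto
  show ?case
  \<comment> \<open>Creation and raised exponent contribute \<open>C\<close> each, the two terms
    with a moment factor \<open>N * C\<close> each.\<close>
  proof (intro exI[of _ "2 * C + 2 * (N * C)"] conjI allI impI, goal_cases)
    case 1
    show ?case using C N0 by simp
  next
    case (2 n w)
    define t where "t = 1 / sqrt (real n)"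
    have t: "0 < t" "t \<le> 1" "real n * t ^ 2 = 1" using 2(1) by (simp_all add: t_def power_divide)
    have n: "n \<ge> 1" and w: "valid_word {1..n} w" and K: "\<And>x. x \<in> set w \<Longrightarrow> snd x \<le> K" using 2 by auto
    have N1: "norm (c n (i, j) k) \<le> N * t ^ k" if "i \<in> {1..n}" "j \<in> {1..n}" "k \<le> Suc K" for i j k
    proof -
      have "norm (c n (i, j) k) \<le> M k * t ^ k" using M(2)[OF n that(1,2)] by (simp only: t_def)
      also have "\<dots> \<le> N * t ^ k" using MN[OF that(3)] t(1) by (intro mult_right_mono) auto
      finally show ?thesis .
    qed
    have CN: "0 \<le> N * C" using N0 C by simp
    show ?case
    proof (cases w)
      case Nil
      have "norm (g n (Suc m) []) \<le> (\<Sum>i=1..n. C * t ^ 2)"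
        unfolding g_Nil[OF n]
      proof (rule sum_norm_le)
        fix i assume "i \<in> {1..n}"
        show "norm (g n m [((i, i), 1)]) \<le> C * t ^ 2"
        proof -
          have "norm (g n m [((i, i), 1)]) \<le> C * t ^ weight [((i, i), 1)]"
            unfolding t_def by (rule C(2)[OF n]) (use \<open>i \<in> {1..n}\<close> in \<open>auto simp: valid_word_singleton\<close>)
          then show ?thesis by (simp add: power2_eq_square)
        qed
      qed
      also have "\<dots> = C * (real n * t ^ 2)" by simp
      also have "\<dots> = C" unfolding t(3) by simp
      also have "\<dots> \<le> 2 * C + 2 * (N * C)" using C(1) CN by simp
      finally show ?thesis using Nil by simp
    next
      case (Cons x w')
      obtain i j k where x: "x = ((i, j), k)" by (metis surj_pair)
      have w1: "valid_word {1..n} (((i, j), k) # w')" using w Cons x by simp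
      have ij: "i \<in> {1..n}" "j \<in> {1..n}" and k1: "k \<ge> 1"
        using w1 by (auto simp: valid_word_def Lambda_seqs_def)
      have w': "valid_word {1..n} w'" using w1 by (rule valid_word_tl)
      have k: "k \<le> K" using K[of x] Cons x by simp
      have K': "\<And>x. x \<in> set w' \<Longrightarrow> snd x \<le> Suc K" using K Cons by (force intro: le_SucI)
      define s where "s = t ^ (Suc k + weight w')"
      have s0: "s \<ge> 0" using t by (simp add: s_def)
      have a1: "norm (\<Sum>l=1..n. if (l, i) = (i, j) then 0 else g n m (((l, i), 1) # ((i, j), k) # w')) \<le> C * s"
      proof -
        have "norm (\<Sum>l=1..n. if (l, i) = (i, j) then 0 else g n m (((l, i), 1) # ((i, j), k) # w')) \<le> (\<Sum>l=1..n. C * (t ^ 2 * s))"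
        proof (rule sum_norm_le)
          fix l assume l: "l \<in> {1..n}"
          have "norm (g n m (((l, i), 1) # ((i, j), k) # w')) \<le> C * (t ^ 2 * s)" if "(l, i) \<noteq> (i, j)"
          proof -
            have v: "valid_word {1..n} (((l, i), 1) # ((i, j), k) # w')"
              using that l w1 by (simp add: valid_word_Cons_Cons)
            have "snd x \<le> Suc K" if "x \<in> set (((l, i), 1) # ((i, j), k) # w')" for x
              using that k K'[of x] by auto
            from C(2)[OF n v this]
            have "norm (g n m (((l, i), 1) # ((i, j), k) # w')) \<le> C * t ^ (2 + (Suc k + weight w'))"
              by (simp add: t_def)
            then show ?thesis by (simp only: s_def power_add)
          qed
          then show "norm (if (l, i) = (i, j) then 0 else g n m (((l, i), 1) # ((i, j), k) # w')) \<le> C * (t ^ 2 * s)"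
            using C(1) s0 by simp
        qed
        also have "\<dots> = real n * t ^ 2 * (C * s)" by simp
        also have "\<dots> = C * s" unfolding t(3) by simp
        finally show ?thesis .
      qed
      have a2: "norm (g n m (((i, j), Suc k) # w')) \<le> C * s"
      proof -
        have "norm (g n m (((i, j), Suc k) # w')) \<le> C * t ^ (Suc (Suc k) + weight w')"
        proof -
          have v: "valid_word {1..n} (((i, j), Suc k) # w')" using w1 by (rule valid_word_exponent) simp
          have "snd x \<le> Suc K" if "x \<in> set (((i, j), Suc k) # w')" for x using that k K'[of x] by auto
          from C(2)[OF n v this] show ?thesis by (simp only: t_def weight_simps)
        qed
        also have "\<dots> \<le> C * s"
          unfolding s_def using C(1) t(1,2) by (intro mult_left_mono power_decreasing) auto
        finally show ?thesis .
      qed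
      have a3: "norm (c n (i, j) (Suc k) * g n m w') \<le> N * C * s"
      proof -
        have "norm (c n (i, j) (Suc k) * g n m w') \<le> (N * t ^ Suc k) * (C * t ^ weight w')"
          unfolding norm_mult
        proof (rule mult_mono)
          show "norm (c n (i, j) (Suc k)) \<le> N * t ^ Suc k" using N1[OF ij, of "Suc k"] k by simp
          show "norm (g n m w') \<le> C * t ^ weight w'" unfolding t_def by (rule C(2)[OF n w' K'])
        qed (use N0 t(1) in auto)
        also have "\<dots> = N * C * s" by (simp add: s_def power_add)
        finally show ?thesis .
      qed
      have a4: "norm (c n (i, j) k * g n m (((i, j), 1) # w')) \<le> N * C * s"
      proof -
        have g1: "norm (g n m (((i, j), 1) # w')) \<le> C * t ^ (Suc 1 + weight w')"
        proof -
          have v: "valid_word {1..n} (((i, j), 1) # w')" using w1 by (rule valid_word_exponent) simp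
          have "snd x \<le> Suc K" if "x \<in> set (((i, j), 1) # w')" for x using that K'[of x] by auto
          from C(2)[OF n v this] show ?thesis by (simp only: t_def weight_simps)
        qed
        have "norm (c n (i, j) k * g n m (((i, j), 1) # w')) \<le> (N * t ^ k) * (C * t ^ (Suc 1 + weight w'))"
          unfolding norm_mult
        proof (rule mult_mono[OF _ g1])
          show "norm (c n (i, j) k) \<le> N * t ^ k" using N1[OF ij, of k] k by simp
        qed (use N0 t(1) in auto)
        also have "\<dots> = N * C * (t ^ (Suc (Suc k) + weight w'))" by (simp add: power_add power2_eq_square)
        also have "\<dots> \<le> N * C * s"
          unfolding s_def using CN t(1,2) by (intro mult_left_mono power_decreasing) auto
        finally show ?thesis .
      qed
      have "norm (g n (Suc m) w) \<le> C * s + C * s + N * C * s + N * C * s"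
        unfolding Cons x g_Cons[OF n w1]
        by (rule order_trans[OF norm_triangle_ineq4 add_mono[OF norm_triangle_le[OF add_mono[OF norm_triangle_le[OF add_mono[OF a1 a2]] a3]] a4]])
      also have "\<dots> = (2 * C + 2 * (N * C)) * s" by (simp add: algebra_simps)
      finally show ?thesis using Cons x by (simp add: s_def t_def)
    qed
  qed
qed

text \<open>The exceptional index \<open>i\<close> accounts for the one missing in the creation sum
  over a diagonal letter: there \<open>f\<close> is 0 while the limit need not be. A single error of
  size \<open>B\<close> is divided by \<open>n\<close>.\<close>

lemma colour_average:
  assumes n: "n \<ge> 1" and B: "\<And>k. k \<in> {1..r} \<Longrightarrow> \<bar>L k\<bar> \<le> B"
    and f: "\<And>l. l \<in> {1..n} \<Longrightarrow> norm (f l - of_real (L (colour n l))) \<le> \<epsilon> + (if l = i then B else 0)"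
    and B0: "B \<ge> 0"
  shows "norm ((\<Sum>l=1..n. f l) / of_nat n - complex_of_real (\<Sum>k=1..r. d k * L k)) \<le>
    \<epsilon> + B / real n + B * (\<Sum>k=1..r. \<bar>real (card {l \<in> {1..n}. colour n l = k}) / real n - d k\<bar>)"
proof -
  define N where "N k = real (card {l \<in> {1..n}. colour n l = k})" for k
  have "(\<Sum>l=1..n. L (colour n l)) = (\<Sum>k=1..r. \<Sum>l\<in>{l \<in> {1..n}. colour n l = k}. L (colour n l))"
    using colour[OF n] by (intro sum.group[symmetric]) auto
  also have "\<dots> = (\<Sum>k=1..r. N k * L k)" by (intro sum.cong) (auto simp: N_def)
  finally have L: "(\<Sum>l=1..n. L (colour n l)) = (\<Sum>k=1..r. N k * L k)" .
  have 1: "norm ((\<Sum>l=1..n. f l) - of_real (\<Sum>l=1..n. L (colour n l))) \<le> real n * \<epsilon> + B"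
  proof -
    have "(\<Sum>l=1..n. f l) - of_real (\<Sum>l=1..n. L (colour n l)) = (\<Sum>l=1..n. f l - of_real (L (colour n l)))"
      by (simp add: sum_subtractf)
    also have "norm \<dots> \<le> (\<Sum>l=1..n. \<epsilon> + (if l = i then B else 0))" by (rule sum_norm_le[OF f])
    also have "\<dots> = real n * \<epsilon> + (if i \<in> {1..n} then B else 0)" by (simp add: sum.distrib)
    also have "\<dots> \<le> real n * \<epsilon> + B" using B0 by simp
    finally show ?thesis .
  qed
  have 2: "\<bar>(\<Sum>k=1..r. N k * L k) / real n - (\<Sum>k=1..r. d k * L k)\<bar> \<le> B * (\<Sum>k=1..r. \<bar>N k / real n - d k\<bar>)"
  proof -
    have "(\<Sum>k=1..r. N k * L k) / real n - (\<Sum>k=1..r. d k * L k) = (\<Sum>k=1..r. (N k / real n - d k) * L k)"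
      by (simp add: sum_divide_distrib sum_subtractf[symmetric] algebra_simps)
    also have "\<bar>\<dots>\<bar> \<le> (\<Sum>k=1..r. \<bar>N k / real n - d k\<bar> * B)"
      by (rule order_trans[OF sum_abs sum_mono]) (use B in \<open>auto simp: abs_mult intro!: mult_left_mono\<close>)
    finally show ?thesis by (simp add: sum_distrib_left mult.commute)
  qed
  have "(\<Sum>l=1..n. f l) / of_nat n - complex_of_real (\<Sum>k=1..r. d k * L k) =
    ((\<Sum>l=1..n. f l) - of_real (\<Sum>l=1..n. L (colour n l))) / of_nat n +
    of_real ((\<Sum>k=1..r. N k * L k) / real n - (\<Sum>k=1..r. d k * L k))"
    unfolding L by (simp add: diff_divide_distrib)
  also have "norm \<dots> \<le> (real n * \<epsilon> + B) / real n + B * (\<Sum>k=1..r. \<bar>N k / real n - d k\<bar>)"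
  proof (rule norm_triangle_le[OF add_mono])
    show "norm (((\<Sum>l=1..n. f l) - of_real (\<Sum>l=1..n. L (colour n l))) / of_nat n) \<le> (real n * \<epsilon> + B) / real n"
      using 1 unfolding norm_divide norm_of_nat by (rule divide_right_mono) simp
    show "norm (complex_of_real ((\<Sum>k=1..r. N k * L k) / real n - (\<Sum>k=1..r. d k * L k))) \<le> B * (\<Sum>k=1..r. \<bar>N k / real n - d k\<bar>)"
      using 2 by (simp only: norm_of_real)
  qed
  also have "\<dots> = \<epsilon> + B / real n + B * (\<Sum>k=1..r. \<bar>N k / real n - d k\<bar>)"
    using n by (simp add: add_divide_distrib)
  finally show ?thesis by (simp add: N_def)
qed

definition colours :: "nat \<Rightarrow> nat word \<Rightarrow> nat list" where
  "colours n w = map (\<lambda>x. colour n (fst (fst x))) w"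

lemma colours_simps [simp]:
  "colours n [] = []" "colours n (((i, j), k) # w) = colour n i # colours n w"
  by (simp_all add: colours_def)

lemma colours_subset: "n \<ge> 1 \<Longrightarrow> valid_word {1..n} w \<Longrightarrow> set (colours n w) \<subseteq> {1..r}"
proof -
  assume n: "n \<ge> 1" and w: "valid_word {1..n} w"
  have "set (map fst w) \<subseteq> {1..n} \<times> {1..n}" using w by (auto simp: valid_word_def Lambda_seqs_def)
  then have "fst (fst x) \<in> {1..n}" if "x \<in> set w" for x using that by (metis imageI list.set_map mem_Times_iff subsetD)
  then show "set (colours n w) \<subseteq> {1..r}" unfolding colours_def set_map using colour[OF n] by blast
qed

abbreviation "L \<equiv> limit_moment r d u"

text \<open>A word of exponents 1 has weight twice its length, hence the scaling by a power of
  \<open>n\<close>. The error must be uniform in the word, because each step averages over up to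
  \<open>n\<close> longer words.\<close>

lemma g_limit:
  "\<exists>\<epsilon>. \<epsilon> \<longlonglongrightarrow> (0::real) \<and> (\<forall>n\<ge>1. \<forall>w. valid_word {1..n} w \<and> (\<forall>x\<in>set w. snd x = 1) \<longrightarrow>
     norm (of_nat n ^ length w * g n m w - of_real (L m (colours n w))) \<le> \<epsilon> n)"
proof (induction m)
  case 0
  show ?case
  proof (intro exI[of _ "\<lambda>_. 0"] conjI allI impI)
    fix n :: nat and w assume "n \<ge> 1" "valid_word {1..n} w \<and> (\<forall>x\<in>set w. snd x = 1)"
    then show "norm (of_nat n ^ length w * g n 0 w - of_real (L 0 (colours n w))) \<le> 0"
      using g_0[of n w] by (simp add: colours_def)
  qed simp
next
  case (Suc m)
  then obtain \<epsilon> where \<epsilon>: "\<epsilon> \<longlonglongrightarrow> 0" "\<And>n w. n \<ge> 1 \<Longrightarrow> valid_word {1..n} w \<Longrightarrow> (\<And>x. x \<in> set w \<Longrightarrow> snd x = 1) \<Longrightarrow>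
     norm (of_nat n ^ length w * g n m w - of_real (L m (colours n w))) \<le> \<epsilon> n" by blast
  have \<epsilon>0: "\<epsilon> n \<ge> 0" if "n \<ge> 1" for n
    using \<epsilon>(2)[OF that, of "[]"] by (simp add: order_trans[OF norm_ge_zero])
  obtain B where B: "B \<ge> 0" "\<And>cs. set cs \<subseteq> {1..r} \<Longrightarrow> \<bar>L m cs\<bar> \<le> B"
    using limit_moment_bounded by blast
  obtain C where C: "C \<ge> 0" "\<And>n w. n \<ge> 1 \<Longrightarrow> valid_word {1..n} w \<Longrightarrow> (\<And>x. x \<in> set w \<Longrightarrow> snd x \<le> 2) \<Longrightarrow>
     norm (g n m w) \<le> C * (1 / sqrt (real n)) ^ weight w" using g_bound[of 2 m] by blast
  define U where "U = (\<Sum>i=1..r. \<Sum>j=1..r. \<bar>u i j\<bar>)"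
  have U: "\<bar>u i j\<bar> \<le> U" if "i \<in> {1..r}" "j \<in> {1..r}" for i j
    unfolding U_def using that by (intro abs_le_sum_sum) auto
  have U0: "U \<ge> 0" unfolding U_def by (intro sum_nonneg) auto
  define \<delta> where "\<delta> n = (\<Sum>k=1..r. \<bar>real (card {l \<in> {1..n}. colour n l = k}) / real n - d k\<bar>)" for n
  have \<delta>0: "\<delta> n \<ge> 0" for n unfolding \<delta>_def by (intro sum_nonneg) auto
  have "\<delta> \<longlonglongrightarrow> (\<Sum>k=1..r. \<bar>d k - d k\<bar>)" unfolding \<delta>_def by (intro tendsto_intros density)
  then have \<delta>: "\<delta> \<longlonglongrightarrow> 0" by simp
  \<comment> \<open>The first three terms come from averaging over creations, the fourth from a
    letter of exponent 2, the last from removing the leading letter with its variance.\<close>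
  define \<eta> where "\<eta> n = \<epsilon> n + B / real n + B * \<delta> n + C * (1 / sqrt (real n)) + U * \<epsilon> n" for n
  have sq: "(\<lambda>n. 1 / sqrt (real n)) \<longlonglongrightarrow> 0"
    by (rule tendsto_divide_0[OF tendsto_const]) (intro filterlim_at_top_imp_at_infinity
      filterlim_compose[OF sqrt_at_top filterlim_real_sequentially])
  have "\<eta> \<longlonglongrightarrow> 0 + 0 + B * 0 + C * 0 + U * 0"
    unfolding \<eta>_def by (intro tendsto_add tendsto_mult tendsto_const \<epsilon>(1) \<delta> sq lim_const_over_n)
  then have \<eta>: "\<eta> \<longlonglongrightarrow> 0" by simp
  show ?case
  proof (intro exI[of _ \<eta>] conjI \<eta> allI impI)
    fix n :: nat and w assume n: "n \<ge> 1" and "valid_word {1..n} w \<and> (\<forall>x\<in>set w. snd x = 1)"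
    then have w: "valid_word {1..n} w" and one: "\<forall>x\<in>set w. snd x = 1" by auto
    have n0: "(of_nat n :: complex) \<noteq> 0" using n by simp
    show "norm (of_nat n ^ length w * g n (Suc m) w - of_real (L (Suc m) (colours n w))) \<le> \<eta> n"
    proof (cases w)
      case Nil
      have "norm ((\<Sum>l=1..n. of_nat n * g n m [((l, l), 1)]) / of_nat n - complex_of_real (\<Sum>k=1..r. d k * L m [k])) \<le>
        \<epsilon> n + B / real n + B * (\<Sum>k=1..r. \<bar>real (card {l \<in> {1..n}. colour n l = k}) / real n - d k\<bar>)"
      proof (rule colour_average[OF n _ _ B(1), where i = 0])
        show "\<bar>L m [k]\<bar> \<le> B" if "k \<in> {1..r}" for k using B(2)[of "[k]"] that by simp
        show "norm (of_nat n * g n m [((l, l), 1)] - complex_of_real (L m [colour n l])) \<le> \<epsilon> n + (if l = 0 then B else 0)"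
          if "l \<in> {1..n}" for l
          using \<epsilon>(2)[OF n, of "[((l, l), 1)]"] that by (simp add: valid_word_singleton)
      qed
      moreover have "(\<Sum>l=1..n. of_nat n * g n m [((l, l), 1)]) / of_nat n = g n (Suc m) []"
        unfolding g_Nil[OF n] using n0 by (simp add: sum_distrib_left[symmetric])
      moreover have "0 \<le> C * (1 / sqrt (real n))" "0 \<le> U * \<epsilon> n" using C(1) U0 \<epsilon>0[OF n] by auto
      ultimately show ?thesis unfolding Nil \<eta>_def \<delta>_def by simp
    next
      case (Cons x w')
      obtain i j k where x: "x = ((i, j), k)" by (metis surj_pair)
      then have k: "k = 1" using one Cons by simp
      have w1: "valid_word {1..n} (((i, j), 1) # w')" using w Cons x k by simp
      have ij: "i \<in> {1..n}" "j \<in> {1..n}" using w1 by (auto simp: valid_word_def Lambda_seqs_def)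
      have w': "valid_word {1..n} w'" using w1 by (rule valid_word_tl)
      have one': "\<And>x. x \<in> set w' \<Longrightarrow> snd x = 1" using one Cons by simp
      have wt: "weight w' = 2 * length w'"
        using one' by (induction w') (auto simp: weight_def)
      let ?h = "length w'"
      let ?cs = "colours n w'"
      have cs: "set (colour n i # ?cs) \<subseteq> {1..r}" using colours_subset[OF n w1] by simp
      define f where "f l = of_nat n ^ (Suc (Suc ?h)) * (if (l, i) = (i, j) then 0 else g n m (((l, i), 1) # ((i, j), 1) # w'))" for l
      have p1: "norm ((\<Sum>l=1..n. f l) / of_nat n - complex_of_real (\<Sum>k=1..r. d k * L m (k # colour n i # ?cs))) \<le>
        \<epsilon> n + B / real n + B * (\<Sum>k=1..r. \<bar>real (card {l \<in> {1..n}. colour n l = k}) / real n - d k\<bar>)"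
      proof (rule colour_average[OF n _ _ B(1), where i = i])
        show "\<bar>L m (k # colour n i # ?cs)\<bar> \<le> B" if "k \<in> {1..r}" for k
          using B(2)[of "k # colour n i # ?cs"] that cs by simp
        show "norm (f l - complex_of_real (L m (colour n l # colour n i # ?cs))) \<le> \<epsilon> n + (if l = i then B else 0)"
          if l: "l \<in> {1..n}" for l
        proof (cases "(l, i) = (i, j)")
          case True
          then show ?thesis
            using B(2)[of "colour n l # colour n i # ?cs"] cs colour[OF n l] \<epsilon>0[OF n] by (simp add: f_def)
        next
          case False
          then have v: "valid_word {1..n} (((l, i), 1) # ((i, j), 1) # w')"
            using l w1 by (auto simp: valid_word_Cons_Cons)
          have "snd x = 1" if "x \<in> set (((l, i), 1) # ((i, j), 1) # w')" for x using that one'[of x] by auto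
          from \<epsilon>(2)[OF n v this] have "norm (f l - complex_of_real (L m (colour n l # colour n i # ?cs))) \<le> \<epsilon> n"
            by (simp only: f_def False if_False list.size colours_simps add_0_right add_Suc_right)
          moreover have "\<epsilon> n \<le> \<epsilon> n + (if l = i then B else 0)" using B(1) by simp
          ultimately show ?thesis by (rule order_trans)
        qed
      qed
      \<comment> \<open>The weight of this word exceeds twice its length by one, so a factor
        \<open>1 / sqrt n\<close> survives the scaling.\<close>
      have p2: "norm (of_nat n ^ Suc ?h * g n m (((i, j), Suc 1) # w')) \<le> C * (1 / sqrt (real n))"
      proof -
        have "norm (g n m (((i, j), Suc 1) # w')) \<le> C * (1 / sqrt (real n)) ^ weight (((i, j), Suc 1) # w')"
        proof -
          have v: "valid_word {1..n} (((i, j), Suc 1) # w')" using w1 by (rule valid_word_exponent) simp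
          have "snd x \<le> 2" if "x \<in> set (((i, j), Suc 1) # w')" for x using that one'[of x] by auto
          from C(2)[OF n v this] show ?thesis .
        qed
        also have "(1 / sqrt (real n)) ^ weight (((i, j), Suc 1) # w') = (1 / sqrt (real n)) / real n ^ Suc ?h"
        proof -
          have "weight (((i, j), Suc 1) # w') = Suc (2 * Suc ?h)" by (simp add: wt)
          then have "(1 / sqrt (real n)) ^ weight (((i, j), Suc 1) # w') = (1 / sqrt (real n)) * ((1 / sqrt (real n)) ^ 2) ^ Suc ?h"
            by (simp only: power_Suc power_mult)
          also have "(1 / sqrt (real n)) ^ 2 = 1 / real n" by (simp add: power_divide)
          finally show ?thesis by (simp only: power_one_over times_divide_eq_right mult_1_right)
        qed
        finally have "real n ^ Suc ?h * norm (g n m (((i, j), Suc 1) # w')) \<le>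
          real n ^ Suc ?h * (C * ((1 / sqrt (real n)) / real n ^ Suc ?h))"
          by (rule mult_left_mono) simp
        also have "\<dots> = C * (1 / sqrt (real n))" using n by simp
        finally show ?thesis by (simp add: norm_mult norm_power)
      qed
      let ?u = "u (colour n i) (colour n j)"
      have p3: "norm (of_nat n ^ Suc ?h * (c n (i, j) (Suc 1) * g n m w') - of_real (?u * L m ?cs)) \<le> U * \<epsilon> n"
      proof -
        have "c n (i, j) (Suc 1) = of_real (?u / real n)" using c_2[OF n ij] by (simp add: numeral_2_eq_2)
        then have "of_nat n ^ Suc ?h * (c n (i, j) (Suc 1) * g n m w') - of_real (?u * L m ?cs) =
          of_real ?u * (of_nat n ^ ?h * g n m w' - of_real (L m ?cs))"
          using n0 by (simp add: right_diff_distrib)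
        also have "norm \<dots> \<le> U * \<epsilon> n"
          unfolding norm_mult norm_of_real
          using U[OF colour[OF n ij(1)] colour[OF n ij(2)]] \<epsilon>(2)[OF n w' one'] U0 by (intro mult_mono) auto
        finally show ?thesis .
      qed
      have hd: "colour n j = (if ?cs = [] then colour n i else hd ?cs)"
      proof (cases w')
        case Nil
        then show ?thesis using w1 by (auto simp: valid_word_singleton)
      next
        case (Cons y w'')
        obtain i' j' k' where y: "y = ((i', j'), k')" by (metis surj_pair)
        then have "j = i'" using w1 Cons by (simp add: valid_word_Cons_Cons)
        then show ?thesis using Cons y by simp
      qed
      have L_eq: "L (Suc m) (colours n w) = (\<Sum>k=1..r. d k * L m (k # colour n i # ?cs)) + ?u * L m ?cs"
        unfolding Cons x by (simp flip: hd)
      \<comment> \<open>The fourth term of the recursion is absent: its coefficient is the first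
        moment.\<close>
      have g_eq: "of_nat n ^ length w * g n (Suc m) w = (\<Sum>l=1..n. f l) / of_nat n +
        of_nat n ^ Suc ?h * g n m (((i, j), Suc 1) # w') + of_nat n ^ Suc ?h * (c n (i, j) (Suc 1) * g n m w')"
      proof -
        have "(\<Sum>l=1..n. f l) / of_nat n =
          of_nat n ^ Suc ?h * (\<Sum>l=1..n. if (l, i) = (i, j) then 0 else g n m (((l, i), 1) # ((i, j), 1) # w'))"
          unfolding f_def sum_distrib_left[symmetric] using n0 by simp
        then show ?thesis
          unfolding Cons x k g_Cons[OF n w1] using c_1[OF n ij] by (simp add: algebra_simps)
      qed
      have "of_nat n ^ length w * g n (Suc m) w - of_real (L (Suc m) (colours n w)) =
        ((\<Sum>l=1..n. f l) / of_nat n - of_real (\<Sum>k=1..r. d k * L m (k # colour n i # ?cs))) +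
        of_nat n ^ Suc ?h * g n m (((i, j), Suc 1) # w') +
        (of_nat n ^ Suc ?h * (c n (i, j) (Suc 1) * g n m w') - of_real (?u * L m ?cs))"
        unfolding g_eq L_eq by simp
      also have "norm \<dots> \<le> (\<epsilon> n + B / real n + B * \<delta> n) + C * (1 / sqrt (real n)) + U * \<epsilon> n"
        using norm_triangle_le[OF add_mono[OF norm_triangle_le[OF add_mono[OF p1 p2]] p3]] by (simp only: \<delta>_def)
      finally show ?thesis by (simp add: \<eta>_def)
    qed
  qed
qed

theorem g_tendsto: "(\<lambda>n. g n m []) \<longlonglongrightarrow> complex_of_real (L m [])"
proof -
  obtain \<epsilon> where \<epsilon>: "\<epsilon> \<longlonglongrightarrow> (0::real)" "\<And>n w. n \<ge> 1 \<Longrightarrow> valid_word {1..n} w \<Longrightarrow> (\<And>x. x \<in> set w \<Longrightarrow> snd x = 1) \<Longrightarrow>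
     norm (of_nat n ^ length w * g n m w - of_real (L m (colours n w))) \<le> \<epsilon> n"
    using g_limit[of m] by blast
  have "norm (g n m [] - of_real (L m [])) \<le> \<epsilon> n" if "n \<ge> 1" for n
    using \<epsilon>(2)[OF that, of "[]"] by simp
  then have "eventually (\<lambda>n. norm (g n m [] - of_real (L m [])) \<le> \<epsilon> n) sequentially"
    by (auto intro: eventually_sequentiallyI[of 1])
  from Lim_null_comparison[OF this \<epsilon>(1)] show ?thesis by (simp add: LIM_zero_iff)
qed

end

section \<open>Generating functions, boolean convolution and blocks\<close>

text \<open>Product ansatz: a letter \<open>x\<close> followed by \<open>y\<close> contributes
  \<open>fps_X * M x\<close> with weight \<open>d x * u x y\<close>, and the vacuum contributes
  \<open>M0\<close>. Summing over all letters in front of \<open>x\<close> reproduces the word times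
  the nonconstant part of \<open>M x\<close>, which is what the equation for \<open>M x\<close>
  says. The weights \<open>d\<close> turn the weighted creation sum into a plain sum.\<close>

lemma moment_fps_limit_moment:
  fixes M :: "nat \<Rightarrow> real fps"
  assumes M: "\<And>i. i \<in> {1..r} \<Longrightarrow> M i = 1 + fps_X\<^sup>2 * (\<Sum>l=1..r. fps_const (d l * u l i) * M l) * M i"
    and M0: "M0 = 1 + fps_X\<^sup>2 * (\<Sum>l=1..r. fps_const (d l * u l l) * M l) * M0"
  shows "fps_nth M0 m = limit_moment r d u m []"
proof -
  \<comment> \<open>\<open>F cs\<close> is the generating function in \<open>m\<close> of the limit moments, weighted by the block dimensions.\<close>
  define F where "F cs = rec_list M0 (\<lambda>x cs y. fps_const (d x * u x (if cs = [] then x else hd cs)) * fps_X * M x * y) cs" for cs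
  have F_Nil: "F [] = M0" and F_Cons: "F (x # cs) = fps_const (d x * u x (if cs = [] then x else hd cs)) * fps_X * M x * F cs" for x cs
    by (simp_all add: F_def)
  have step0: "F [] = 1 + fps_X * (\<Sum>k=1..r. F [k])"
  proof -
    have "(\<Sum>k=1..r. F [k]) = fps_X * (\<Sum>l=1..r. fps_const (d l * u l l) * M l) * M0"
      by (simp add: F_Nil F_Cons sum_distrib_left sum_distrib_right mult_ac)
    then show ?thesis by (subst F_Nil, subst M0) (simp add: power2_eq_square mult.assoc)
  qed
  have step: "F (x # cs) = fps_X * (fps_const (d x * u x (if cs = [] then x else hd cs)) * F cs + (\<Sum>k=1..r. F (k # x # cs)))"
    if "x \<in> {1..r}" for x cs
  proof -
    let ?\<beta> = "fps_const (d x * u x (if cs = [] then x else hd cs))"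
    have "(\<Sum>k=1..r. F (k # x # cs)) = fps_X\<^sup>2 * (\<Sum>l=1..r. fps_const (d l * u l x) * M l) * M x * (?\<beta> * F cs)"
      by (simp add: F_Cons sum_distrib_left sum_distrib_right mult_ac power2_eq_square)
    then have "?\<beta> * F cs + (\<Sum>k=1..r. F (k # x # cs)) =
      (1 + fps_X\<^sup>2 * (\<Sum>l=1..r. fps_const (d l * u l x) * M l) * M x) * (?\<beta> * F cs)"
      by (simp add: distrib_right)
    also have "\<dots> = M x * (?\<beta> * F cs)" by (simp only: M[OF that, symmetric])
    finally show ?thesis unfolding F_Cons by (simp add: mult_ac)
  qed
  have "fps_nth (F cs) m = prod_list (map d cs) * limit_moment r d u m cs" if "set cs \<subseteq> {1..r}" for cs
    using that
  proof (induction m arbitrary: cs)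
    case 0
    show ?case
    proof (cases cs)
      case Nil
      then show ?thesis by (simp only: step0) simp
    next
      case (Cons x cs')
      have "fps_nth (F (x # cs')) 0 = 0" by (subst step) (use 0 Cons in auto)
      then show ?thesis using Cons by simp
    qed
  next
    case (Suc m)
    show ?case
    proof (cases cs)
      case Nil
      have "fps_nth (F [k]) m = d k * limit_moment r d u m [k]" if "k \<in> {1..r}" for k
        using Suc.IH[of "[k]"] that by simp
      then show ?thesis unfolding Nil step0 by (simp add: fps_sum_nth)
    next
      case (Cons x cs')
      have x: "x \<in> {1..r}" and cs': "set cs' \<subseteq> {1..r}" using Suc.prems Cons by auto
      have "fps_nth (F (k # cs)) m = d k * (prod_list (map d cs) * limit_moment r d u m (k # cs))" if "k \<in> {1..r}" for k
        using Suc.IH[of "k # cs"] that Suc.prems by (simp add: mult.assoc)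
      then have "(\<Sum>k=1..r. fps_nth (F (k # cs)) m) = prod_list (map d cs) * (\<Sum>k=1..r. d k * limit_moment r d u m (k # cs))"
        by (simp add: sum_distrib_left mult.left_commute)
      then show ?thesis
        using Suc.IH[OF cs'] unfolding Cons step[OF x]
        by (simp add: fps_sum_nth algebra_simps)
    qed
  qed
  from this[of "[]"] show ?thesis by (simp add: F_Nil)
qed

lemma boolean_conv_upto_Suc:
  "s \<ge> 1 \<Longrightarrow> boolean_conv_upto \<mu> (Suc s) = boolean_conv_upto \<mu> s \<uplus>\<^sub>b \<mu> (Suc s)"
  by (simp add: boolean_conv_upto_def)

text \<open>A boolean convolution can be evaluated only after a measure with the summed K-transform
  is exhibited. Each partial sum is of the form provided by \<open>K_fraction_measures\<close>. The
  series \<open>M\<close> belong to the measures inside the fractions, not to the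
  \<open>K_measure\<close>s.\<close>

theorem K_measure_boolean:
  fixes r :: nat and b :: "nat \<Rightarrow> nat \<Rightarrow> real"
  assumes r: "r \<ge> 1" and b: "\<And>i j. i \<in> {1..r} \<Longrightarrow> j \<in> {1..r} \<Longrightarrow> b i j \<ge> 0"
  defines "\<mu>0 \<equiv> boolean_conv_upto (\<lambda>j. K_measure r b j j) r"
  shows "\<exists>M. (\<forall>j\<in>{1..r}. has_K_transform (K_measure r b j j) (K_fraction r b j j)) \<and>
    has_K_transform \<mu>0 (\<lambda>z. \<Sum>j=1..r. K_fraction r b j j z) \<and> tame_measure \<mu>0 \<and>
    (\<forall>i\<in>{1..r}. M i = 1 + fps_X\<^sup>2 * (\<Sum>l=1..r. fps_const (b l i) * M l) * M i) \<and>
    moment_fps \<mu>0 = 1 + fps_X\<^sup>2 * (\<Sum>l=1..r. fps_const (b l l) * M l) * moment_fps \<mu>0"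
proof -
  obtain \<nu> where
    K: "\<And>i j z. i \<in> {1..r} \<Longrightarrow> Im z > 0 \<Longrightarrow> K_fraction r b i j z = of_real (b i j) * cauchy_transform (\<nu> i) z"
    and M: "\<And>i. i \<in> {1..r} \<Longrightarrow>
       moment_fps (\<nu> i) = 1 + fps_X\<^sup>2 * (\<Sum>l=1..r. fps_const (b l i) * moment_fps (\<nu> l)) * moment_fps (\<nu> i)"
    and ex: "\<And>a. (\<And>l. l \<in> {1..r} \<Longrightarrow> a l \<ge> 0) \<Longrightarrow> \<exists>\<mu>. tame_measure \<mu> \<and>
       has_K_transform \<mu> (\<lambda>z. \<Sum>l=1..r. of_real (a l) * cauchy_transform (\<nu> l) z) \<and>
       moment_fps \<mu> = 1 + fps_X\<^sup>2 * (\<Sum>l=1..r. fps_const (a l) * moment_fps (\<nu> l)) * moment_fps \<mu>"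
    using K_fraction_measures[of r b, OF b] by blast
  have exJ: "\<exists>\<mu>. has_K_transform \<mu> (\<lambda>z. \<Sum>j\<in>J. K_fraction r b j j z)" if "J \<subseteq> {1..r}" for J
  proof -
    have "(\<Sum>l=1..r. of_real (if l \<in> J then b l l else 0) * cauchy_transform (\<nu> l) z) = (\<Sum>j\<in>J. K_fraction r b j j z)"
      if "Im z > 0" for z
    proof -
      have "(\<Sum>j\<in>J. K_fraction r b j j z) = (\<Sum>l\<in>J. of_real (if l \<in> J then b l l else 0) * cauchy_transform (\<nu> l) z)"
        using \<open>J \<subseteq> {1..r}\<close> K that by (intro sum.cong) auto
      also have "\<dots> = (\<Sum>l=1..r. of_real (if l \<in> J then b l l else 0) * cauchy_transform (\<nu> l) z)"
        using \<open>J \<subseteq> {1..r}\<close> by (intro sum.mono_neutral_left) auto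
      finally show ?thesis by simp
    qed
    then have iff: "has_K_transform \<mu> (\<lambda>z. \<Sum>l=1..r. of_real (if l \<in> J then b l l else 0) * cauchy_transform (\<nu> l) z) =
      has_K_transform \<mu> (\<lambda>z. \<Sum>j\<in>J. K_fraction r b j j z)" for \<mu>
      by (rule has_K_transform_cong)
    \<comment> \<open>Setting the weights outside \<open>J\<close> to zero selects any subfamily:
      singletons give the factors, initial segments the partial convolutions.\<close>
    have "(if l \<in> J then b l l else 0) \<ge> 0" if "l \<in> {1..r}" for l using b[OF that that] by simp
    from ex[of "\<lambda>l. if l \<in> J then b l l else 0", OF this]
    obtain \<mu> where "has_K_transform \<mu> (\<lambda>z. \<Sum>l=1..r. of_real (if l \<in> J then b l l else 0) * cauchy_transform (\<nu> l) z)"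
      by blast
    then show ?thesis unfolding iff by blast
  qed
  have single: "has_K_transform (K_measure r b j j) (K_fraction r b j j)" if j: "j \<in> {1..r}" for j
  proof -
    obtain \<mu> where "has_K_transform \<mu> (\<lambda>z. \<Sum>j\<in>{j}. K_fraction r b j j z)" using exJ[of "{j}"] j by blast
    then have "has_K_transform \<mu> (K_fraction r b j j)" by simp
    then show ?thesis unfolding K_measure_def by (simp add: measure_of_K_eq)
  qed
  have upto: "has_K_transform (boolean_conv_upto (\<lambda>j. K_measure r b j j) s) (\<lambda>z. \<Sum>j=1..s. K_fraction r b j j z)"
    if "s \<ge> 1" "s \<le> r" for s
    using that
  proof (induction s rule: nat_induct_at_least)
    case base
    then show ?case using single[of 1] by (simp add: boolean_conv_upto_def)
  next
    case (Suc s)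
    obtain \<mu> where \<mu>: "has_K_transform \<mu> (\<lambda>z. \<Sum>j=1..Suc s. K_fraction r b j j z)"
      using exJ[of "{1..Suc s}"] Suc.prems by auto
    have sum: "K_transform (boolean_conv_upto (\<lambda>j. K_measure r b j j) s) z + K_transform (K_measure r b (Suc s) (Suc s)) z =
      (\<Sum>j=1..Suc s. K_fraction r b j j z)" if "Im z > 0" for z
      using Suc single[of "Suc s"] that by (simp add: has_K_transform_def)
    have "has_K_transform \<mu> (\<lambda>z. K_transform (boolean_conv_upto (\<lambda>j. K_measure r b j j) s) z + K_transform (K_measure r b (Suc s) (Suc s)) z) =
      has_K_transform \<mu> (\<lambda>z. \<Sum>j=1..Suc s. K_fraction r b j j z)"
      by (rule has_K_transform_cong) (rule sum)
    with \<mu> have "has_K_transform \<mu> (\<lambda>z. K_transform (boolean_conv_upto (\<lambda>j. K_measure r b j j) s) z + K_transform (K_measure r b (Suc s) (Suc s)) z)"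
      by blast
    then have "boolean_conv_upto (\<lambda>j. K_measure r b j j) (Suc s) = \<mu>"
      unfolding boolean_conv_upto_Suc[OF Suc.hyps] boolean_conv_def by (rule measure_of_K_eq)
    then show ?case using \<mu> by simp
  qed
  from ex[of "\<lambda>l. b l l"] b obtain \<mu> where \<mu>: "tame_measure \<mu>"
    "has_K_transform \<mu> (\<lambda>z. \<Sum>l=1..r. of_real (b l l) * cauchy_transform (\<nu> l) z)"
    "moment_fps \<mu> = 1 + fps_X\<^sup>2 * (\<Sum>l=1..r. fps_const (b l l) * moment_fps (\<nu> l)) * moment_fps \<mu>"
    by blast
  have "has_K_transform \<mu> (\<lambda>z. \<Sum>l=1..r. of_real (b l l) * cauchy_transform (\<nu> l) z) =
    has_K_transform \<mu> (\<lambda>z. \<Sum>j=1..r. K_fraction r b j j z)"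
    by (rule has_K_transform_cong) (use K in \<open>auto intro!: sum.cong\<close>)
  with \<mu>(2) have "has_K_transform \<mu> (\<lambda>z. \<Sum>j=1..r. K_fraction r b j j z)" by blast
  then have "\<mu>0 = \<mu>" unfolding \<mu>0_def using upto[OF r order_refl] by (rule has_K_transform_unique[symmetric])
  then show ?thesis
    using single upto[OF r order_refl] M \<mu> unfolding \<mu>0_def
    by (intro exI[of _ "\<lambda>i. moment_fps (\<nu> i)"] conjI ballI) auto
qed

section \<open>Blocks of indices and their densities\<close>

definition block_end :: "(nat \<Rightarrow> real) \<Rightarrow> nat \<Rightarrow> nat \<Rightarrow> nat" where
  "block_end d n k = (\<Sum>l=1..k. block_size d n l)"

text \<open>Blocks may be empty for small \<open>n\<close>. An empty block ends where its
  predecessor ends, so \<open>LEAST\<close> passes over it.\<close>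

definition block_index :: "(nat \<Rightarrow> real) \<Rightarrow> nat \<Rightarrow> nat \<Rightarrow> nat" where
  "block_index d n i = (LEAST k. i \<le> block_end d n k)"

context
  fixes r :: nat and d :: "nat \<Rightarrow> real"
  assumes d_pos: "\<And>k. k \<in> {1..r} \<Longrightarrow> d k > 0" and d_sum: "(\<Sum>k=1..r. d k) = 1"
begin

text \<open>The sizes telescope; positivity of the dimensions makes the floor differences
  nonnegative, so the conversion by \<open>nat\<close> loses nothing.\<close>

lemma block_end_eq:
  assumes "k \<le> r"
  shows "int (block_end d n k) = \<lfloor>(\<Sum>l=1..k. d l) * real n\<rfloor>"
  using assms
proof (induction k)
  case 0
  show ?case by (simp add: block_end_def)
next
  case (Suc k)
  have eq: "{1..<Suc k} = {1..k}" by auto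
  have "(\<Sum>l=1..k. d l) * real n \<le> (\<Sum>l=1..Suc k. d l) * real n"
    using d_pos[of "Suc k"] Suc.prems by (intro mult_right_mono) auto
  then have "\<lfloor>(\<Sum>l=1..k. d l) * real n\<rfloor> \<le> \<lfloor>(\<Sum>l=1..Suc k. d l) * real n\<rfloor>" by (rule floor_mono)
  then have "int (block_size d n (Suc k)) = \<lfloor>(\<Sum>l=1..Suc k. d l) * real n\<rfloor> - \<lfloor>(\<Sum>l=1..k. d l) * real n\<rfloor>"
    unfolding block_size_def eq by simp
  moreover have "block_end d n (Suc k) = block_end d n k + block_size d n (Suc k)"
    by (simp add: block_end_def)
  ultimately show ?case using Suc by simp
qed

lemma block_end_mono: "k \<le> k' \<Longrightarrow> block_end d n k \<le> block_end d n k'"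
  unfolding block_end_def by (intro sum_mono2) auto

lemma block_end_last: "block_end d n r = n"
  using block_end_eq[of r n] d_sum by simp

lemma block_eq: "k \<ge> 1 \<Longrightarrow> block d n k = {block_end d n (k - 1)<..block_end d n k}"
  unfolding block_def block_end_def by (cases k) (simp_all add: atLeastLessThanSuc_atLeastAtMost)

lemma block_index:
  assumes "i \<in> {1..n}"
  shows "block_index d n i \<in> {1..r}" "i \<in> block d n (block_index d n i)"
proof -
  let ?k = "block_index d n i"
  have ir: "i \<le> block_end d n r" using assms block_end_last by simp
  have le: "i \<le> block_end d n ?k" unfolding block_index_def by (rule LeastI[of _ r]) (rule ir)
  have "?k \<le> r" unfolding block_index_def by (rule Least_le) (rule ir)
  moreover have "?k \<noteq> 0" using le assms by (intro notI) (simp add: block_end_def)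
  ultimately show k: "?k \<in> {1..r}" by simp
  have "\<not> i \<le> block_end d n (?k - 1)"
    unfolding block_index_def by (rule not_less_Least) (use \<open>?k \<noteq> 0\<close> in \<open>simp add: block_index_def\<close>)
  then show "i \<in> block d n ?k" using le k by (simp add: block_eq)
qed

lemma block_index_eq_iff:
  assumes "k \<in> {1..r}"
  shows "{i \<in> {1..n}. block_index d n i = k} = block d n k"
proof (intro equalityI subsetI)
  fix i assume i: "i \<in> block d n k"
  then have i1: "block_end d n (k - 1) < i" "i \<le> block_end d n k" using assms by (simp_all add: block_eq)
  have "block_index d n i = k"
    unfolding block_index_def
  proof (rule Least_equality)
    fix k' assume k': "i \<le> block_end d n k'"
    show "k \<le> k'"
    proof (rule ccontr)
      assume "\<not> k \<le> k'"
      then have "block_end d n k' \<le> block_end d n (k - 1)" by (intro block_end_mono) simp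
      then show False using k' i1 by simp
    qed
  qed (rule i1)
  moreover have "block_end d n k \<le> n" using block_end_mono[of k r n] block_end_last assms by simp
  ultimately show "i \<in> {i \<in> {1..n}. block_index d n i = k}" using i1 by auto
qed (use block_index in auto)

lemma block_end_density:
  assumes "k \<le> r"
  shows "(\<lambda>n. real (block_end d n k) / real n) \<longlonglongrightarrow> (\<Sum>l=1..k. d l)"
proof -
  let ?D = "\<Sum>l=1..k. d l"
  have "norm (real (block_end d n k) / real n - ?D) \<le> 1 / real n" if "n \<ge> 1" for n
  proof -
    have "real (block_end d n k) = of_int \<lfloor>?D * real n\<rfloor>"
      using block_end_eq[OF assms, of n] by (metis of_int_of_nat_eq)
    then have "\<bar>real (block_end d n k) - ?D * real n\<bar> \<le> 1" by linarith
    then have "\<bar>real (block_end d n k) - ?D * real n\<bar> / real n \<le> 1 / real n" by (rule divide_right_mono) simp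
    moreover have "real (block_end d n k) / real n - ?D = (real (block_end d n k) - ?D * real n) / real n"
      using that by (simp add: diff_divide_distrib)
    ultimately show ?thesis by simp
  qed
  then have "eventually (\<lambda>n. norm (real (block_end d n k) / real n - ?D) \<le> 1 / real n) sequentially"
    by (auto intro: eventually_sequentiallyI[of 1])
  from Lim_null_comparison[OF this lim_const_over_n] show ?thesis by (simp add: LIM_zero_iff)
qed

lemma block_density:
  assumes "k \<in> {1..r}"
  shows "(\<lambda>n. real (card {i \<in> {1..n}. block_index d n i = k}) / real n) \<longlonglongrightarrow> d k"
proof -
  have k: "k \<ge> 1" "k \<le> r" using assms by auto
  have "real (card {i \<in> {1..n}. block_index d n i = k}) / real n =
    real (block_end d n k) / real n - real (block_end d n (k - 1)) / real n" for n
    unfolding block_index_eq_iff[OF assms] block_eq[OF k(1)]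
    using block_end_mono[of "k - 1" k n] by (simp add: diff_divide_distrib)
  moreover have "(\<lambda>n. real (block_end d n k) / real n - real (block_end d n (k - 1)) / real n)
    \<longlonglongrightarrow> (\<Sum>l=1..k. d l) - (\<Sum>l=1..k - 1. d l)"
    using k by (intro tendsto_diff block_end_density) auto
  moreover have "(\<Sum>l=1..k. d l) - (\<Sum>l=1..k - 1. d l) = d k" using k by (cases k) auto
  ultimately show ?thesis by simp
qed

end

section \<open>The limit theorem\<close>

theorem theorem7p2:
  fixes A :: "nat \<Rightarrow> 'a star_algebra"
    and \<phi> :: "nat \<Rightarrow> 'a \<Rightarrow> complex"
    and \<psi> :: "nat \<Rightarrow> nat \<Rightarrow> 'a \<Rightarrow> complex"
    and X :: "nat \<Rightarrow> nat \<Rightarrow> nat \<Rightarrow> 'a"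
    and v :: "nat \<Rightarrow> nat \<Rightarrow> nat \<Rightarrow> real"
    and r :: nat
    and d :: "nat \<Rightarrow> real"
    and u :: "nat \<Rightarrow> nat \<Rightarrow> real"
  assumes "\<And>n. n \<ge> 1 \<Longrightarrow> unital_star_algebra (A n)"
    and "\<And>n. n \<ge> 1 \<Longrightarrow> state (A n) (\<phi> n)"
    and "\<And>n j. n \<ge> 1 \<Longrightarrow> j \<in> {1..n} \<Longrightarrow> state (A n) (\<psi> n j)"
    and "\<And>n i j. n \<ge> 1 \<Longrightarrow> i \<in> {1..n} \<Longrightarrow> j \<in> {1..n} \<Longrightarrow> self_adjoint (A n) (X n i j)"
    and matricial_freeness:
      "\<And>n. n \<ge> 1 \<Longrightarrow> matricially_free_variables (A n) {1..n} (\<phi> n) (\<psi> n) (X n)"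
    and mean_zero:
      "\<And>n i j. n \<ge> 1 \<Longrightarrow> i \<in> {1..n} \<Longrightarrow> j \<in> {1..n} \<Longrightarrow>
         state_array (\<phi> n) (\<psi> n) i j (X n i j) = 0"
    and variances:
      "\<And>n i j. n \<ge> 1 \<Longrightarrow> i \<in> {1..n} \<Longrightarrow> j \<in> {1..n} \<Longrightarrow>
         state_array (\<phi> n) (\<psi> n) i j (X n i j [^]\<^bsub>A n\<^esub> (2::nat)) = complex_of_real (v n i j)"
    and uniformly_bounded:
      "\<And>m::nat. \<exists>M\<ge>0. \<forall>n\<ge>1. \<forall>i\<in>{1..n}. \<forall>j\<in>{1..n}.
         norm (state_array (\<phi> n) (\<psi> n) i j (X n i j [^]\<^bsub>A n\<^esub> m)) \<le> M * real n powr (- real m / 2)"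
    and dimensions: "\<And>k. k \<in> {1..r} \<Longrightarrow> d k > 0" "(\<Sum>k=1..r. d k) = 1"
    and U_diagonal: "\<And>j. j \<in> {1..r} \<Longrightarrow> u j j > 0"
    and U_nonneg: "\<And>i j. i \<in> {1..r} \<Longrightarrow> j \<in> {1..r} \<Longrightarrow> u i j \<ge> 0"
    and blocks: "\<And>n. n \<ge> 1 \<Longrightarrow> block_form r d u n (v n)"
  shows "let B = (\<lambda>i j. d i * u i j);
             S = (\<lambda>n. \<Oplus>\<^bsub>A n\<^esub>i\<in>{1..n}. \<Oplus>\<^bsub>A n\<^esub>j\<in>{1..n}. X n i j);
             \<mu> = (\<lambda>j. K_measure r B j j);
             \<mu>0 = boolean_conv_upto \<mu> r
         in (\<forall>j\<in>{1..r}. has_K_transform (\<mu> j) (K_fraction r B j j)) \<and>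
            has_K_transform \<mu>0 (\<lambda>z. \<Sum>j=1..r. K_fraction r B j j z) \<and>
            converges_in_moments (\<lambda>n m. \<phi> n (S n [^]\<^bsub>A n\<^esub> m)) \<mu>0"
proof -
  define B where "B i j = d i * u i j" for i j
  have B: "B i j \<ge> 0" if "i \<in> {1..r}" "j \<in> {1..r}" for i j
    using dimensions(1)[OF that(1)] U_nonneg[OF that] by (simp add: B_def)
  \<comment> \<open>An empty family of dimensions would sum to 0. The fold in
    \<open>boolean_conv_upto\<close> starts from the first measure, so this is used.\<close>
  have r: "r \<ge> 1" using dimensions(2) by (cases r) auto
  define \<mu>0 where "\<mu>0 = boolean_conv_upto (\<lambda>j. K_measure r B j j) r"
  obtain M where "(\<forall>j\<in>{1..r}. has_K_transform (K_measure r B j j) (K_fraction r B j j)) \<and>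
    has_K_transform \<mu>0 (\<lambda>z. \<Sum>j=1..r. K_fraction r B j j z) \<and> tame_measure \<mu>0 \<and>
    (\<forall>i\<in>{1..r}. M i = 1 + fps_X\<^sup>2 * (\<Sum>l=1..r. fps_const (B l i) * M l) * M i) \<and>
    moment_fps \<mu>0 = 1 + fps_X\<^sup>2 * (\<Sum>l=1..r. fps_const (B l l) * M l) * moment_fps \<mu>0"
    using K_measure_boolean[of r B, OF r B] unfolding \<mu>0_def ..
  then have K: "\<forall>j\<in>{1..r}. has_K_transform (K_measure r B j j) (K_fraction r B j j)"
    and K0: "has_K_transform \<mu>0 (\<lambda>z. \<Sum>j=1..r. K_fraction r B j j z)" and tame: "tame_measure \<mu>0"
    and M: "\<And>i. i \<in> {1..r} \<Longrightarrow> M i = 1 + fps_X\<^sup>2 * (\<Sum>l=1..r. fps_const (d l * u l i) * M l) * M i"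
    and M0: "moment_fps \<mu>0 = 1 + fps_X\<^sup>2 * (\<Sum>l=1..r. fps_const (d l * u l l) * M l) * moment_fps \<mu>0"
    unfolding B_def by blast+
  have moment: "(\<integral>x. x ^ m \<partial>\<mu>0) = limit_moment r d u m []" for m
    using moment_fps_limit_moment[of r M d u, OF M M0, of m]
    by (simp add: moment_fps_def)
  let ?S = "\<lambda>n. \<Oplus>\<^bsub>A n\<^esub>i\<in>{1..n}. \<Oplus>\<^bsub>A n\<^esub>j\<in>{1..n}. X n i j"
  define c where "c n = (\<lambda>(i, j) k. state_array (\<phi> n) (\<psi> n) i j (X n i j [^]\<^bsub>A n\<^esub> (k :: nat)))" for n
  have "\<exists>g. word_recursion {1..n} (c n) (\<lambda>m. \<phi> n (?S n [^]\<^bsub>A n\<^esub> m)) g" if n: "n \<ge> 1" for n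
    unfolding c_def
  proof (rule matricially_free_recursion[OF matricial_freeness[OF n] finite_atLeastAtMost _ mean_zero[OF n]])
    show "X n i j \<in> carrier (A n)" if "i \<in> {1..n}" "j \<in> {1..n}" for i j
      using assms(4)[OF n that] by (simp add: self_adjoint_def)
  qed
  then obtain g where g: "\<And>n. n \<ge> 1 \<Longrightarrow> word_recursion {1..n} (c n) (\<lambda>m. \<phi> n (?S n [^]\<^bsub>A n\<^esub> m)) (g n)"
    by metis
  note g_rec = g[unfolded word_recursion_def]
  \<comment> \<open>The colour of an index is its block: block form makes each variance a function
    of two colours divided by \<open>n\<close>.\<close>
  interpret moment_recursion g c r d u "block_index d"
  proof
    fix k :: nat
    obtain M where M: "M \<ge> 0" "\<And>n i j. n \<ge> 1 \<Longrightarrow> i \<in> {1..n} \<Longrightarrow> j \<in> {1..n} \<Longrightarrow>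
         norm (state_array (\<phi> n) (\<psi> n) i j (X n i j [^]\<^bsub>A n\<^esub> k)) \<le> M * real n powr (- real k / 2)"
      using uniformly_bounded[of k] by blast
    have pow: "real n powr (- real k / 2) = (1 / sqrt (real n)) ^ k" if "n \<ge> 1" for n
    proof -
      have "1 / sqrt (real n) = real n powr (- (1 / 2))"
        by (simp only: powr_minus_divide powr_half_sqrt of_nat_0_le_iff)
      then have "(1 / sqrt (real n)) ^ k = real n powr (- (1 / 2) * real k)"
        using that by (simp only: powr_power) simp
      then show ?thesis by (simp only: mult_minus_left times_divide_eq_left mult_1_left minus_divide_left)
    qed
    have "norm (c n (i, j) k) \<le> M * (1 / sqrt (real n)) ^ k"
      if "n \<ge> 1" "i \<in> {1..n}" "j \<in> {1..n}" for n i j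
      using M(2)[OF that] unfolding c_def pow[OF that(1)] by (simp only: case_prod_conv)
    then show "\<exists>M\<ge>0. \<forall>n\<ge>1. \<forall>i\<in>{1..n}. \<forall>j\<in>{1..n}. norm (c n (i, j) k) \<le> M * (1 / sqrt (real n)) ^ k"
      using M(1) by blast
  next
    fix n i j :: nat assume n: "n \<ge> 1" and ij: "i \<in> {1..n}" "j \<in> {1..n}"
    have i: "block_index d n i \<in> {1..r}" "i \<in> block d n (block_index d n i)"
      using block_index[of r d, OF dimensions ij(1)] by auto
    have j: "block_index d n j \<in> {1..r}" "j \<in> block d n (block_index d n j)"
      using block_index[of r d, OF dimensions ij(2)] by auto
    have "v n i j = u (block_index d n i) (block_index d n j) / real n"
      using blocks[OF n] i j unfolding block_form_def by blast
    then show "c n (i, j) 2 = of_real (u (block_index d n i) (block_index d n j) / real n)"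
      using variances[OF n ij] by (simp add: c_def)
  next
    fix n i :: nat assume "n \<ge> 1" "i \<in> {1..n}"
    then show "block_index d n i \<in> {1..r}" using block_index[of r d, OF dimensions] by blast
  next
    fix k assume "k \<in> {1..r}"
    then show "(\<lambda>n. real (card {i \<in> {1..n}. block_index d n i = k}) / real n) \<longlonglongrightarrow> d k"
      using block_density[of r d k, OF dimensions] by blast
  qed (use g_rec in blast)+
  \<comment> \<open>The recursion is available for \<open>n \<ge> 1\<close> only, so the two
    sequences are identified eventually.\<close>
  have "(\<lambda>n. \<phi> n (?S n [^]\<^bsub>A n\<^esub> m)) \<longlonglongrightarrow> complex_of_real (\<integral>x. x ^ m \<partial>\<mu>0)" for m
  proof (rule Lim_transform_eventually[OF g_tendsto[of m, folded moment]])
    show "\<forall>\<^sub>F n in sequentially. g n m [] = \<phi> n (?S n [^]\<^bsub>A n\<^esub> m)"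
      using g_rec by (intro eventually_sequentiallyI[of 1]) blast
  qed
  moreover obtain R where R: "real_distribution \<mu>0" "AE x in \<mu>0. \<bar>x\<bar> \<le> R"
    using tame by (auto simp: tame_measure_def)
  moreover have "integrable \<mu>0 (\<lambda>x. x ^ m)" for m
    by (rule real_distribution.integrable_continuous_bounded_support[OF R]) (intro continuous_intros)
  ultimately have "converges_in_moments (\<lambda>n m. \<phi> n (?S n [^]\<^bsub>A n\<^esub> m)) \<mu>0"
    unfolding converges_in_moments_def by blast
  then show ?thesis
    using K K0 unfolding Let_def \<mu>0_def B_def[abs_def] by blast
qed

end
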